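(* Let $a \ge 0$ and $b > 0$. If $\gamma > 2^*/2$ and \[ a^{\gamma-2^*/2}\, b^{2^*/2-1} > \frac{(\gamma - 2^*/2)^{\gamma-2^*/2}\, (2^*/2 - 1)^{2^*/2-1}}{(\gamma - 1)^{\gamma-1}}\, S^{-(2^*/2)(\gamma-1)}, \] then the problem \[ \left\{\begin{aligned} - \left[a + b \left(\int_\Omega |\nabla u|^2\, dx\right)^{\gamma-1}\right] \Delta u & = \lambda u + |u|^{2^*-2}\, u && \text{in } \Omega\\ u & = 0 && \text{on } \partial\Omega \end{aligned}\right. \] has two nontrivial weak solutions for $\lambda \ge a\lambda_1$.
   Context: $\Omega$ is a bounded domain in $\mathbb{R}^N$, $N \ge 3$, and $2^* = 2N/(N-2)$. $\lambda_1 > 0$ is the first Dirichlet eigenvalue of $-\Delta$ in $\Omega$. The best Sobolev constant is $S = \inf_{u \in H^1_0(\Omega) \setminus \{0\}} \int_\Omega |\nabla u|^2\, dx \big/ \left(\int_\Omega |u|^{2^*} dx\right)^{2/2^*}$. A (weak) solution is a function $u \in H^1_0(\Omega)$ such that $\left[a + b \left(\int_\Omega |\nabla u|^2\, dx\right)^{\gamma-1}\right] \int_\Omega \nabla u \cdot \nabla v\, dx = \lambda \int_\Omega uv\, dx + \int_\Omega |u|^{2^*-2} uv\, dx$ for all $v \in H^1_0(\Omega)$; it is nontrivial if $u \neq 0$. "Two nontrivial solutions" means at least two distinct nontrivial solutions. *)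

theory Defs
  imports "HOL-Analysis.Analysis"
begin

text \<open>
  Elements of the function spaces below are represented by functions on the whole space of which only
  the values on \<open>\<Omega>\<close> matter, up to equality almost everywhere on \<open>\<Omega>\<close>.
\<close>

subsection \<open>Test functions\<close>

primrec C_k :: "nat \<Rightarrow> (real^'n \<Rightarrow> real) \<Rightarrow> bool" where
  "C_k 0 f \<longleftrightarrow> continuous_on UNIV f"
| "C_k (Suc k) f \<longleftrightarrow> (\<exists>g. (\<forall>x. GDERIV f x :> g x) \<and> (\<forall>i. C_k k (\<lambda>x. g x $ i)))"

definition gradient :: "(real^'n \<Rightarrow> real) \<Rightarrow> real^'n \<Rightarrow> real^'n" where
  "gradient f x = (THE D. GDERIV f x :> D)"

definition test_functions :: "(real^'n) set \<Rightarrow> (real^'n \<Rightarrow> real) set" where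
  "test_functions \<Omega> =
     {\<phi>. (\<forall>k. C_k k \<phi>) \<and> compact (closure {x. \<phi> x \<noteq> 0}) \<and> closure {x. \<phi> x \<noteq> 0} \<subseteq> \<Omega>}"

subsection \<open>Sobolev spaces\<close>

definition L2 :: "(real^'n) set \<Rightarrow> (real^'n \<Rightarrow> 'b::euclidean_space) set" where
  "L2 \<Omega> = {f. f \<in> borel_measurable (lebesgue_on \<Omega>) \<and>
              integrable (lebesgue_on \<Omega>) (\<lambda>x. (norm (f x))\<^sup>2)}"

text \<open>
  Local integrability is not part of this definition: it is only used for \<open>u, G \<in> L2 \<Omega>\<close>.
\<close>
definition has_weak_gradient ::
    "(real^'n) set \<Rightarrow> (real^'n \<Rightarrow> real) \<Rightarrow> (real^'n \<Rightarrow> real^'n) \<Rightarrow> bool" where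
  "has_weak_gradient \<Omega> u G \<longleftrightarrow>
     (\<forall>\<phi>\<in>test_functions \<Omega>. \<forall>i.
        (\<integral>x. u x * gradient \<phi> x $ i \<partial>lebesgue_on \<Omega>) = - (\<integral>x. G x $ i * \<phi> x \<partial>lebesgue_on \<Omega>))"

definition H1 :: "(real^'n) set \<Rightarrow> (real^'n \<Rightarrow> real) set" where
  "H1 \<Omega> = {u \<in> L2 \<Omega>. \<exists>G\<in>L2 \<Omega>. has_weak_gradient \<Omega> u G}"

text \<open>
  The weak gradient of \<open>u \<in> H1 \<Omega>\<close> is unique up to almost everywhere equality, so the choice of
  representative does not affect the integrals in which it occurs.
\<close>
definition weak_gradient :: "(real^'n) set \<Rightarrow> (real^'n \<Rightarrow> real) \<Rightarrow> real^'n \<Rightarrow> real^'n" where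
  "weak_gradient \<Omega> u = (SOME G. G \<in> L2 \<Omega> \<and> has_weak_gradient \<Omega> u G)"

definition dirichlet_form :: "(real^'n) set \<Rightarrow> (real^'n \<Rightarrow> real) \<Rightarrow> (real^'n \<Rightarrow> real) \<Rightarrow> real" where
  "dirichlet_form \<Omega> u v = (\<integral>x. weak_gradient \<Omega> u x \<bullet> weak_gradient \<Omega> v x \<partial>lebesgue_on \<Omega>)"

definition dirichlet_energy :: "(real^'n) set \<Rightarrow> (real^'n \<Rightarrow> real) \<Rightarrow> real" where
  "dirichlet_energy \<Omega> u = (\<integral>x. (norm (weak_gradient \<Omega> u x))\<^sup>2 \<partial>lebesgue_on \<Omega>)"

definition H1_norm :: "(real^'n) set \<Rightarrow> (real^'n \<Rightarrow> real) \<Rightarrow> real" where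
  "H1_norm \<Omega> u = sqrt ((\<integral>x. (u x)\<^sup>2 \<partial>lebesgue_on \<Omega>) + dirichlet_energy \<Omega> u)"

definition H10 :: "(real^'n) set \<Rightarrow> (real^'n \<Rightarrow> real) set" where
  "H10 \<Omega> = {u \<in> H1 \<Omega>. \<exists>\<phi>::nat \<Rightarrow> real^'n \<Rightarrow> real.
     (\<forall>n. \<phi> n \<in> test_functions \<Omega>) \<and> (\<lambda>n. H1_norm \<Omega> (\<lambda>x. u x - \<phi> n x)) \<longlonglongrightarrow> 0}"

definition ae_equal :: "(real^'n) set \<Rightarrow> (real^'n \<Rightarrow> real) \<Rightarrow> (real^'n \<Rightarrow> real) \<Rightarrow> bool" where
  "ae_equal \<Omega> u v \<longleftrightarrow> (AE x in lebesgue_on \<Omega>. u x = v x)"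

subsection \<open>Sobolev constant and first Dirichlet eigenvalue\<close>

definition critical_exponent :: "nat \<Rightarrow> real" where
  "critical_exponent N = 2 * real N / (real N - 2)"

definition sobolev_const :: "(real^'n) set \<Rightarrow> real" where
  "sobolev_const \<Omega> =
     (INF u \<in> {u \<in> H10 \<Omega>. \<not> ae_equal \<Omega> u (\<lambda>_. 0)}.
        dirichlet_energy \<Omega> u /
        (\<integral>x. \<bar>u x\<bar> powr critical_exponent CARD('n) \<partial>lebesgue_on \<Omega>)
          powr (2 / critical_exponent CARD('n)))"

definition dirichlet_eigenvalue :: "(real^'n) set \<Rightarrow> real \<Rightarrow> bool" where
  "dirichlet_eigenvalue \<Omega> \<mu> \<longleftrightarrow>
     (\<exists>u\<in>H10 \<Omega>. \<not> ae_equal \<Omega> u (\<lambda>_. 0) \<and>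
        (\<forall>v\<in>H10 \<Omega>. dirichlet_form \<Omega> u v = \<mu> * (\<integral>x. u x * v x \<partial>lebesgue_on \<Omega>)))"

definition first_dirichlet_eigenvalue :: "(real^'n) set \<Rightarrow> real" where
  "first_dirichlet_eigenvalue \<Omega> = Inf {\<mu>. dirichlet_eigenvalue \<Omega> \<mu>}"

subsection \<open>The Kirchhoff problem\<close>

definition weak_solution ::
    "(real^'n) set \<Rightarrow> real \<Rightarrow> real \<Rightarrow> real \<Rightarrow> real \<Rightarrow> (real^'n \<Rightarrow> real) \<Rightarrow> bool" where
  "weak_solution \<Omega> a b \<gamma> lam u \<longleftrightarrow>
     u \<in> H10 \<Omega> \<and>
     (\<forall>v\<in>H10 \<Omega>.
        (a + b * dirichlet_energy \<Omega> u powr (\<gamma> - 1)) * dirichlet_form \<Omega> u v =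
        lam * (\<integral>x. u x * v x \<partial>lebesgue_on \<Omega>) +
        (\<integral>x. \<bar>u x\<bar> powr (critical_exponent CARD('n) - 2) * u x * v x \<partial>lebesgue_on \<Omega>))"

end

theory Submission
  imports Defs "HOL-Complex_Analysis.Great_Picard"
begin

text \<open>
  The functional
  \<open>J u = a / 2 * t + b / (2 * \<gamma>) * t powr \<gamma> - lam / 2 * \<integral> u\<^sup>2 - 1 / p * \<integral> \<bar>u\<bar> powr p\<close> with \<open>t = \<integral> \<bar>\<nabla>u\<bar>\<^sup>2\<close>
  is even and its critical points are the weak solutions, so a single nontrivial critical point \<open>u\<close>
  yields the two solutions \<open>u\<close> and \<open>- u\<close>. Since \<open>\<gamma> > p / 2\<close>, \<open>J\<close> is coercive; the hypothesis on
  \<open>a\<close> and \<open>b\<close> says that the Kirchhoff term dominates the critical term at every energy level, which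
  together with the Brezis-Lieb lemma makes \<open>J\<close> weakly lower semicontinuous although the embedding
  into \<open>L\<^sup>p\<close> is not compact. Hence \<open>J\<close> attains its infimum, and \<open>lam \<ge> a \<lambda>\<^sub>1\<close> makes the infimum
  negative: test with small multiples of a first eigenfunction.

  The Sobolev inequality is derived from the translation estimate
  \<open>\<integral> \<bar>u (x + h) - u x\<bar>\<^sup>2 \<le> \<bar>h\<bar>\<^sup>2 \<integral> \<bar>\<nabla>u\<bar>\<^sup>2\<close>: averaging over the cells of a grid gives the
  inequality of Nash, which is applied to the truncations of \<open>u\<close> to the dyadic levels
  \<open>r < \<bar>u\<bar> < 2 * r\<close> and summed. The same grid estimate gives Rellich's theorem.
\<close>

subsection \<open>Smooth functions\<close>

text \<open>At the exponent \<open>p\<close> bounded energy gives only weak compactness: the part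
  \<open>w n - u\<close> that is lost in the limit may keep both energy and \<open>L\<^sup>p\<close>
  mass. It has to be charged with the sharp constant, which enters only because
  \<open>sobolev_const\<close> is defined as an infimum. The inequality obtained from the grid has a
  crude constant; it supplies what the sharp one presupposes, namely that members of
  \<open>H10 \<Omega>\<close> lie in \<open>L\<^sup>p\<close> and that the infimum is positive.
  Nash's inequality is enough for this because its cell size is free: at each level it is tuned to
  the measure of the superlevel set, and \<open>p\<close> is the exponent for which the resulting
  recursion between consecutive levels is scale invariant, so that it can be summed. Minimising
  sequences consist of test functions, whose gradients are classical, and limits carry an explicit
  gradient \<open>G\<close>; the choice inside \<open>weak_gradient\<close> is met only where
  \<open>H10\<close>, \<open>dirichlet_form\<close> and \<open>dirichlet_energy\<close> are
  unfolded.\<close>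

lemma GDERIV_unique:
  fixes f :: "'a::real_inner \<Rightarrow> real"
  assumes "GDERIV f x :> D" "GDERIV f x :> E"
  shows "D = E"
proof -
  have "(\<lambda>h. h \<bullet> D) = (\<lambda>h. h \<bullet> E)"
    using assms has_derivative_unique unfolding gderiv_def by blast
  then show ?thesis
    by (metis inner_commute vector_eq_ldot)
qed

lemma gradient_eq: "GDERIV f x :> D \<Longrightarrow> gradient f x = D"
  unfolding gradient_def by (rule the_equality) (auto intro: GDERIV_unique)

lemma GDERIV_continuous: "GDERIV f x :> D \<Longrightarrow> isCont f x"
  unfolding gderiv_def by (rule has_derivative_continuous)

text \<open>Gradient vectors are unique, so the witness hidden in \<open>C_k\<close> is always
  \<open>gradient f\<close>.\<close>

lemma C_k_Suc_iff:
  "C_k (Suc k) f \<longleftrightarrow> (\<forall>x. GDERIV f x :> gradient f x) \<and> (\<forall>i. C_k k (\<lambda>x. gradient f x $ i))"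
proof
  assume "C_k (Suc k) f"
  then obtain g where g: "\<And>x. GDERIV f x :> g x" "\<And>i. C_k k (\<lambda>x. g x $ i)" by auto
  then have "gradient f = g" using gradient_eq by blast
  then show "(\<forall>x. GDERIV f x :> gradient f x) \<and> (\<forall>i. C_k k (\<lambda>x. gradient f x $ i))"
    using g by simp
qed auto

lemma C_k_SucI:
  "\<lbrakk>\<And>x. GDERIV f x :> g x; \<And>i. C_k k (\<lambda>x. g x $ i)\<rbrakk> \<Longrightarrow> C_k (Suc k) f"
  by auto

lemma C_k_Suc_imp: "C_k (Suc k) f \<Longrightarrow> C_k k f"
proof (induction k arbitrary: f)
  case 0
  then show ?case
    using GDERIV_continuous by (fastforce intro: continuous_at_imp_continuous_on)
next
  case (Suc k)
  then show ?case by (meson C_k_Suc_iff)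
qed

lemma C_k_const: "C_k k (\<lambda>x. c)"
proof (induction k arbitrary: c)
  case (Suc k)
  have "C_k (Suc k) (\<lambda>x::real^'a. c)"
    by (rule C_k_SucI[where g="\<lambda>x. 0"]) (use Suc GDERIV_const in auto)
  then show ?case .
qed auto

lemma C_k_add: "\<lbrakk>C_k k f; C_k k g\<rbrakk> \<Longrightarrow> C_k k (\<lambda>x. f x + g x)"
proof (induction k arbitrary: f g)
  case (Suc k)
  then obtain F G where "\<And>x. GDERIV f x :> F x" "\<And>i. C_k k (\<lambda>x. F x $ i)"
    "\<And>x. GDERIV g x :> G x" "\<And>i. C_k k (\<lambda>x. G x $ i)" by auto
  then show ?case
    by (intro C_k_SucI[where g="\<lambda>x. F x + G x"] GDERIV_add) (auto intro: Suc.IH)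
qed (auto intro: continuous_intros)

lemma C_k_mult: "\<lbrakk>C_k k f; C_k k g\<rbrakk> \<Longrightarrow> C_k k (\<lambda>x. f x * g x)"
proof (induction k arbitrary: f g)
  case (Suc k)
  then obtain F G where *: "\<And>x. GDERIV f x :> F x" "\<And>i. C_k k (\<lambda>x. F x $ i)"
    "\<And>x. GDERIV g x :> G x" "\<And>i. C_k k (\<lambda>x. G x $ i)" by auto
  have "C_k k f" "C_k k g" using Suc.prems C_k_Suc_imp by blast+
  with * show ?case
    by (intro C_k_SucI[where g="\<lambda>x. f x *\<^sub>R G x + g x *\<^sub>R F x"] GDERIV_mult) (auto intro!: Suc.IH C_k_add)
qed (auto intro: continuous_intros)

lemma C_k_prod: "\<lbrakk>finite I; \<And>i. i \<in> I \<Longrightarrow> C_k k (f i)\<rbrakk> \<Longrightarrow> C_k k (\<lambda>x. \<Prod>i\<in>I. f i x)"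
  by (induction I rule: finite_induct) (auto intro: C_k_const C_k_mult)

lemma C_k_affine: "C_k k (\<lambda>x. c * x $ i + d)"
proof (cases k)
  case 0
  then show ?thesis by (auto intro!: continuous_intros)
next
  case (Suc k)
  have "C_k (Suc k) (\<lambda>x. c * x $ i + d)"
  proof (rule C_k_SucI)
    show "GDERIV (\<lambda>x. c * x $ i + d) x :> axis i c" for x :: "real^'a"
      unfolding gderiv_def inner_axis
      by (auto intro!: derivative_eq_intros bounded_linear.has_derivative[OF bounded_linear_vec_nth] simp: mult.commute)
  qed (rule C_k_const)
  then show ?thesis using Suc by simp
qed

text \<open>The outer function comes with the tower of its derivatives, and the claim is made for
  all \<open>m\<close> at once: the chain rule at \<open>m\<close> produces
  \<open>F (Suc m)\<close>, to which the induction hypothesis applies.\<close>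

lemma C_k_compose:
  assumes "\<And>m x. (F m has_real_derivative F (Suc m) x) (at x)" and "C_k k g"
  shows "C_k k (\<lambda>x. F m (g x))"
  using assms(2)
proof (induction k arbitrary: m g)
  case 0
  have "continuous_on UNIV (F m)"
    using assms(1) DERIV_isCont by (blast intro: continuous_at_imp_continuous_on)
  then show ?case
    using 0 continuous_on_compose2 by fastforce
next
  case (Suc k)
  then obtain G where *: "\<And>x. GDERIV g x :> G x" "\<And>i. C_k k (\<lambda>x. G x $ i)" by auto
  have "C_k k g" using Suc.prems C_k_Suc_imp by blast
  with * show ?case
    by (intro C_k_SucI[where g="\<lambda>x. F (Suc m) (g x) *\<^sub>R G x"] GDERIV_DERIV_compose assms(1))
       (auto intro: Suc.IH C_k_mult)
qed

subsection \<open>A smooth function vanishing on the negative half-line\<close>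

text \<open>The polynomial is a parameter because the family is closed under differentiation; the
  classical flat function is the member with \<open>q = 1\<close>.\<close>

definition flat_exp :: "real poly \<Rightarrow> real \<Rightarrow> real" where
  "flat_exp q t = (if t > 0 then poly q (1 / t) * exp (- (1 / t)) else 0)"

lemma poly_times_exp_minus_tendsto_0: "((\<lambda>s::real. poly q s * exp (- s)) \<longlongrightarrow> 0) at_top"
proof -
  have *: "((\<lambda>s::real. s ^ k * exp (- s)) \<longlongrightarrow> 0) at_top" for k
    using tendsto_power_div_exp_0[of k] by (simp add: exp_minus divide_inverse)
  have "((\<lambda>s::real. \<Sum>i\<le>degree q. coeff q i * (s ^ i * exp (- s))) \<longlongrightarrow> (\<Sum>i\<le>degree q. coeff q i * 0)) at_top"
    by (intro tendsto_sum tendsto_mult tendsto_const *)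
  then show ?thesis
    by (simp add: poly_altdef sum_distrib_right mult.assoc)
qed

text \<open>In the variable s = 1 / t one has ds/dt = - s^2, so q(s) exp(- s) has the t-derivative
  s^2 (q - q')(s) exp(- s). Only t = 0 needs a limit, and there exp(- s) beats every
  polynomial.\<close>

lemma flat_exp_deriv:
  "(flat_exp q has_real_derivative flat_exp (monom 1 2 * (q - pderiv q)) t) (at t)"
proof -
  consider "t > 0" | "t < 0" | "t = 0" by linarith
  then show ?thesis
  proof cases
    case 1
    have "((\<lambda>t. poly q (1 / t) * exp (- (1 / t))) has_real_derivative
           flat_exp (monom 1 2 * (q - pderiv q)) t) (at t)"
    proof -
      have "((\<lambda>t. 1 / t) has_real_derivative - (1 / t\<^sup>2)) (at t)"
        using 1 by (auto intro!: derivative_eq_intros simp: power2_eq_square)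
      from DERIV_mult[OF DERIV_chain2[OF poly_DERIV this] DERIV_chain2[OF DERIV_exp DERIV_minus[OF this]]]
      show ?thesis
        using 1 by (simp add: flat_exp_def poly_monom field_simps)
    qed
    then show ?thesis
      by (rule has_field_derivative_transform_within_open[of _ _ _ "{0<..}"])
         (use 1 in \<open>auto simp: flat_exp_def\<close>)
  next
    case 2
    have "((\<lambda>t::real. 0::real) has_real_derivative flat_exp (monom 1 2 * (q - pderiv q)) t) (at t)"
      using 2 by (auto simp: flat_exp_def)
    then show ?thesis
      by (rule has_field_derivative_transform_within_open[of _ _ _ "{..<0}"])
         (use 2 in \<open>auto simp: flat_exp_def\<close>)
  next
    case 3
    have r: "((\<lambda>h. flat_exp q h / h) \<longlongrightarrow> 0) (at_right 0)"
    proof -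
      \<comment> \<open>Dividing by \<open>h\<close> multiplies the polynomial by its own variable 1
        / h, hence the factor \<open>monom 1 1\<close>.\<close>
      have "((\<lambda>h::real. poly (monom 1 1 * q) (inverse h) * exp (- (inverse h))) \<longlongrightarrow> 0) (at_right 0)"
        by (rule filterlim_compose[OF poly_times_exp_minus_tendsto_0 filterlim_inverse_at_top_right])
      then show ?thesis
        by (rule Lim_transform_eventually)
           (auto simp: flat_exp_def poly_monom field_simps eventually_at_right_field intro!: exI[of _ 1])
    qed
    have l: "((\<lambda>h. flat_exp q h / h) \<longlongrightarrow> 0) (at_left 0)"
      by (rule Lim_transform_eventually[OF tendsto_const])
         (auto simp: flat_exp_def eventually_at_left_field intro!: exI[of _ "-1"])
    have "((\<lambda>h. flat_exp q h / h) \<longlongrightarrow> 0) (at 0)"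
      using l r filterlim_split_at by blast
    then show ?thesis
      using 3 by (simp add: DERIV_def flat_exp_def)
  qed
qed

definition bump :: "real \<Rightarrow> real" where "bump = flat_exp 1"

lemma bump_simps: "t > 0 \<Longrightarrow> bump t = exp (- (1 / t))" "t \<le> 0 \<Longrightarrow> bump t = 0"
  by (auto simp: bump_def flat_exp_def)

lemma bump_bounds: "0 \<le> bump t" "bump t \<le> 1"
  by (auto simp: bump_def flat_exp_def)

lemma C_k_bump: "C_k k g \<Longrightarrow> C_k k (\<lambda>x. bump (g x))"
proof -
  \<comment> \<open>The derivative of order \<open>m\<close> of \<open>bump\<close> is
    \<open>flat_exp (Q m)\<close>.\<close>
  define Q where "Q m = ((\<lambda>q. monom 1 2 * (q - pderiv q)) ^^ m) (1 :: real poly)" for m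
  assume "C_k k g"
  then have "C_k k (\<lambda>x. flat_exp (Q 0) (g x))"
    by (rule C_k_compose[of "\<lambda>m. flat_exp (Q m)", rotated]) (use flat_exp_deriv in \<open>simp add: Q_def\<close>)
  then show ?thesis by (simp add: Q_def bump_def)
qed

subsection \<open>Test functions\<close>

lemma test_functionsI:
  assumes "\<And>k. C_k k \<phi>" "compact K" "K \<subseteq> \<Omega>" "\<And>x. x \<notin> K \<Longrightarrow> \<phi> x = 0"
  shows "\<phi> \<in> test_functions \<Omega>"
proof -
  have "closure {x. \<phi> x \<noteq> 0} \<subseteq> K"
    using assms by (intro closure_minimal compact_imp_closed) auto
  moreover from this have "compact (closure {x. \<phi> x \<noteq> 0})"
    using assms(2) by (metis bounded_subset closed_closure compact_eq_bounded_closed)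
  ultimately show ?thesis
    using assms by (auto simp: test_functions_def)
qed

lemma test_functionsD:
  assumes "\<phi> \<in> test_functions \<Omega>"
  obtains K where "compact K" "K \<subseteq> \<Omega>" "\<And>x. x \<notin> K \<Longrightarrow> \<phi> x = 0"
proof (rule that)
  show "\<phi> x = 0" if "x \<notin> closure {x. \<phi> x \<noteq> 0}" for x
    using that closure_subset[of "{x. \<phi> x \<noteq> 0}"] by blast
  show "compact (closure {x. \<phi> x \<noteq> 0})" "closure {x. \<phi> x \<noteq> 0} \<subseteq> \<Omega>"
    using assms by (auto simp: test_functions_def)
qed

lemma test_functions_C_k: "\<phi> \<in> test_functions \<Omega> \<Longrightarrow> C_k k \<phi>"
  by (simp add: test_functions_def)

lemma test_functions_GDERIV: "\<phi> \<in> test_functions \<Omega> \<Longrightarrow> GDERIV \<phi> x :> gradient \<phi> x"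
  using test_functions_C_k[of \<phi> \<Omega> "Suc 0"] C_k_Suc_iff by blast

lemma gradient_eq_0:
  assumes "closed K" "\<And>x. x \<notin> K \<Longrightarrow> \<phi> x = 0" "x \<notin> K"
  shows "gradient \<phi> x = 0"
proof (rule gradient_eq)
  have "(\<phi> has_derivative (\<lambda>h. 0)) (at x)"
    by (rule has_derivative_transform_within_open[of "\<lambda>_. 0" _ _ _ "- K"]) (use assms in auto)
  then show "GDERIV \<phi> x :> 0"
    by (simp add: gderiv_def)
qed

lemma test_functions_gradient:
  assumes "\<phi> \<in> test_functions \<Omega>" shows "(\<lambda>x. gradient \<phi> x $ i) \<in> test_functions \<Omega>"
proof -
  obtain K where K: "compact K" "K \<subseteq> \<Omega>" "\<And>x. x \<notin> K \<Longrightarrow> \<phi> x = 0"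
    using test_functionsD[OF assms] by metis
  show ?thesis
  proof (rule test_functionsI[OF _ K(1,2)])
    show "C_k k (\<lambda>x. gradient \<phi> x $ i)" for k
      using test_functions_C_k[OF assms, of "Suc k"] C_k_Suc_iff by blast
    show "gradient \<phi> x $ i = 0" if "x \<notin> K" for x
      using gradient_eq_0[OF compact_imp_closed[OF K(1)] K(3) that] by simp
  qed
qed

lemma test_functions_0: "(\<lambda>x. 0) \<in> test_functions \<Omega>"
  by (rule test_functionsI[of _ "{}"]) (auto intro: C_k_const)

lemma test_functions_lincomb:
  assumes "\<phi> \<in> test_functions \<Omega>" "\<psi> \<in> test_functions \<Omega>"
  shows "(\<lambda>x. c * \<phi> x + d * \<psi> x) \<in> test_functions \<Omega>"
proof -
  obtain K L where "compact K" "K \<subseteq> \<Omega>" "\<And>x. x \<notin> K \<Longrightarrow> \<phi> x = 0"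
    and "compact L" "L \<subseteq> \<Omega>" "\<And>x. x \<notin> L \<Longrightarrow> \<psi> x = 0"
    using assms test_functionsD by metis
  moreover have "C_k k (\<lambda>x. c * \<phi> x + d * \<psi> x)" for k
    by (intro C_k_add C_k_mult C_k_const test_functions_C_k[OF assms(1)] test_functions_C_k[OF assms(2)])
  ultimately show ?thesis
    by (intro test_functionsI[of _ "K \<union> L"]) auto
qed

lemma gradient_lincomb:
  assumes "\<phi> \<in> test_functions \<Omega>" "\<psi> \<in> test_functions \<Omega>"
  shows "gradient (\<lambda>x. c * \<phi> x + d * \<psi> x) x = c *\<^sub>R gradient \<phi> x + d *\<^sub>R gradient \<psi> x"
proof (rule gradient_eq)
  have "GDERIV (\<lambda>x. c * \<phi> x) x :> c *\<^sub>R gradient \<phi> x + \<phi> x *\<^sub>R 0"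
    "GDERIV (\<lambda>x. d * \<psi> x) x :> d *\<^sub>R gradient \<psi> x + \<psi> x *\<^sub>R 0"
    by (intro GDERIV_mult GDERIV_const test_functions_GDERIV[OF assms(1)] test_functions_GDERIV[OF assms(2)])+
  then show "GDERIV (\<lambda>x. c * \<phi> x + d * \<psi> x) x :> c *\<^sub>R gradient \<phi> x + d *\<^sub>R gradient \<psi> x"
    using GDERIV_add by fastforce
qed

text \<open>A smooth approximation of the indicator of the open box, supported in the closed box;
  the edges sharpen as \<open>k\<close> grows. It carries weak identities over from test functions
  to boxes.\<close>

definition box_bump :: "real^'n \<Rightarrow> real^'n \<Rightarrow> nat \<Rightarrow> real^'n \<Rightarrow> real" where
  "box_bump a b k x = (\<Prod>i\<in>UNIV. bump (real k * (x $ i - a $ i)) * bump (real k * (b $ i - x $ i)))"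

lemma box_bump_test:
  assumes "cbox a b \<subseteq> \<Omega>" shows "box_bump a b k \<in> test_functions \<Omega>"
proof (rule test_functionsI[OF _ compact_cbox assms])
  have "C_k m (\<lambda>x. \<Prod>i\<in>UNIV. bump (real k * x $ i + (- real k * a $ i)) * bump ((- real k) * x $ i + real k * b $ i))" for m
    by (intro C_k_prod C_k_mult C_k_bump C_k_affine) auto
  then show "C_k m (box_bump a b k)" for m
    by (simp add: box_bump_def[abs_def] algebra_simps)
  show "box_bump a b k x = 0" if x: "x \<notin> cbox a b" for x
  proof -
    obtain i where "x $ i < a $ i \<or> b $ i < x $ i" using x unfolding mem_box_cart by (meson not_le)
    then have "bump (real k * (x $ i - a $ i)) * bump (real k * (b $ i - x $ i)) = 0"
      by (auto simp: bump_simps mult_nonneg_nonpos)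
    then show ?thesis unfolding box_bump_def by (meson UNIV_I finite prod_zero)
  qed
qed

lemma box_bump_bounds: "0 \<le> box_bump a b k x" "box_bump a b k x \<le> 1"
  unfolding box_bump_def by (auto intro!: prod_nonneg prod_le_1 mult_nonneg_nonneg mult_le_one bump_bounds)

lemma bump_tendsto: "(\<lambda>k. bump (real k * s)) \<longlonglongrightarrow> (if s > 0 then 1 else 0)"
proof (cases "s > 0")
  case True
  have "(\<lambda>k. exp (- (1 / s * (1 / real k)))) \<longlonglongrightarrow> exp (- (1 / s * 0))"
    by (intro tendsto_intros lim_1_over_n)
  then have "(\<lambda>k. exp (- (1 / s * (1 / real k)))) \<longlonglongrightarrow> 1" by simp
  then have "(\<lambda>k. bump (real k * s)) \<longlonglongrightarrow> 1"
    by (rule Lim_transform_eventually)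
       (use True in \<open>auto simp: bump_simps intro!: eventually_sequentiallyI[of 1]\<close>)
  then show ?thesis using True by simp
qed (auto simp: bump_simps mult_nonneg_nonpos)

lemma box_bump_tendsto: "(\<lambda>k. box_bump a b k x) \<longlonglongrightarrow> indicator (box a b) x"
proof -
  have "(\<lambda>k. box_bump a b k x) \<longlonglongrightarrow>
    (\<Prod>i\<in>UNIV. (if x $ i - a $ i > 0 then 1 else 0) * (if b $ i - x $ i > 0 then 1 else 0))"
    unfolding box_bump_def by (intro tendsto_prod tendsto_mult bump_tendsto)
  also have "(\<Prod>i\<in>UNIV. (if x $ i - a $ i > 0 then 1 else 0) * (if b $ i - x $ i > 0 then 1 else 0)) = (indicator (box a b) x :: real)"
    by (auto simp: indicator_def mem_box_cart intro!: prod.neutral)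
  finally show ?thesis .
qed

subsection \<open>Continuously differentiable functions of compact support\<close>

text \<open>Truncating a test function at a level leaves it only continuously differentiable, so the
  estimates on the whole space are proved for this larger class. \<open>K\<close> may be larger than
  the support.\<close>

definition C1_compact :: "('a::euclidean_space \<Rightarrow> real) \<Rightarrow> ('a \<Rightarrow> 'a) \<Rightarrow> 'a set \<Rightarrow> bool" where
  "C1_compact f g K \<longleftrightarrow> (\<forall>x. GDERIV f x :> g x) \<and> continuous_on UNIV g \<and> compact K \<and> (\<forall>x. x \<notin> K \<longrightarrow> f x = 0)"

lemma C1_compactD:
  assumes "C1_compact f g K"
  shows "GDERIV f x :> g x" "continuous_on UNIV g" "compact K" "x \<notin> K \<Longrightarrow> f x = 0"
  using assms by (auto simp: C1_compact_def)

lemma C1_compact_continuous: "C1_compact f g K \<Longrightarrow> continuous_on UNIV f"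
  using C1_compactD(1) GDERIV_continuous by (blast intro: continuous_at_imp_continuous_on)

lemma C1_compact_gradient_0:
  assumes f: "C1_compact f g K" and "x \<notin> K"
  shows "g x = 0"
proof -
  have "(f has_derivative (\<lambda>h. 0)) (at x)"
    by (rule has_derivative_transform_within_open[of "\<lambda>_. 0" _ _ _ "- K"])
       (use assms C1_compactD[OF f] in \<open>auto intro: compact_imp_closed\<close>)
  then have "GDERIV f x :> 0" by (simp add: gderiv_def)
  then show ?thesis using GDERIV_unique C1_compactD(1)[OF f] by blast
qed

lemma C1_compact_borel [measurable_dest]:
  assumes "C1_compact f g K"
  shows "f \<in> borel_measurable borel" "g \<in> borel_measurable borel"
  using assms C1_compact_continuous C1_compactD(2) borel_measurable_continuous_onI by blast+

lemma integrable_compact_support: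
  fixes f :: "'a::euclidean_space \<Rightarrow> 'b::{banach, second_countable_topology}"
  assumes "continuous_on UNIV f" "compact K" "\<And>x. x \<notin> K \<Longrightarrow> f x = 0"
  shows "integrable lborel f"
proof -
  have "integrable lborel (\<lambda>x. indicator K x *\<^sub>R f x)"
    by (rule borel_integrable_compact[OF assms(2) continuous_on_subset[OF assms(1)]]) simp
  moreover have "(\<lambda>x. indicator K x *\<^sub>R f x) = f"
    using assms(3) by (auto simp: indicator_def fun_eq_iff)
  ultimately show ?thesis by simp
qed

lemma bounded_compact_support:
  fixes f :: "'a::euclidean_space \<Rightarrow> 'b::real_normed_vector"
  assumes "continuous_on UNIV f" "compact K" "\<And>x. x \<notin> K \<Longrightarrow> f x = 0"
  obtains B where "B > 0" "\<And>x. norm (f x) \<le> B"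
proof -
  have "bounded (f ` K)"
    using assms by (intro compact_imp_bounded compact_continuous_image) (auto intro: continuous_on_subset)
  then obtain B where "B > 0" "\<And>x. x \<in> K \<Longrightarrow> norm (f x) \<le> B"
    unfolding bounded_pos by blast
  then have "norm (f x) \<le> B" for x
    using assms(3)[of x] by (cases "x \<in> K") auto
  then show ?thesis using that \<open>B > 0\<close> by blast
qed

lemma C1_compact_integrable:
  assumes "C1_compact f g K"
  shows "integrable lborel f" "integrable lborel (\<lambda>x. (f x)\<^sup>2)" "integrable lborel (\<lambda>x. (norm (g x))\<^sup>2)"
  using C1_compact_continuous[OF assms] C1_compactD[OF assms] C1_compact_gradient_0[OF assms]
  by (auto intro!: integrable_compact_support[of _ K] continuous_intros)

lemma C1_compact_test_function:
  assumes "\<phi> \<in> test_functions \<Omega>"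
  obtains K where "C1_compact \<phi> (gradient \<phi>) K" "K \<subseteq> \<Omega>"
proof -
  obtain K where K: "compact K" "K \<subseteq> \<Omega>" "\<And>x. x \<notin> K \<Longrightarrow> \<phi> x = 0"
    using test_functionsD[OF assms] by metis
  have "continuous_on UNIV (\<lambda>x. gradient \<phi> x $ i)" for i
    using test_functions_C_k[OF test_functions_gradient[OF assms], of 0] by simp
  then have "continuous_on UNIV (\<lambda>x. \<chi> i. gradient \<phi> x $ i)"
    by (intro continuous_on_vec_lambda)
  then have "C1_compact \<phi> (gradient \<phi>) K"
    using K test_functions_GDERIV[OF assms] by (simp add: C1_compact_def)
  then show ?thesis using that K(2) by blast
qed

section \<open>Translations and the estimates that they give\<close>

lemma nn_integral_lborel_translate:
  fixes f :: "'a::euclidean_space \<Rightarrow> ennreal"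
  assumes [measurable]: "f \<in> borel_measurable borel"
  shows "(\<integral>\<^sup>+x. f (c + x) \<partial>lborel) = (\<integral>\<^sup>+x. f x \<partial>lborel)"
proof -
  have "(\<integral>\<^sup>+x. f x \<partial>lborel) = (\<integral>\<^sup>+x. f x \<partial>distr lborel borel ((+) c))"
    by (simp add: lborel_distr_plus)
  also have "\<dots> = (\<integral>\<^sup>+x. f (c + x) \<partial>lborel)"
    by (subst nn_integral_distr) auto
  finally show ?thesis by simp
qed

lemma integral_lborel_translate:
  fixes f :: "'a::euclidean_space \<Rightarrow> real"
  assumes "integrable lborel f"
  shows "integrable lborel (\<lambda>x. f (c + x))" "(\<integral>x. f (c + x) \<partial>lborel) = (\<integral>x. f x \<partial>lborel)"
proof -
  have [measurable]: "f \<in> borel_measurable borel" using assms by auto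
  have "integrable (distr lborel borel ((+) c)) f" using assms by (simp add: lborel_distr_plus)
  then show "integrable lborel (\<lambda>x. f (c + x))"
    by (subst (asm) integrable_distr_eq) auto
  have "(\<integral>x. f x \<partial>lborel) = (\<integral>x. f x \<partial>distr lborel borel ((+) c))"
    by (simp add: lborel_distr_plus)
  also have "\<dots> = (\<integral>x. f (c + x) \<partial>lborel)"
    by (subst integral_distr) auto
  finally show "(\<integral>x. f (c + x) \<partial>lborel) = (\<integral>x. f x \<partial>lborel)" by simp
qed

text \<open>
  The difference quotients have integral zero by translation invariance and converge boundedly.
\<close>
lemma C1_compact_integral_gradient:
  assumes f: "C1_compact f g K"
  shows "(\<integral>x. g x \<bullet> h \<partial>lborel) = 0"
proof -
  note [measurable] = C1_compact_borel[OF f]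
  obtain B where B: "B > 0" "\<And>x. norm (g x) \<le> B"
    using bounded_compact_support[OF C1_compactD(2,3)[OF f] C1_compact_gradient_0[OF f]] by blast
  obtain R where R: "R > 0" "\<And>x. x \<in> K \<Longrightarrow> norm x \<le> R"
    using compact_imp_bounded[OF C1_compactD(3)[OF f]] bounded_pos by blast
  define q where "q n x = (f (x + (1 / Suc n) *\<^sub>R h) - f x) * Suc n" for n x
  have q0: "(\<integral>x. q n x \<partial>lborel) = 0" for n
  proof -
    have "q n = (\<lambda>x. (f ((1 / Suc n) *\<^sub>R h + x) - f x) * Suc n)"
      by (simp add: q_def fun_eq_iff add.commute)
    then have "(\<integral>x. q n x \<partial>lborel) = ((\<integral>x. f ((1 / Suc n) *\<^sub>R h + x) \<partial>lborel) - (\<integral>x. f x \<partial>lborel)) * Suc n"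
      using C1_compact_integrable(1)[OF f] integral_lborel_translate(1)[OF C1_compact_integrable(1)[OF f], of "(1 / Suc n) *\<^sub>R h"]
      by simp
    then show ?thesis using integral_lborel_translate(2)[OF C1_compact_integrable(1)[OF f]] by simp
  qed
  have lip: "\<bar>f y - f x\<bar> \<le> B * norm (y - x)" for x y
  proof -
    have "norm (f y - f x) \<le> B * norm (y - x)"
    proof (rule differentiable_bound[of UNIV f "\<lambda>x h. h \<bullet> g x"])
      show "(f has_derivative (\<lambda>h. h \<bullet> g x)) (at x within UNIV)" for x
        using C1_compactD(1)[OF f] by (simp add: gderiv_def)
      show "onorm (\<lambda>h. h \<bullet> g x) \<le> B" for x
        by (rule onorm_le) (metis B(2) Cauchy_Schwarz_ineq2 mult.commute mult_left_mono norm_ge_zero order_trans real_norm_def)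
    qed auto
    then show ?thesis by simp
  qed
  have "(\<lambda>n. \<integral>x. q n x \<partial>lborel) \<longlonglongrightarrow> (\<integral>x. g x \<bullet> h \<partial>lborel)"
  proof (rule integral_dominated_convergence)
    \<comment> \<open>The shifts have length at most \<open>norm h\<close>, so all quotients vanish
      outside this ball; inside it the Lipschitz bound \<open>lip\<close> controls them.\<close>
    show "integrable lborel (\<lambda>x. indicator (cball 0 (R + norm h)) x *\<^sub>R (B * norm h))"
      by (intro borel_integrable_compact) auto
    show "AE x in lborel. (\<lambda>n. q n x) \<longlonglongrightarrow> g x \<bullet> h"
    proof (rule AE_I2)
      fix x
      have "((\<lambda>t. f (x + t *\<^sub>R h)) has_derivative (\<lambda>t. (t *\<^sub>R h) \<bullet> g (x + 0 *\<^sub>R h))) (at 0)"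
        by (rule has_derivative_compose[of "\<lambda>t. x + t *\<^sub>R h" "\<lambda>t. t *\<^sub>R h" 0 UNIV f])
           (use C1_compactD(1)[OF f] in \<open>auto simp: gderiv_def intro!: derivative_eq_intros\<close>)
      then have "((\<lambda>t. f (x + t *\<^sub>R h)) has_real_derivative (g x \<bullet> h)) (at 0)"
        by (auto simp: has_field_derivative_def inner_commute mult.commute
            elim!: has_derivative_eq_rhs)
      then have "((\<lambda>t. (f (x + t *\<^sub>R h) - f x) / t) \<longlongrightarrow> g x \<bullet> h) (at 0)"
        by (simp add: DERIV_def)
      moreover have "filterlim (\<lambda>n. 1 / real (Suc n)) (at 0) sequentially"
        unfolding filterlim_at using LIMSEQ_inverse_real_of_nat by (auto simp: inverse_eq_divide)
      ultimately have "(\<lambda>n. (f (x + (1 / real (Suc n)) *\<^sub>R h) - f x) / (1 / real (Suc n))) \<longlonglongrightarrow> g x \<bullet> h"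
        by (rule filterlim_compose)
      then show "(\<lambda>n. q n x) \<longlonglongrightarrow> g x \<bullet> h" by (simp add: q_def)
    qed
    show "AE x in lborel. norm (q n x) \<le> indicator (cball 0 (R + norm h)) x *\<^sub>R (B * norm h)" for n
    proof (rule AE_I2)
      fix x
      have nh: "norm ((1 / Suc n) *\<^sub>R h) \<le> norm h" by (simp add: field_simps)
      show "norm (q n x) \<le> indicator (cball 0 (R + norm h)) x *\<^sub>R (B * norm h)"
      proof (cases "x \<in> cball 0 (R + norm h)")
        case True
        have "\<bar>f (x + (1 / Suc n) *\<^sub>R h) - f x\<bar> * Suc n \<le> (B * norm ((1 / Suc n) *\<^sub>R h)) * Suc n"
          using lip[of "x + (1 / Suc n) *\<^sub>R h" x] by (intro mult_right_mono) auto
        then show ?thesis using True by (simp add: q_def abs_mult)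
      next
        case False
        then have x: "norm x > R + norm h" by simp
        then have "norm (x + (1 / Suc n) *\<^sub>R h) > R"
          using nh norm_triangle_ineq4[of "x + (1 / Suc n) *\<^sub>R h" "(1 / Suc n) *\<^sub>R h"] by auto
        moreover have "norm x > R" using x norm_ge_zero[of h] by linarith
        ultimately have "x + (1 / Suc n) *\<^sub>R h \<notin> K" "x \<notin> K" using R(2) by fastforce+
        then show ?thesis using C1_compactD(4)[OF f] B(1) by (simp add: q_def)
      qed
    qed
  qed (simp_all add: q_def)
  then show ?thesis by (simp add: q0 LIMSEQ_const_iff)
qed

text \<open>The variance of \<open>f\<close> on the unit interval, with mean \<open>c\<close>, is
  nonnegative.\<close>

lemma square_integral_unit_interval_le:
  fixes f :: "real \<Rightarrow> real"
  assumes "continuous_on {0..1} f"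
  shows "(\<integral>t. indicator {0..1} t *\<^sub>R f t \<partial>lborel)\<^sup>2 \<le> (\<integral>t. indicator {0..1} t *\<^sub>R (f t)\<^sup>2 \<partial>lborel)"
proof -
  define c where "c = (\<integral>t. indicator {0..1} t *\<^sub>R f t \<partial>lborel)"
  have i1: "integrable lborel (\<lambda>t. indicator {0..1} t *\<^sub>R f t)"
    and i2: "integrable lborel (\<lambda>t. indicator {0..1} t *\<^sub>R (f t)\<^sup>2)"
    and i3: "integrable lborel (\<lambda>t. indicator {0..1::real} t *\<^sub>R (1::real))"
    by (intro borel_integrable_compact continuous_intros assms; simp)+
  have "0 \<le> (\<integral>t. indicator {0..1} t *\<^sub>R (f t - c)\<^sup>2 \<partial>lborel)"
    by (rule integral_nonneg_AE) auto
  also have "(\<integral>t. indicator {0..1} t *\<^sub>R (f t - c)\<^sup>2 \<partial>lborel) =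
    (\<integral>t. indicator {0..1} t *\<^sub>R (f t)\<^sup>2 - (2 * c) * (indicator {0..1} t *\<^sub>R f t) + c\<^sup>2 * (indicator {0..1} t *\<^sub>R 1) \<partial>lborel)"
    by (rule Bochner_Integration.integral_cong) (auto simp: power2_diff algebra_simps)
  also have "\<dots> = (\<integral>t. indicator {0..1} t *\<^sub>R (f t)\<^sup>2 \<partial>lborel) - 2 * c * c + c\<^sup>2 * (\<integral>t. indicator {0..1::real} t *\<^sub>R 1 \<partial>lborel)"
    using i1 i2 i3 by (simp add: c_def)
  also have "(\<integral>t. indicator {0..1::real} t *\<^sub>R (1::real) \<partial>lborel) = 1" by simp
  finally show ?thesis by (simp add: c_def power2_eq_square)
qed

text \<open>The increment is the integral of \<open>h \<bullet> g\<close> along the segment from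
  \<open>x\<close> to \<open>x + h\<close>. Its square is at most the integral of the square, and
  after exchanging the integrals translation invariance removes the dependence on the point of the
  segment.\<close>

lemma C1_compact_translation:
  assumes f: "C1_compact f g K"
  shows "(\<integral>\<^sup>+x. ennreal ((f (x + h) - f x)\<^sup>2) \<partial>lborel) \<le> ennreal ((norm h)\<^sup>2 * (\<integral>x. (norm (g x))\<^sup>2 \<partial>lborel))"
proof -
  note [measurable] = C1_compact_borel[OF f]
  have pw: "ennreal ((f (x + h) - f x)\<^sup>2) \<le>
      ennreal ((norm h)\<^sup>2) * (\<integral>\<^sup>+t. indicator {0..1} t * ennreal ((norm (g (x + t *\<^sub>R h)))\<^sup>2) \<partial>lborel)" for x
  proof -
    have der: "((\<lambda>t. f (x + t *\<^sub>R h)) has_vector_derivative (h \<bullet> g (x + t *\<^sub>R h))) (at t within {0..1})" for t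
    proof -
      have "((\<lambda>t. f (x + t *\<^sub>R h)) has_derivative (\<lambda>s. (s *\<^sub>R h) \<bullet> g (x + t *\<^sub>R h))) (at t within {0..1})"
        by (rule has_derivative_compose[of "\<lambda>t. x + t *\<^sub>R h" "\<lambda>t. t *\<^sub>R h" t "{0..1}" f])
           (use C1_compactD(1)[OF f] in \<open>auto simp: gderiv_def intro!: derivative_eq_intros\<close>)
      then show ?thesis by (simp add: has_vector_derivative_def)
    qed
    have cg: "continuous_on {0..1} (\<lambda>t. g (x + t *\<^sub>R h))"
      by (rule continuous_on_compose2[OF C1_compactD(2)[OF f]]) (auto intro!: continuous_intros)
    have "f (x + h) - f x = (\<integral>t. indicator {0..1} t *\<^sub>R (h \<bullet> g (x + t *\<^sub>R h)) \<partial>lborel)"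
      using integral_FTC_Icc[OF _ der continuous_on_inner[OF continuous_on_const cg]] by simp
    then have "(f (x + h) - f x)\<^sup>2 \<le> (\<integral>t. indicator {0..1} t *\<^sub>R (h \<bullet> g (x + t *\<^sub>R h))\<^sup>2 \<partial>lborel)"
      using square_integral_unit_interval_le[OF continuous_on_inner[OF continuous_on_const cg]] by simp
    also have "\<dots> \<le> (\<integral>t. (norm h)\<^sup>2 * (indicator {0..1} t *\<^sub>R (norm (g (x + t *\<^sub>R h)))\<^sup>2) \<partial>lborel)"
    proof (rule integral_mono)
      show "integrable lborel (\<lambda>t. indicator {0..1} t *\<^sub>R (h \<bullet> g (x + t *\<^sub>R h))\<^sup>2)"
        by (intro borel_integrable_compact continuous_intros cg) simp
      show "integrable lborel (\<lambda>t. (norm h)\<^sup>2 * (indicator {0..1} t *\<^sub>R (norm (g (x + t *\<^sub>R h)))\<^sup>2))"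
        by (intro integrable_mult_right borel_integrable_compact continuous_intros cg) simp
      show "indicator {0..1} t *\<^sub>R (h \<bullet> g (x + t *\<^sub>R h))\<^sup>2 \<le> (norm h)\<^sup>2 * (indicator {0..1} t *\<^sub>R (norm (g (x + t *\<^sub>R h)))\<^sup>2)" for t
        using Cauchy_Schwarz_ineq2[of h "g (x + t *\<^sub>R h)"]
        by (auto simp: indicator_def power_mult_distrib[symmetric] abs_le_square_iff[symmetric])
    qed
    also have "\<dots> = (norm h)\<^sup>2 * (\<integral>t. (indicator {0..1} t *\<^sub>R (norm (g (x + t *\<^sub>R h)))\<^sup>2) \<partial>lborel)"
      by simp
    finally have "ennreal ((f (x + h) - f x)\<^sup>2) \<le> ennreal ((norm h)\<^sup>2 * (\<integral>t. (indicator {0..1} t *\<^sub>R (norm (g (x + t *\<^sub>R h)))\<^sup>2) \<partial>lborel))"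
      by (rule ennreal_leI)
    also have "\<dots> = ennreal ((norm h)\<^sup>2) * (\<integral>\<^sup>+t. ennreal (indicator {0..1} t *\<^sub>R (norm (g (x + t *\<^sub>R h)))\<^sup>2) \<partial>lborel)"
    proof (subst nn_integral_eq_integral)
      show "integrable lborel (\<lambda>t. indicator {0..1} t *\<^sub>R (norm (g (x + t *\<^sub>R h)))\<^sup>2)"
        by (intro borel_integrable_compact continuous_intros cg) simp
    qed (auto simp: ennreal_mult')
    also have "(\<integral>\<^sup>+t. ennreal (indicator {0..1} t *\<^sub>R (norm (g (x + t *\<^sub>R h)))\<^sup>2) \<partial>lborel) =
      (\<integral>\<^sup>+t. indicator {0..1} t * ennreal ((norm (g (x + t *\<^sub>R h)))\<^sup>2) \<partial>lborel)"
      by (intro nn_integral_cong) (auto simp: indicator_def)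
    finally show ?thesis .
  qed
  have "(\<integral>\<^sup>+x. ennreal ((f (x + h) - f x)\<^sup>2) \<partial>lborel) \<le>
     (\<integral>\<^sup>+x. ennreal ((norm h)\<^sup>2) * (\<integral>\<^sup>+t. indicator {0..1} t * ennreal ((norm (g (x + t *\<^sub>R h)))\<^sup>2) \<partial>lborel) \<partial>lborel)"
    by (intro nn_integral_mono pw)
  also have "\<dots> = ennreal ((norm h)\<^sup>2) * (\<integral>\<^sup>+x. (\<integral>\<^sup>+t. indicator {0..1} t * ennreal ((norm (g (x + t *\<^sub>R h)))\<^sup>2) \<partial>lborel) \<partial>lborel)"
    by (rule nn_integral_cmult) measurable
  also have "(\<integral>\<^sup>+x. (\<integral>\<^sup>+t. indicator {0..1} t * ennreal ((norm (g (x + t *\<^sub>R h)))\<^sup>2) \<partial>lborel) \<partial>lborel) =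
     (\<integral>\<^sup>+t. (\<integral>\<^sup>+x. indicator {0..1::real} t * ennreal ((norm (g (x + t *\<^sub>R h)))\<^sup>2) \<partial>lborel) \<partial>lborel)"
    by (rule lborel_pair.Fubini') measurable
  also have "\<dots> = (\<integral>\<^sup>+t. indicator {0..1::real} t * (\<integral>\<^sup>+x. ennreal ((norm (g x))\<^sup>2) \<partial>lborel) \<partial>lborel)"
  proof (rule nn_integral_cong)
    fix t :: real
    have "(\<integral>\<^sup>+x. indicator {0..1::real} t * ennreal ((norm (g (x + t *\<^sub>R h)))\<^sup>2) \<partial>lborel) =
      indicator {0..1::real} t * (\<integral>\<^sup>+x. ennreal ((norm (g (t *\<^sub>R h + x)))\<^sup>2) \<partial>lborel)"
      by (subst nn_integral_cmult) (auto simp: add.commute)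
    also have "(\<integral>\<^sup>+x. ennreal ((norm (g (t *\<^sub>R h + x)))\<^sup>2) \<partial>lborel) = (\<integral>\<^sup>+x. ennreal ((norm (g x))\<^sup>2) \<partial>lborel)"
      by (rule nn_integral_lborel_translate) measurable
    finally show "(\<integral>\<^sup>+x. indicator {0..1::real} t * ennreal ((norm (g (x + t *\<^sub>R h)))\<^sup>2) \<partial>lborel) =
      indicator {0..1::real} t * (\<integral>\<^sup>+x. ennreal ((norm (g x))\<^sup>2) \<partial>lborel)" .
  qed
  also have "\<dots> = (\<integral>\<^sup>+x. ennreal ((norm (g x))\<^sup>2) \<partial>lborel)"
    by (subst nn_integral_multc) auto
  also have "\<dots> = ennreal (\<integral>x. (norm (g x))\<^sup>2 \<partial>lborel)"
    by (intro nn_integral_eq_integral C1_compact_integrable(3)[OF f]) auto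
  finally show ?thesis by (simp add: ennreal_mult')
qed

text \<open>A shift by the diameter \<open>2 * R\<close> moves the support off itself: at each point
  one of \<open>f x\<close> and \<open>f (x + h)\<close> vanishes. The left side of the translation
  estimate is then twice the integral of the square of \<open>f\<close>.\<close>

lemma C1_compact_Poincare:
  assumes f: "C1_compact f g K" and R: "R > 0" "K \<subseteq> ball 0 R"
  shows "(\<integral>x. (f x)\<^sup>2 \<partial>lborel) \<le> 2 * R\<^sup>2 * (\<integral>x. (norm (g x))\<^sup>2 \<partial>lborel)"
proof -
  note [measurable] = C1_compact_borel[OF f]
  obtain b :: 'a where b: "b \<in> Basis" using nonempty_Basis by blast
  define h where "h = (2 * R) *\<^sub>R b"
  have nh: "norm h = 2 * R" using b R by (simp add: h_def)
  have dis: "(f (x + h) - f x)\<^sup>2 = (f (h + x))\<^sup>2 + (f x)\<^sup>2" for x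
  proof (cases "norm x < R")
    case True
    then have "norm (x + h) \<ge> R"
      using norm_triangle_ineq4[of "x + h" x] nh by auto
    then have "f (x + h) = 0" using R(2) C1_compactD(4)[OF f] by fastforce
    then show ?thesis by (simp add: add.commute)
  next
    case False
    then have "f x = 0" using R(2) C1_compactD(4)[OF f] by fastforce
    then show ?thesis by (simp add: add.commute)
  qed
  have "(\<integral>\<^sup>+x. ennreal ((f (x + h) - f x)\<^sup>2) \<partial>lborel) = (\<integral>\<^sup>+x. ennreal ((f (h + x))\<^sup>2) \<partial>lborel) + (\<integral>\<^sup>+x. ennreal ((f x)\<^sup>2) \<partial>lborel)"
    unfolding dis by (subst nn_integral_add[symmetric]) auto
  also have "(\<integral>\<^sup>+x. ennreal ((f (h + x))\<^sup>2) \<partial>lborel) = (\<integral>\<^sup>+x. ennreal ((f x)\<^sup>2) \<partial>lborel)"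
    by (rule nn_integral_lborel_translate) measurable
  also have "(\<integral>\<^sup>+x. ennreal ((f x)\<^sup>2) \<partial>lborel) = ennreal (\<integral>x. (f x)\<^sup>2 \<partial>lborel)"
    by (intro nn_integral_eq_integral C1_compact_integrable(2)[OF f]) auto
  finally have "ennreal (2 * (\<integral>x. (f x)\<^sup>2 \<partial>lborel)) \<le> ennreal ((2 * R)\<^sup>2 * (\<integral>x. (norm (g x))\<^sup>2 \<partial>lborel))"
    using C1_compact_translation[OF f, of h] nh by (simp add: ennreal_plus[symmetric] del: ennreal_plus)
  then have "2 * (\<integral>x. (f x)\<^sup>2 \<partial>lborel) \<le> (2 * R)\<^sup>2 * (\<integral>x. (norm (g x))\<^sup>2 \<partial>lborel)"
    by (subst (asm) ennreal_le_iff) (auto intro!: mult_nonneg_nonneg integral_nonneg_AE)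
  then show ?thesis by (simp add: power2_eq_square)
qed

subsection \<open>Averages over a grid of cubes\<close>

text \<open>Half-open cubes of side \<open>e\<close>, so that the cells partition the space; only
  the values of \<open>z\<close> on \<open>Basis\<close> matter.\<close>

definition grid_cell :: "real \<Rightarrow> ('a::euclidean_space \<Rightarrow> int) \<Rightarrow> 'a set" where
  "grid_cell e z = {x. \<forall>i\<in>Basis. \<lfloor>(x \<bullet> i) / e\<rfloor> = z i}"

lemma grid_cell_borel [measurable]: "grid_cell e z \<in> sets (borel :: 'a::euclidean_space measure)"
proof -
  have "grid_cell e z = (\<Inter>i\<in>Basis. {x::'a. \<lfloor>(x \<bullet> i) / e\<rfloor> = z i})"
    by (auto simp: grid_cell_def)
  moreover have "{x::'a \<in> space borel. \<lfloor>(x \<bullet> i) / e\<rfloor> = z i} \<in> sets borel" for i by measurable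
  ultimately show ?thesis by (auto intro!: sets.finite_INT)
qed

lemma grid_cell_box:
  fixes z :: "'a::euclidean_space \<Rightarrow> int"
  assumes "e > 0"
  defines "l \<equiv> (\<Sum>i\<in>Basis. (e * real_of_int (z i)) *\<^sub>R i)"
  shows "box l (l + e *\<^sub>R One) \<subseteq> grid_cell e z" "grid_cell e z \<subseteq> cbox l (l + e *\<^sub>R One)"
proof -
  have *: "\<lfloor>y / e\<rfloor> = k \<longleftrightarrow> e * real_of_int k \<le> y \<and> y < e * real_of_int k + e" for y k
    using assms(1) by (auto simp: floor_eq_iff field_simps)
  show "box l (l + e *\<^sub>R One) \<subseteq> grid_cell e z" "grid_cell e z \<subseteq> cbox l (l + e *\<^sub>R One)"
    by (auto simp: grid_cell_def * mem_box l_def inner_add_left less_imp_le)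
qed

lemma emeasure_grid_cell:
  assumes "e > 0"
  shows "emeasure lborel (grid_cell e z :: 'a::euclidean_space set) = ennreal (e ^ DIM('a))"
proof -
  define l :: 'a where "l = (\<Sum>i\<in>Basis. (e * real_of_int (z i)) *\<^sub>R i)"
  have le: "l \<bullet> i \<le> (l + e *\<^sub>R One) \<bullet> i" "(l + e *\<^sub>R One - l) \<bullet> i = e" if "i \<in> Basis" for i
    using that assms by (auto simp: inner_add_left)
  have "emeasure lborel (box l (l + e *\<^sub>R One)) = ennreal (e ^ DIM('a))"
    "emeasure lborel (cbox l (l + e *\<^sub>R One)) = ennreal (e ^ DIM('a))"
    using le by (simp_all add: emeasure_lborel_box_eq emeasure_lborel_cbox_eq)
  then show ?thesis
    using grid_cell_box[OF assms, of z, folded l_def]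
      emeasure_mono[of "box l (l + e *\<^sub>R One)" "grid_cell e z" lborel]
      emeasure_mono[of "grid_cell e z" "cbox l (l + e *\<^sub>R One)" lborel]
    by (simp add: antisym)
qed

text \<open>Extensional functions, so that no two indices name the same cell; the range is large
  enough for the cells to cover the ball of radius \<open>R\<close>.\<close>

definition grid_index :: "real \<Rightarrow> real \<Rightarrow> ('a::euclidean_space \<Rightarrow> int) set" where
  "grid_index e R = (\<Pi>\<^sub>E i\<in>Basis. {\<lfloor>- R / e\<rfloor>..\<lfloor>R / e\<rfloor>})"

lemma finite_grid_index: "finite (grid_index e R)"
  unfolding grid_index_def by (rule finite_PiE) auto

lemma grid_cell_unique:
  assumes "z \<in> grid_index e R" "w \<in> grid_index e R" "x \<in> grid_cell e z" "x \<in> grid_cell e w"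
  shows "z = w"
  using assms unfolding grid_index_def grid_cell_def by (intro PiE_ext) auto

lemma grid_cell_exists:
  fixes x :: "'a::euclidean_space"
  assumes "e > 0" "norm x \<le> R"
  shows "\<exists>z\<in>grid_index e R. x \<in> grid_cell e z"
proof
  let ?z = "restrict (\<lambda>i. \<lfloor>(x \<bullet> i) / e\<rfloor>) Basis"
  have "- R \<le> x \<bullet> i \<and> x \<bullet> i \<le> R" if "i \<in> Basis" for i
    using Basis_le_norm[OF that, of x] assms(2) by linarith
  then show "?z \<in> grid_index e R"
    using divide_right_mono[of "- R" _ e] divide_right_mono[of _ R e] assms(1)
    by (auto simp: grid_index_def intro!: floor_mono)
  show "x \<in> grid_cell e ?z" by (simp add: grid_cell_def)
qed

lemma sum_grid_cell:
  fixes x :: "'a::euclidean_space"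
  assumes "e > 0" "norm x \<le> R"
  shows "(\<Sum>z\<in>grid_index e R. indicator (grid_cell e z) x) = (1 :: 'b::{semiring_1})"
proof -
  obtain w :: "'a \<Rightarrow> int" where w: "w \<in> grid_index e R" "x \<in> grid_cell e w"
    using grid_cell_exists[OF assms] by blast
  have "(\<Sum>z\<in>grid_index e R. indicator (grid_cell e z) x :: 'b) = (\<Sum>z\<in>grid_index e R. if z = w then 1 else 0)"
  proof (intro sum.cong refl)
    fix z :: "'a \<Rightarrow> int" assume "z \<in> grid_index e R"
    then have "x \<in> grid_cell e z \<longleftrightarrow> z = w" using w grid_cell_unique by blast
    then show "indicator (grid_cell e z) x = (if z = w then 1 else 0 :: 'b)" by (simp add: indicator_def)
  qed
  then show ?thesis using w by (simp add: finite_grid_index)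
qed

text \<open>At most one cell contains both points, and in that case each coordinate of the
  difference is at most \<open>e\<close> in absolute value. This replaces the grid, which is not
  translation invariant, by a condition on \<open>y - x\<close> alone.\<close>

lemma sum_grid_cell_pair_le:
  fixes x y :: "'a::euclidean_space"
  assumes "e > 0"
  shows "(\<Sum>z\<in>grid_index e R. indicator (grid_cell e z) x * indicator (grid_cell e z) y)
     \<le> (indicator (cbox (- e *\<^sub>R One) (e *\<^sub>R One)) (y - x) :: real)"
proof (cases "\<exists>w\<in>grid_index e R. x \<in> grid_cell e w \<and> y \<in> grid_cell e w")
  case True
  then obtain w where w: "w \<in> grid_index e R" "x \<in> grid_cell e w" "y \<in> grid_cell e w" by blast
  have "(\<Sum>z\<in>grid_index e R. indicator (grid_cell e z) x * indicator (grid_cell e z) y :: real)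
     \<le> (\<Sum>z\<in>grid_index e R. if z = w then 1 else 0)"
  proof (rule sum_mono)
    fix z :: "'a \<Rightarrow> int" assume "z \<in> grid_index e R"
    then have "x \<in> grid_cell e z \<Longrightarrow> z = w" using w grid_cell_unique by blast
    then show "indicator (grid_cell e z) x * indicator (grid_cell e z) y \<le> (if z = w then 1 else (0::real))"
      by (auto simp: indicator_def)
  qed
  also have "\<dots> = 1" using w by (simp add: finite_grid_index)
  also have "y - x \<in> cbox (- e *\<^sub>R One) (e *\<^sub>R One)"
  proof -
    have "- e \<le> (y - x) \<bullet> i \<and> (y - x) \<bullet> i \<le> e" if i: "i \<in> Basis" for i
    proof -
      have "\<lfloor>(x \<bullet> i) / e\<rfloor> = w i" "\<lfloor>(y \<bullet> i) / e\<rfloor> = w i"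
        using w(2,3) i by (auto simp: grid_cell_def)
      then have "\<bar>(x \<bullet> i) / e - (y \<bullet> i) / e\<bar> \<le> 1" by linarith
      then have "\<bar>x \<bullet> i - y \<bullet> i\<bar> \<le> e"
        using assms by (simp add: field_simps flip: diff_divide_distrib)
      then show ?thesis by (simp add: inner_diff_left abs_le_iff)
    qed
    then show ?thesis by (simp add: mem_box)
  qed
  then have "1 = (indicator (cbox (- e *\<^sub>R One) (e *\<^sub>R One)) (y - x) :: real)" by simp
  finally show ?thesis .
next
  case False
  then have "(\<Sum>z\<in>grid_index e R. indicator (grid_cell e z) x * indicator (grid_cell e z) y) = (0::real)"
    by (intro sum.neutral) (auto simp: indicator_def)
  then show ?thesis by simp
qed

text \<open>Substitute y = x + h. Each \<open>h\<close> of the cube costs at most the squared norm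
  of \<open>h\<close>, hence \<open>DIM('a) * e\<^sup>2\<close>, times the energy, and the cube has
  volume \<open>(2 * e) ^ DIM('a)\<close>.\<close>

lemma C1_compact_cube_translations:
  fixes f :: "'a::euclidean_space \<Rightarrow> real" and e :: real
  assumes f: "C1_compact f g K" and e: "e > 0"
  shows "(\<integral>\<^sup>+x. \<integral>\<^sup>+y. ennreal (indicator (cbox (- e *\<^sub>R One) (e *\<^sub>R One)) (y - x) * (f y - f x)\<^sup>2) \<partial>lborel \<partial>lborel)
     \<le> ennreal ((2 * e) ^ DIM('a) * (DIM('a) * e\<^sup>2) * (\<integral>x. (norm (g x))\<^sup>2 \<partial>lborel))"
proof -
  let ?C = "cbox (- e *\<^sub>R One) (e *\<^sub>R One) :: 'a set" and ?D = "\<integral>x. (norm (g x))\<^sup>2 \<partial>lborel"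
  note [measurable] = C1_compact_borel[OF f]
  have D: "?D \<ge> 0" by (intro integral_nonneg_AE) auto
  have normC: "(norm h)\<^sup>2 \<le> DIM('a) * e\<^sup>2" if "h \<in> ?C" for h
  proof -
    have "(norm h)\<^sup>2 = (\<Sum>i\<in>Basis. (h \<bullet> i)\<^sup>2)"
      unfolding power2_norm_eq_inner by (subst euclidean_inner) (simp add: power2_eq_square)
    also have "\<dots> \<le> real_of_nat DIM('a) * e\<^sup>2"
    proof (rule sum_bounded_above)
      fix i :: 'a assume i: "i \<in> Basis"
      then have "- e \<le> h \<bullet> i" "h \<bullet> i \<le> e" using that by (simp_all add: mem_box)
      then have "\<bar>h \<bullet> i\<bar> \<le> e" by linarith
      then show "(h \<bullet> i)\<^sup>2 \<le> e\<^sup>2" using e by (metis abs_le_square_iff abs_of_pos)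
    qed
    finally show ?thesis .
  qed
  have vol: "emeasure lborel ?C = ennreal ((2 * e) ^ DIM('a))"
  proof -
    have "(\<Prod>b\<in>Basis. (e *\<^sub>R One - (- e *\<^sub>R (One::'a))) \<bullet> b) = (\<Prod>b\<in>(Basis::'a set). 2 * e)"
      by (intro prod.cong) (auto simp: inner_diff_left inner_add_left)
    then show ?thesis using e by (subst emeasure_lborel_cbox) auto
  qed
  have "(\<integral>\<^sup>+x. \<integral>\<^sup>+y. ennreal (indicator ?C (y - x) * (f y - f x)\<^sup>2) \<partial>lborel \<partial>lborel) =
      (\<integral>\<^sup>+x. \<integral>\<^sup>+h. ennreal (indicator ?C h * (f (x + h) - f x)\<^sup>2) \<partial>lborel \<partial>lborel)"
  proof (rule nn_integral_cong)
    fix x :: 'a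
    show "(\<integral>\<^sup>+y. ennreal (indicator ?C (y - x) * (f y - f x)\<^sup>2) \<partial>lborel) =
      (\<integral>\<^sup>+h. ennreal (indicator ?C h * (f (x + h) - f x)\<^sup>2) \<partial>lborel)"
      using nn_integral_lborel_translate[of "\<lambda>y. ennreal (indicator ?C (y - x) * (f y - f x)\<^sup>2)" x] by simp
  qed
  also have "\<dots> = (\<integral>\<^sup>+h. \<integral>\<^sup>+x. ennreal (indicator ?C h * (f (x + h) - f x)\<^sup>2) \<partial>lborel \<partial>lborel)"
    by (rule lborel_pair.Fubini') measurable
  also have "\<dots> \<le> (\<integral>\<^sup>+h. ennreal (DIM('a) * e\<^sup>2 * ?D) * indicator ?C h \<partial>lborel)"
  proof (rule nn_integral_mono)
    fix h :: 'a
    show "(\<integral>\<^sup>+x. ennreal (indicator ?C h * (f (x + h) - f x)\<^sup>2) \<partial>lborel) \<le> ennreal (DIM('a) * e\<^sup>2 * ?D) * indicator ?C h"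
    proof (cases "h \<in> ?C")
      case True
      have "(\<integral>\<^sup>+x. ennreal ((f (x + h) - f x)\<^sup>2) \<partial>lborel) \<le> ennreal ((norm h)\<^sup>2 * ?D)"
        by (rule C1_compact_translation[OF f])
      also have "\<dots> \<le> ennreal (DIM('a) * e\<^sup>2 * ?D)"
        by (intro ennreal_leI mult_right_mono normC[OF True] D)
      finally show ?thesis using True by simp
    qed simp
  qed
  also have "\<dots> = ennreal (DIM('a) * e\<^sup>2 * ?D) * ennreal ((2 * e) ^ DIM('a))"
    by (subst nn_integral_cmult_indicator, simp, simp only: vol)
  also have "\<dots> = ennreal ((2 * e) ^ DIM('a) * (DIM('a) * e\<^sup>2) * ?D)"
    using e D by (subst ennreal_mult[symmetric]) (auto simp: mult_ac)
  finally show ?thesis .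
qed

text \<open>The variance identity on \<open>Q\<close>: expanding the square in the double integral
  gives twice the measure times the integral of the square, minus twice the square of the
  integral.\<close>

lemma integral_square_split:
  fixes f :: "'a \<Rightarrow> real"
  assumes Q: "Q \<in> sets M" "emeasure M Q = ennreal m" "m \<ge> 0" and "sigma_finite_measure M"
    and i: "integrable M f" "integrable M (\<lambda>x. (f x)\<^sup>2)"
  shows "ennreal (2 * m * (\<integral>x. indicator Q x * (f x)\<^sup>2 \<partial>M)) =
     ennreal (2 * (\<integral>x. indicator Q x * f x \<partial>M)\<^sup>2) +
     (\<integral>\<^sup>+x. \<integral>\<^sup>+y. ennreal (indicator Q x * indicator Q y * (f y - f x)\<^sup>2) \<partial>M \<partial>M)"
proof -
  have mQ: "measure M Q = m" using Q by (simp add: measure_def)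
  have iQ: "integrable M (indicator Q :: _ \<Rightarrow> real)"
    using Q by (simp add: integrable_indicator_iff less_top)
  have i1: "integrable M (\<lambda>x. indicator Q x * f x)" and i2: "integrable M (\<lambda>x. indicator Q x * (f x)\<^sup>2)"
    using integrable_mult_indicator[OF Q(1) i(1)] integrable_mult_indicator[OF Q(1) i(2)] by simp_all
  define A B where "A = (\<integral>x. indicator Q x * f x \<partial>M)" and "B = (\<integral>x. indicator Q x * (f x)\<^sup>2 \<partial>M)"
  have B: "B \<ge> 0" unfolding B_def by (intro integral_nonneg_AE) auto
  have inner: "(\<integral>\<^sup>+y. ennreal (indicator Q x * indicator Q y * (f y - f x)\<^sup>2) \<partial>M) =
      ennreal (indicator Q x * B - 2 * A * (indicator Q x * f x) + m * (indicator Q x * (f x)\<^sup>2))"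
    and nn: "0 \<le> indicator Q x * B - 2 * A * (indicator Q x * f x) + m * (indicator Q x * (f x)\<^sup>2)" for x
  proof -
    have eq: "(\<lambda>y. indicator Q x * indicator Q y * (f y - f x)\<^sup>2) =
      (\<lambda>y. indicator Q x * (indicator Q y * (f y)\<^sup>2) - (2 * indicator Q x * f x) * (indicator Q y * f y) + (indicator Q x * (f x)\<^sup>2) * indicator Q y)"
      by (auto simp: fun_eq_iff indicator_def power2_diff algebra_simps)
    have "integrable M (\<lambda>y. indicator Q x * indicator Q y * (f y - f x)\<^sup>2)"
      unfolding eq using i1 i2 iQ by simp
    moreover have val: "(\<integral>y. indicator Q x * indicator Q y * (f y - f x)\<^sup>2 \<partial>M) =
        indicator Q x * B - 2 * A * (indicator Q x * f x) + m * (indicator Q x * (f x)\<^sup>2)"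
      unfolding eq using i1 i2 iQ Q by (simp add: A_def[symmetric] B_def[symmetric] mQ)
    ultimately show "(\<integral>\<^sup>+y. ennreal (indicator Q x * indicator Q y * (f y - f x)\<^sup>2) \<partial>M) =
      ennreal (indicator Q x * B - 2 * A * (indicator Q x * f x) + m * (indicator Q x * (f x)\<^sup>2))"
      by (subst nn_integral_eq_integral) auto
    show "0 \<le> indicator Q x * B - 2 * A * (indicator Q x * f x) + m * (indicator Q x * (f x)\<^sup>2)"
      unfolding val[symmetric] by (intro integral_nonneg_AE) auto
  qed
  have "(\<integral>\<^sup>+x. \<integral>\<^sup>+y. ennreal (indicator Q x * indicator Q y * (f y - f x)\<^sup>2) \<partial>M \<partial>M) =
     ennreal (\<integral>x. indicator Q x * B - 2 * A * (indicator Q x * f x) + m * (indicator Q x * (f x)\<^sup>2) \<partial>M)"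
    unfolding inner by (rule nn_integral_eq_integral) (use iQ i1 i2 nn in auto)
  also have "(\<integral>x. indicator Q x * B - 2 * A * (indicator Q x * f x) + m * (indicator Q x * (f x)\<^sup>2) \<partial>M) = m * B - 2 * A * A + m * B"
    using iQ i1 i2 Q by (simp add: mQ A_def[symmetric] B_def[symmetric])
  also have "\<dots> = 2 * m * B - 2 * A\<^sup>2" by (simp add: power2_eq_square)
  finally have E: "(\<integral>\<^sup>+x. \<integral>\<^sup>+y. ennreal (indicator Q x * indicator Q y * (f y - f x)\<^sup>2) \<partial>M \<partial>M) = ennreal (2 * m * B - 2 * A\<^sup>2)" .
  \<comment> \<open>\<open>ennreal\<close> sends negative reals to 0, so the difference can be moved
    to the other side only once it is known to be nonnegative.\<close>
  have "0 \<le> (\<integral>x. indicator Q x * B - 2 * A * (indicator Q x * f x) + m * (indicator Q x * (f x)\<^sup>2) \<partial>M)"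
    by (intro integral_nonneg_AE) (use nn in auto)
  also have "\<dots> = m * B - 2 * A * A + m * B"
    using iQ i1 i2 Q by (simp add: mQ A_def[symmetric] B_def[symmetric])
  also have "\<dots> = 2 * m * B - 2 * A\<^sup>2" by (simp add: power2_eq_square)
  finally show ?thesis
    unfolding E A_def[symmetric] B_def[symmetric] by (subst ennreal_plus[symmetric]) auto
qed

text \<open>The variance identity is summed over the cells, and the pairs of points sharing a cell
  are estimated by \<open>C1_compact_cube_translations\<close>. Halving the result would leave half
  of the gradient term; that gain is given up.\<close>

lemma C1_compact_grid:
  fixes f :: "'a::euclidean_space \<Rightarrow> real" and e :: real
  assumes f: "C1_compact f g K" and e: "e > 0" and R: "K \<subseteq> cball 0 R"
  shows "e ^ DIM('a) * (\<integral>x. (f x)\<^sup>2 \<partial>lborel) \<le>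
     (\<Sum>z\<in>grid_index e R. (\<integral>x. indicator (grid_cell e z) x * f x \<partial>lborel)\<^sup>2) +
     (2 * e) ^ DIM('a) * (DIM('a) * e\<^sup>2) * (\<integral>x. (norm (g x))\<^sup>2 \<partial>lborel)"
proof -
  let ?Z = "grid_index e R :: ('a \<Rightarrow> int) set" and ?D = "\<integral>x. (norm (g x))\<^sup>2 \<partial>lborel"
  let ?I = "\<lambda>z. indicator (grid_cell e z) :: 'a \<Rightarrow> real"
  note [measurable] = C1_compact_borel[OF f]
  have D: "?D \<ge> 0" by (intro integral_nonneg_AE) auto
  note i = C1_compact_integrable[OF f]
  have i2: "integrable lborel (\<lambda>x. ?I z x * (f x)\<^sup>2)" for z
    using integrable_mult_indicator[OF _ i(2), of "grid_cell e z"] by simp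
  have "(\<Sum>z\<in>?Z. \<integral>x. ?I z x * (f x)\<^sup>2 \<partial>lborel) = (\<integral>x. (\<Sum>z\<in>?Z. ?I z x * (f x)\<^sup>2) \<partial>lborel)"
    using i2 by simp
  also have "(\<lambda>x. \<Sum>z\<in>?Z. ?I z x * (f x)\<^sup>2) = (\<lambda>x. (f x)\<^sup>2)"
  proof
    fix x show "(\<Sum>z\<in>?Z. ?I z x * (f x)\<^sup>2) = (f x)\<^sup>2"
    proof (cases "x \<in> K")
      case True
      then have "norm x \<le> R" using R by auto
      then show ?thesis using sum_grid_cell[OF e, of x R, where 'b=real] by (simp flip: sum_distrib_right)
    qed (use C1_compactD(4)[OF f] in simp)
  qed
  finally have S: "(\<integral>x. (f x)\<^sup>2 \<partial>lborel) = (\<Sum>z\<in>?Z. \<integral>x. ?I z x * (f x)\<^sup>2 \<partial>lborel)" by simp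
  have "ennreal (2 * e ^ DIM('a) * (\<integral>x. (f x)\<^sup>2 \<partial>lborel)) =
     (\<Sum>z\<in>?Z. ennreal (2 * e ^ DIM('a) * (\<integral>x. ?I z x * (f x)\<^sup>2 \<partial>lborel)))"
    unfolding S using e by (subst sum_ennreal) (auto simp: sum_distrib_left intro!: mult_nonneg_nonneg integral_nonneg_AE)
  also have "\<dots> = (\<Sum>z\<in>?Z. ennreal (2 * (\<integral>x. ?I z x * f x \<partial>lborel)\<^sup>2) +
     (\<integral>\<^sup>+x. \<integral>\<^sup>+y. ennreal (?I z x * ?I z y * (f y - f x)\<^sup>2) \<partial>lborel \<partial>lborel))"
    using e emeasure_grid_cell[OF e] i
    by (intro sum.cong refl integral_square_split sigma_finite_lborel) auto
  also have "\<dots> = ennreal (2 * (\<Sum>z\<in>?Z. (\<integral>x. ?I z x * f x \<partial>lborel)\<^sup>2)) +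
     (\<integral>\<^sup>+x. \<integral>\<^sup>+y. (\<Sum>z\<in>?Z. ennreal (?I z x * ?I z y * (f y - f x)\<^sup>2)) \<partial>lborel \<partial>lborel)"
  proof -
    have "(\<Sum>z\<in>?Z. ennreal (2 * (\<integral>x. ?I z x * f x \<partial>lborel)\<^sup>2)) = ennreal (2 * (\<Sum>z\<in>?Z. (\<integral>x. ?I z x * f x \<partial>lborel)\<^sup>2))"
      by (simp add: sum_distrib_left)
    then show ?thesis
      by (simp add: sum.distrib nn_integral_sum del: sum_ennreal)
  qed
  also have "(\<integral>\<^sup>+x. \<integral>\<^sup>+y. (\<Sum>z\<in>?Z. ennreal (?I z x * ?I z y * (f y - f x)\<^sup>2)) \<partial>lborel \<partial>lborel) \<le>
     (\<integral>\<^sup>+x. \<integral>\<^sup>+y. ennreal (indicator (cbox (- e *\<^sub>R One) (e *\<^sub>R One)) (y - x) * (f y - f x)\<^sup>2) \<partial>lborel \<partial>lborel)"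
  proof (intro nn_integral_mono)
    fix x y :: 'a
    have "(\<Sum>z\<in>?Z. ?I z x * ?I z y) * (f y - f x)\<^sup>2 \<le> indicator (cbox (- e *\<^sub>R One) (e *\<^sub>R One)) (y - x) * (f y - f x)\<^sup>2"
      by (rule mult_right_mono[OF sum_grid_cell_pair_le[OF e]]) simp
    then show "(\<Sum>z\<in>?Z. ennreal (?I z x * ?I z y * (f y - f x)\<^sup>2)) \<le> ennreal (indicator (cbox (- e *\<^sub>R One) (e *\<^sub>R One)) (y - x) * (f y - f x)\<^sup>2)"
      by (subst sum_ennreal) (auto simp: sum_distrib_right intro!: ennreal_leI)
  qed
  also have "\<dots> \<le> ennreal ((2 * e) ^ DIM('a) * (DIM('a) * e\<^sup>2) * ?D)"
    by (rule C1_compact_cube_translations[OF f e])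
  finally have "ennreal (2 * e ^ DIM('a) * (\<integral>x. (f x)\<^sup>2 \<partial>lborel)) \<le>
     ennreal (2 * (\<Sum>z\<in>?Z. (\<integral>x. ?I z x * f x \<partial>lborel)\<^sup>2) + (2 * e) ^ DIM('a) * (DIM('a) * e\<^sup>2) * ?D)"
    using e D by (subst ennreal_plus) (auto intro!: sum_nonneg mult_nonneg_nonneg)
  then have "2 * e ^ DIM('a) * (\<integral>x. (f x)\<^sup>2 \<partial>lborel) \<le>
     2 * (\<Sum>z\<in>?Z. (\<integral>x. ?I z x * f x \<partial>lborel)\<^sup>2) + (2 * e) ^ DIM('a) * (DIM('a) * e\<^sup>2) * ?D"
    using e D by (subst (asm) ennreal_le_iff) (auto intro!: sum_nonneg mult_nonneg_nonneg add_nonneg_nonneg)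
  moreover have "0 \<le> (2 * e) ^ DIM('a) * (DIM('a) * e\<^sup>2) * ?D" using e D by simp
  ultimately show ?thesis by linarith
qed

text \<open>For a nonnegative function the sum of the squared cell integrals is at most the square
  of their sum, which is the full integral. This is Nash's inequality before optimising over the
  cell size \<open>e\<close>.\<close>

lemma C1_compact_Nash:
  fixes f :: "'a::euclidean_space \<Rightarrow> real" and e :: real
  assumes f: "C1_compact f g K" and e: "e > 0" and nn: "\<And>x. f x \<ge> 0"
  shows "(\<integral>x. (f x)\<^sup>2 \<partial>lborel) \<le>
     (\<integral>x. f x \<partial>lborel)\<^sup>2 / e ^ DIM('a) + 2 ^ DIM('a) * DIM('a) * e\<^sup>2 * (\<integral>x. (norm (g x))\<^sup>2 \<partial>lborel)"
proof -
  obtain R where R: "K \<subseteq> cball 0 R"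
    using compact_imp_bounded[OF C1_compactD(3)[OF f]] bounded_subset_ballD ball_subset_cball by (metis order_trans)
  let ?Z = "grid_index e R :: ('a \<Rightarrow> int) set"
  let ?I = "\<lambda>z. indicator (grid_cell e z) :: 'a \<Rightarrow> real"
  have i1: "integrable lborel (\<lambda>x. ?I z x * f x)" for z
    using integrable_mult_indicator[OF _ C1_compact_integrable(1)[OF f], of "grid_cell e z"] by simp
  have "(\<Sum>z\<in>?Z. (\<integral>x. ?I z x * f x \<partial>lborel)\<^sup>2) \<le> (\<Sum>z\<in>?Z. (\<integral>x. ?I z x * f x \<partial>lborel))\<^sup>2"
  proof -
    have nnI: "0 \<le> (\<integral>x. ?I z x * f x \<partial>lborel)" for z by (intro integral_nonneg_AE) (use nn in auto)
    show ?thesis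
      using finite_grid_index[of e R]
    proof (induction rule: finite_induct)
      case (insert z F)
      let ?a = "\<lambda>z. \<integral>x. ?I z x * f x \<partial>lborel"
      have "0 \<le> 2 * ?a z * sum ?a F" using nnI by (intro mult_nonneg_nonneg sum_nonneg) auto
      then show ?case
        unfolding sum.insert[OF insert.hyps] power2_sum using insert.IH by linarith
    qed simp
  qed
  also have "(\<Sum>z\<in>?Z. (\<integral>x. ?I z x * f x \<partial>lborel)) = (\<integral>x. (\<Sum>z\<in>?Z. ?I z x * f x) \<partial>lborel)"
    using i1 by simp
  also have "(\<lambda>x. \<Sum>z\<in>?Z. ?I z x * f x) = f"
  proof
    fix x show "(\<Sum>z\<in>?Z. ?I z x * f x) = f x"
    proof (cases "x \<in> K")
      case True
      then have "norm x \<le> R" using R by auto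
      then show ?thesis using sum_grid_cell[OF e, of x R, where 'b=real] by (simp flip: sum_distrib_right)
    qed (use C1_compactD(4)[OF f] in simp)
  qed
  finally have "(\<Sum>z\<in>?Z. (\<integral>x. ?I z x * f x \<partial>lborel)\<^sup>2) \<le> (\<integral>x. f x \<partial>lborel)\<^sup>2" .
  then have "e ^ DIM('a) * (\<integral>x. (f x)\<^sup>2 \<partial>lborel) \<le> (\<integral>x. f x \<partial>lborel)\<^sup>2 +
     (2 * e) ^ DIM('a) * (DIM('a) * e\<^sup>2) * (\<integral>x. (norm (g x))\<^sup>2 \<partial>lborel)"
    using C1_compact_grid[OF f e R] by linarith
  then show ?thesis
    using e by (simp add: field_simps power_mult_distrib)
qed

subsection \<open>The Sobolev inequality\<close>

text \<open>
  A second difference of squares of positive parts: it is \<open>0\<close> up to \<open>1\<close> and \<open>2\<close> from \<open>3\<close> on.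
\<close>
definition C1_step :: "real \<Rightarrow> real" where
  "C1_step q = (max 0 (q - 1))\<^sup>2 - 2 * (max 0 (q - 2))\<^sup>2 + (max 0 (q - 3))\<^sup>2"

text \<open>A tent of height 2 over the interval from 1 to 3.\<close>

definition C1_step' :: "real \<Rightarrow> real" where
  "C1_step' q = 2 * max 0 (q - 1) - 4 * max 0 (q - 2) + 2 * max 0 (q - 3)"

lemma DERIV_square_positive_part:
  "((\<lambda>q. (max 0 (q - c))\<^sup>2) has_real_derivative 2 * max 0 (q - c)) (at q)"
proof -
  consider "q > c" | "q < c" | "q = c" by linarith
  then show ?thesis
  proof cases
    case 1
    have "((\<lambda>q. (q - c)\<^sup>2) has_real_derivative 2 * max 0 (q - c)) (at q)"
      using 1 by (auto intro!: derivative_eq_intros)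
    then show ?thesis
      by (rule has_field_derivative_transform_within_open[of _ _ _ "{c<..}"]) (use 1 in auto)
  next
    case 2
    have "((\<lambda>q. 0) has_real_derivative 2 * max 0 (q - c)) (at q)"
      using 2 by auto
    then show ?thesis
      by (rule has_field_derivative_transform_within_open[of _ _ _ "{..<c}"]) (use 2 in auto)
  next
    case 3
    have "((\<lambda>h. (max 0 h)\<^sup>2 / h) \<longlongrightarrow> 0) (at (0::real))"
    proof (rule Lim_null_comparison)
      show "\<forall>\<^sub>F h in at (0::real). norm ((max 0 h)\<^sup>2 / h) \<le> \<bar>h\<bar>"
        by (auto simp: max_def power2_eq_square)
      show "((\<lambda>h::real. \<bar>h\<bar>) \<longlongrightarrow> 0) (at 0)"
        by (rule tendsto_eq_intros refl)+ simp
    qed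
    then show ?thesis using 3 by (simp add: DERIV_def)
  qed
qed

lemma DERIV_C1_step: "(C1_step has_real_derivative C1_step' q) (at q)"
  unfolding C1_step_def[abs_def] C1_step'_def
  using DERIV_add[OF DERIV_diff[OF DERIV_square_positive_part[of 1 q]
      DERIV_cmult[OF DERIV_square_positive_part[of 2 q], of 2]] DERIV_square_positive_part[of 3 q]] by simp

lemma C1_step_simps: "q \<le> 1 \<Longrightarrow> C1_step q = 0" "q \<ge> 3 \<Longrightarrow> C1_step q = 2"
  by (auto simp: C1_step_def max_def power2_eq_square algebra_simps)

lemma C1_step'_simps: "q \<le> 1 \<Longrightarrow> C1_step' q = 0" "q \<ge> 3 \<Longrightarrow> C1_step' q = 0"
  by (auto simp: C1_step'_def max_def)

lemma C1_step'_bounds: "0 \<le> C1_step' q" "C1_step' q \<le> 2"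
  by (auto simp: C1_step'_def max_def)

lemma C1_step_bounds: "0 \<le> C1_step q" "C1_step q \<le> 2"
proof -
  have mono: "C1_step x \<le> C1_step y" if "x \<le> y" for x y
    by (rule DERIV_nonneg_imp_nondecreasing[OF that]) (use DERIV_C1_step C1_step'_bounds in blast)
  show "0 \<le> C1_step q" using mono[of "min q 1" q] by (simp add: C1_step_simps)
  show "C1_step q \<le> 2" using mono[of q "max q 3"] by (simp add: C1_step_simps)
qed

text \<open>The step acts on the square of \<open>f x / r\<close>, since the absolute value is not
  differentiable at 0. The result is 0 where \<open>\<bar>f x\<bar> \<le> r\<close> and has the
  constant value \<open>2 * r\<close> where \<open>\<bar>f x\<bar> \<ge> 2 * r\<close>.\<close>

lemma C1_compact_truncate:
  assumes f: "C1_compact f g K" and r: "r > 0"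
  shows "C1_compact (\<lambda>x. r * C1_step ((f x)\<^sup>2 / r\<^sup>2))
     (\<lambda>x. (r * (C1_step' ((f x)\<^sup>2 / r\<^sup>2) * (2 * f x / r\<^sup>2))) *\<^sub>R g x) K"
  unfolding C1_compact_def
proof (intro conjI allI impI)
  show "compact K" by (rule C1_compactD(3)[OF f])
  show "r * C1_step ((f x)\<^sup>2 / r\<^sup>2) = 0" if "x \<notin> K" for x
    using C1_compactD(4)[OF f that] by (simp add: C1_step_simps)
  have "continuous_on UNIV C1_step'"
    unfolding C1_step'_def[abs_def] by (intro continuous_intros)
  then have "continuous_on UNIV (\<lambda>x. C1_step' ((f x)\<^sup>2 / r\<^sup>2))"
    by (rule continuous_on_compose2) (auto simp: divide_inverse intro!: continuous_intros C1_compact_continuous[OF f])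
  then show "continuous_on UNIV (\<lambda>x. (r * (C1_step' ((f x)\<^sup>2 / r\<^sup>2) * (2 * f x / r\<^sup>2))) *\<^sub>R g x)"
    unfolding divide_inverse
    by (intro continuous_intros C1_compact_continuous[OF f] C1_compactD(2)[OF f]) (simp add: divide_inverse)
  show "GDERIV (\<lambda>x. r * C1_step ((f x)\<^sup>2 / r\<^sup>2)) x :> (r * (C1_step' ((f x)\<^sup>2 / r\<^sup>2) * (2 * f x / r\<^sup>2))) *\<^sub>R g x" for x
  proof (rule GDERIV_DERIV_compose[OF C1_compactD(1)[OF f]])
    show "((\<lambda>s. r * C1_step (s\<^sup>2 / r\<^sup>2)) has_real_derivative r * (C1_step' ((f x)\<^sup>2 / r\<^sup>2) * (2 * f x / r\<^sup>2))) (at (f x))"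
      by (intro DERIV_cmult DERIV_chain2[OF DERIV_C1_step]) (use r in \<open>auto intro!: derivative_eq_intros simp: field_simps power2_eq_square\<close>)
  qed
qed

section \<open>Decay of the superlevel sets\<close>

lemma C1_compact_level_finite:
  assumes f: "C1_compact f g K" and "s \<ge> 0"
  shows "emeasure lborel {x. \<bar>f x\<bar> > s} < \<infinity>"
proof -
  have "{x. \<bar>f x\<bar> > s} \<subseteq> K" using C1_compactD(4)[OF f] assms(2) by fastforce
  then have "emeasure lborel {x. \<bar>f x\<bar> > s} \<le> emeasure lborel K"
    using C1_compactD(3)[OF f] borel_compact by (intro emeasure_mono) auto
  then show ?thesis using emeasure_compact_finite[OF C1_compactD(3)[OF f]] by (rule le_less_trans)
qed

text \<open>Nash's inequality for the truncation \<open>T\<close>: it equals \<open>2 * r\<close> on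
  the higher superlevel set, its integral is at most \<open>2 * r\<close> times the measure of the
  lower one, and its gradient lives on the band between the two levels.\<close>

lemma C1_compact_level_estimate:
  fixes f :: "'a::euclidean_space \<Rightarrow> real" and e r :: real
  assumes f: "C1_compact f g K" and e: "e > 0" and r: "r > 0"
  shows "r\<^sup>2 * measure lborel {x. \<bar>f x\<bar> > 2 * r} \<le> r\<^sup>2 * (measure lborel {x. \<bar>f x\<bar> > r})\<^sup>2 / e ^ DIM('a) +
    2 ^ DIM('a) * real DIM('a) * 16 * e\<^sup>2 * (\<integral>x. indicator {x. r < \<bar>f x\<bar> \<and> \<bar>f x\<bar> < 2 * r} x * (norm (g x))\<^sup>2 \<partial>lborel)"
proof -
  note [measurable] = C1_compact_borel[OF f]
  define T where "T x = r * C1_step ((f x)\<^sup>2 / r\<^sup>2)" for x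
  define G where "G x = (r * (C1_step' ((f x)\<^sup>2 / r\<^sup>2) * (2 * f x / r\<^sup>2))) *\<^sub>R g x" for x
  have T: "C1_compact T G K" unfolding T_def[abs_def] G_def[abs_def] by (rule C1_compact_truncate[OF f r])
  let ?A = "\<lambda>s. {x. \<bar>f x\<bar> > s}" and ?S = "{x. r < \<bar>f x\<bar> \<and> \<bar>f x\<bar> < 2 * r}"
  have A_meas [measurable]: "?A s \<in> sets lborel" for s by measurable
  have S_meas [measurable]: "?S \<in> sets lborel" by measurable
  have iA: "integrable lborel (indicator (?A s) :: _ \<Rightarrow> real)" if "s \<ge> 0" for s
    using C1_compact_level_finite[OF f that] by (simp add: integrable_indicator_iff)
  have q1: "(f x)\<^sup>2 / r\<^sup>2 \<le> 1 \<longleftrightarrow> \<bar>f x\<bar> \<le> r" for x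
    using r abs_le_square_iff[of "f x" r] by (simp add: field_simps)
  have q4: "(f x)\<^sup>2 / r\<^sup>2 \<ge> 4" if "\<bar>f x\<bar> \<ge> 2 * r" for x
    using r that abs_le_square_iff[of "2 * r" "f x"] by (simp add: field_simps power_mult_distrib)
  have Tnn: "T x \<ge> 0" for x using C1_step_bounds r by (simp add: T_def)
  have "4 * r\<^sup>2 * measure lborel (?A (2 * r)) = (\<integral>x. 4 * r\<^sup>2 * indicator (?A (2 * r)) x \<partial>lborel)"
    using r by simp
  also have "\<dots> \<le> (\<integral>x. (T x)\<^sup>2 \<partial>lborel)"
  proof (rule integral_mono)
    show "integrable lborel (\<lambda>x. 4 * r\<^sup>2 * indicator (?A (2 * r)) x)" using r by (intro integrable_mult_right iA) simp
    show "integrable lborel (\<lambda>x. (T x)\<^sup>2)" by (rule C1_compact_integrable(2)[OF T])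
    show "4 * r\<^sup>2 * indicator (?A (2 * r)) x \<le> (T x)\<^sup>2" for x
    proof (cases "\<bar>f x\<bar> > 2 * r")
      case True
      then have "C1_step ((f x)\<^sup>2 / r\<^sup>2) = 2" using q4[of x] by (intro C1_step_simps) auto
      then show ?thesis using True by (simp add: T_def power_mult_distrib)
    qed simp
  qed
  also have "\<dots> \<le> (\<integral>x. T x \<partial>lborel)\<^sup>2 / e ^ DIM('a) + 2 ^ DIM('a) * DIM('a) * e\<^sup>2 * (\<integral>x. (norm (G x))\<^sup>2 \<partial>lborel)"
    by (rule C1_compact_Nash[OF T e Tnn])
  also have "\<dots> \<le> (2 * r * measure lborel (?A r))\<^sup>2 / e ^ DIM('a) +
      2 ^ DIM('a) * DIM('a) * e\<^sup>2 * (64 * (\<integral>x. indicator ?S x * (norm (g x))\<^sup>2 \<partial>lborel))"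
  proof (intro add_mono divide_right_mono mult_left_mono power_mono)
    have "(\<integral>x. T x \<partial>lborel) \<le> (\<integral>x. 2 * r * indicator (?A r) x \<partial>lborel)"
    proof (rule integral_mono)
      show "integrable lborel (\<lambda>x. 2 * r * indicator (?A r) x)" using r by (intro integrable_mult_right iA) simp
      show "integrable lborel T" by (rule C1_compact_integrable(1)[OF T])
      show "T x \<le> 2 * r * indicator (?A r) x" for x
      proof (cases "\<bar>f x\<bar> > r")
        case True
        then show ?thesis using C1_step_bounds(2)[of "(f x)\<^sup>2 / r\<^sup>2"] r by (simp add: T_def)
      next
        case False
        then show ?thesis using q1[of x] by (simp add: T_def C1_step_simps)
      qed
    qed
    then show "(\<integral>x. T x \<partial>lborel) \<le> 2 * r * measure lborel (?A r)" by simp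
    have "(\<integral>x. (norm (G x))\<^sup>2 \<partial>lborel) \<le> (\<integral>x. 64 * (indicator ?S x * (norm (g x))\<^sup>2) \<partial>lborel)"
    proof (rule integral_mono)
      have "integrable lborel (\<lambda>x. indicator ?S x *\<^sub>R (norm (g x))\<^sup>2)"
        by (rule integrable_mult_indicator[OF S_meas C1_compact_integrable(3)[OF f]])
      then show "integrable lborel (\<lambda>x. 64 * (indicator ?S x * (norm (g x))\<^sup>2))" by simp
      show "integrable lborel (\<lambda>x. (norm (G x))\<^sup>2)" by (rule C1_compact_integrable(3)[OF T])
      show "(norm (G x))\<^sup>2 \<le> 64 * (indicator ?S x * (norm (g x))\<^sup>2)" for x
      proof (cases "x \<in> ?S")
        case True
        \<comment> \<open>On the band the ratio \<open>\<bar>f x\<bar> / r\<close> and the tent are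
          both at most 2, which gives the factor 8 and its square 64; dividing the final estimate by
          4 leaves the 16 of the statement.\<close>
        have "\<bar>r * (C1_step' ((f x)\<^sup>2 / r\<^sup>2) * (2 * f x / r\<^sup>2))\<bar> = C1_step' ((f x)\<^sup>2 / r\<^sup>2) * (2 * (\<bar>f x\<bar> / r))"
          using r C1_step'_bounds(1) by (simp add: abs_mult power2_eq_square)
        also have "\<dots> \<le> 2 * (2 * 2)"
          using True r C1_step'_bounds by (intro mult_mono) (auto simp: field_simps)
        finally have "norm (G x) \<le> 8 * norm (g x)"
          unfolding G_def norm_scaleR by (intro mult_right_mono) auto
        then have "(norm (G x))\<^sup>2 \<le> (8 * norm (g x))\<^sup>2" by (intro power_mono) auto
        then show ?thesis using True by (simp add: power_mult_distrib)
      next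
        case False
        then have "\<bar>f x\<bar> \<le> r \<or> \<bar>f x\<bar> \<ge> 2 * r" by auto
        then have "C1_step' ((f x)\<^sup>2 / r\<^sup>2) = 0"
          using q1[of x] q4[of x] by (auto intro: C1_step'_simps)
        then show ?thesis by (simp add: G_def)
      qed
    qed
    then show "(\<integral>x. (norm (G x))\<^sup>2 \<partial>lborel) \<le> 64 * (\<integral>x. indicator ?S x * (norm (g x))\<^sup>2 \<partial>lborel)" by simp
  qed (use e Tnn in \<open>auto intro!: integral_nonneg_AE mult_nonneg_nonneg\<close>)
  finally show ?thesis by (simp add: power_mult_distrib field_simps)
qed

text \<open>The cell volume is taken proportional to the measure of the superlevel set, so the first
  term of the level estimate becomes a multiple of \<open>b r\<close>, as small as \<open>d\<close>
  prescribes. The second becomes a power of \<open>b r\<close> times the energy on the band, with no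
  power of \<open>r\<close> left over, because of the value of \<open>p\<close>.\<close>

lemma C1_compact_level_decay:
  fixes f :: "'a::euclidean_space \<Rightarrow> real" and r d p :: real
  assumes N: "DIM('a) \<ge> 3" and p: "p = 2 * real DIM('a) / (real DIM('a) - 2)"
    and f: "C1_compact f g K" and r: "r > 0" and d: "d > 0"
  defines "b \<equiv> \<lambda>r. r powr p * measure lborel {x. \<bar>f x\<bar> > r}"
  shows "b (2 * r) \<le> 2 powr p * d * b r + 2 powr p * (2 ^ DIM('a) * real DIM('a) * 16) * d powr - (2 / real DIM('a)) *
     b r powr (2 / real DIM('a)) * (\<integral>x. indicator {x. r < \<bar>f x\<bar> \<and> \<bar>f x\<bar> < 2 * r} x * (norm (g x))\<^sup>2 \<partial>lborel)"
proof -
  note [measurable] = C1_compact_borel[OF f]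
  let ?A = "\<lambda>s. {x. \<bar>f x\<bar> > s}"
  let ?D = "\<integral>x. indicator {x. r < \<bar>f x\<bar> \<and> \<bar>f x\<bar> < 2 * r} x * (norm (g x))\<^sup>2 \<partial>lborel"
  define m where "m s = measure lborel (?A s)" for s
  have m0: "m s \<ge> 0" for s by (simp add: m_def)
  let ?N = "real DIM('a)"
  have N3: "?N \<ge> 3" using N by simp
  show ?thesis
  proof (cases "m r = 0")
    case True
    have "m (2 * r) \<le> m r"
      unfolding m_def using C1_compact_level_finite[OF f, of r] r by (intro measure_mono_fmeasurable fmeasurableI) auto
    then have "m (2 * r) = 0" using True m0[of "2 * r"] by linarith
    then show ?thesis using True by (simp add: b_def m_def)
  next
    case False
    then have mr: "m r > 0" using m0[of r] by linarith
    \<comment> \<open>Chosen to make the cell volume \<open>m r / d\<close>.\<close>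
    define e where "e = (m r / d) powr (1 / ?N)"
    have e: "e > 0" using mr d by (simp add: e_def)
    have eN: "e ^ DIM('a) = m r / d"
      using mr d N by (simp add: e_def powr_realpow[symmetric] powr_powr)
    have e2: "e\<^sup>2 = m r powr (2 / ?N) * d powr - (2 / ?N)"
    proof -
      have "e\<^sup>2 = (m r / d) powr (2 / ?N)"
        using mr d by (simp add: e_def powr_realpow[symmetric] powr_powr)
      then show ?thesis using mr d by (simp add: powr_divide powr_minus_divide)
    qed
    let ?c = "2 ^ DIM('a) * ?N * 16"
    have "r\<^sup>2 * m (2 * r) \<le> r\<^sup>2 * (m r)\<^sup>2 / e ^ DIM('a) + ?c * e\<^sup>2 * ?D"
      unfolding m_def by (rule C1_compact_level_estimate[OF f e r])
    also have "r\<^sup>2 * (m r)\<^sup>2 / e ^ DIM('a) = d * r\<^sup>2 * m r"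
      using mr d by (simp add: eN power2_eq_square)
    finally have "r powr (p - 2) * (r\<^sup>2 * m (2 * r)) \<le> r powr (p - 2) * (d * r\<^sup>2 * m r + ?c * e\<^sup>2 * ?D)"
      by (intro mult_left_mono) auto
    also have "r powr (p - 2) * (d * r\<^sup>2 * m r + ?c * e\<^sup>2 * ?D) =
        d * ((r powr (p - 2) * r\<^sup>2) * m r) + ?c * (r powr (p - 2) * e\<^sup>2) * ?D"
      by (simp add: algebra_simps)
    also have "r powr (p - 2) * (r\<^sup>2 * m (2 * r)) = (r powr (p - 2) * r\<^sup>2) * m (2 * r)" by simp
    finally have "(r powr (p - 2) * r\<^sup>2) * m (2 * r) \<le>
        d * ((r powr (p - 2) * r\<^sup>2) * m r) + ?c * (r powr (p - 2) * e\<^sup>2) * ?D" .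
    moreover have rp: "r powr (p - 2) * r\<^sup>2 = r powr p"
      using r powr_add[of r "p - 2" 2] by simp
    moreover have "r powr (p - 2) * e\<^sup>2 = d powr - (2 / ?N) * b r powr (2 / ?N)"
    proof -
      have "p * (2 / ?N) = p - 2" using N3 by (simp add: p field_simps)
      then have "(r powr p) powr (2 / ?N) = r powr (p - 2)" by (simp add: powr_powr)
      then show ?thesis unfolding e2 b_def m_def[symmetric] using r mr by (simp add: powr_mult mult_ac)
    qed
    ultimately have *: "r powr p * m (2 * r) \<le> d * b r + ?c * (d powr - (2 / ?N) * b r powr (2 / ?N)) * ?D"
      by (simp add: b_def m_def)
    have "b (2 * r) = 2 powr p * (r powr p * m (2 * r))"
      using r by (simp add: b_def m_def powr_mult)
    also have "\<dots> \<le> 2 powr p * (d * b r + ?c * (d powr - (2 / ?N) * b r powr (2 / ?N)) * ?D)"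
      by (intro mult_left_mono *) auto
    finally show ?thesis by (simp add: algebra_simps)
  qed
qed

lemma geometric_level_exists:
  fixes R y :: real
  assumes "0 < y" "y \<le> R"
  shows "\<exists>j. R / 2 ^ Suc j < y \<and> y \<le> R / 2 ^ j"
proof -
  obtain k where k: "R / 2 ^ k < y"
  proof -
    obtain k where "R / y < 2 ^ k" using real_arch_pow[of 2 "R / y"] by auto
    then show ?thesis using that[of k] assms(1) by (simp add: field_simps)
  qed
  define n where "n = (LEAST k. R / 2 ^ k < y)"
  have n: "R / 2 ^ n < y" unfolding n_def using k by (rule LeastI)
  have least: "\<not> R / 2 ^ k < y" if "k < n" for k using that not_less_Least unfolding n_def by blast
  have "n \<noteq> 0" using n assms(2) by (cases n) auto
  then show ?thesis using n least[of "n - 1"] by (intro exI[of _ "n - 1"]) auto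
qed

text \<open>With B the sum of \<open>r powr p\<close> times the measure of the superlevel set over
  dyadic levels \<open>r\<close>, the recursion sums to B \<le> B / 2 + A B^(2/N) D, where D is the
  energy. Absorbing B / 2 bounds B by a power of D, and B controls the integral up to the factor
  \<open>2 powr p\<close>.\<close>

theorem C1_compact_Sobolev:
  assumes N: "DIM('a::euclidean_space) \<ge> 3" and p: "p = 2 * real DIM('a) / (real DIM('a) - 2)"
  shows "\<exists>C>0. \<forall>f g K. C1_compact (f :: 'a \<Rightarrow> real) g K \<longrightarrow>
    (\<integral>x. \<bar>f x\<bar> powr p \<partial>lborel) \<le> C * (\<integral>x. (norm (g x))\<^sup>2 \<partial>lborel) powr (p / 2)"
proof -
  let ?N = "real DIM('a)"
  have N3: "?N \<ge> 3" using N by simp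
  have p2: "p > 2" using N3 by (simp add: p field_simps)
  \<comment> \<open>This reads \<open>(2 powr - p) / 2\<close>; it gives the first term of the
    recursion the coefficient 1 / 2, small enough to be absorbed.\<close>
  define d :: real where "d = 2 powr - p / 2"
  have d: "d > 0" "2 powr p * d = 1 / 2" by (simp_all add: d_def powr_minus)
  define A where "A = 2 powr p * (2 ^ DIM('a) * ?N * 16) * d powr - (2 / ?N)"
  have A: "A > 0" using d by (simp add: A_def)
  show ?thesis
  proof (intro exI[of _ "2 powr p * (2 * A) powr (p / 2)"] conjI allI impI)
    show "0 < 2 powr p * (2 * A) powr (p / 2)" using A by simp
    fix f :: "'a \<Rightarrow> real" and g K assume f: "C1_compact f g K"
    note [measurable] = C1_compact_borel[OF f]
    define D where "D = (\<integral>x. (norm (g x))\<^sup>2 \<partial>lborel)"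
    have D: "D \<ge> 0" unfolding D_def by (intro integral_nonneg_AE) auto
    obtain R where R: "R > 0" "\<And>x. norm (f x) \<le> R"
      using bounded_compact_support[OF C1_compact_continuous[OF f] C1_compactD(3,4)[OF f]] by blast
    define r where "r j = R / 2 ^ j" for j :: nat
    have r: "r j > 0" "r j = 2 * r (Suc j)" for j using R by (simp_all add: r_def)
    define m where "m s = measure lborel {x. \<bar>f x\<bar> > s}" for s
    define c where "c j = r j powr p * m (r j)" for j
    define E where "E j = (\<integral>x. indicator {x. r j < \<bar>f x\<bar> \<and> \<bar>f x\<bar> < 2 * r j} x * (norm (g x))\<^sup>2 \<partial>lborel)" for j
    have c0: "c j \<ge> 0" for j by (simp add: c_def m_def)
    have E0: "E j \<ge> 0" for j unfolding E_def by (intro integral_nonneg_AE) auto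
    have rec: "c j \<le> c (Suc j) / 2 + A * c (Suc j) powr (2 / ?N) * E (Suc j)" for j
      using C1_compact_level_decay[OF N p f r(1)[of "Suc j"] d(1)] r(2)[of j] d(2)
      by (simp add: c_def m_def E_def A_def)
    have mono: "m s \<le> m 0" if "s \<ge> 0" for s
      unfolding m_def using that C1_compact_level_finite[OF f, of 0]
      by (intro measure_mono_fmeasurable fmeasurableI) auto
    \<comment> \<open>Absorbing half of the sum is legitimate only if the sum is finite. This is a
      qualitative matter: all superlevel sets lie in \<open>K\<close>, and \<open>r j powr p\<close>
      decays geometrically.\<close>
    have sc: "summable c"
    proof (rule summable_comparison_test'[where N=0])
      show "summable (\<lambda>j. R powr p * m 0 * (2 powr - p) ^ j)"
        using p2 by (intro summable_mult summable_geometric) (simp add: powr_less_one)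
      show "norm (c j) \<le> R powr p * m 0 * (2 powr - p) ^ j" for j
      proof -
        have "r j powr p = R powr p * (2 powr - p) ^ j"
          using R by (simp add: r_def powr_divide powr_realpow[symmetric] powr_powr powr_minus_divide power_divide mult.commute)
        then have "c j = R powr p * m (r j) * (2 powr - p) ^ j" by (simp add: c_def)
        also have "\<dots> \<le> R powr p * m 0 * (2 powr - p) ^ j"
          using mono[of "r j"] r(1)[of j] by (intro mult_right_mono mult_left_mono) auto
        finally show ?thesis using c0[of j] by simp
      qed
    qed
    define B where "B = (\<Sum>j. c j)"
    have B0: "B \<ge> 0" unfolding B_def by (rule suminf_nonneg[OF sc c0])
    have cB: "c j \<le> B" for j unfolding B_def using sum_le_suminf[OF sc, of "{j}"] c0 by simp
    \<comment> \<open>The bands are pairwise disjoint, since the upper end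
      \<open>2 * r (Suc j)\<close> of a band is the lower end \<open>r j\<close> of the next higher
      one; their energies therefore add up to at most \<open>D\<close>.\<close>
    have sE: "(\<Sum>j<n. E (Suc j)) \<le> D" for n
    proof -
      let ?S = "\<lambda>j. {x. r j < \<bar>f x\<bar> \<and> \<bar>f x\<bar> < 2 * r j}"
      have [measurable]: "?S j \<in> sets lborel" for j by measurable
      have i: "integrable lborel (\<lambda>x. indicator (?S j) x * (norm (g x))\<^sup>2)" for j
        using integrable_mult_indicator[OF _ C1_compact_integrable(3)[OF f], of "?S j"] by simp
      have le1: "(\<Sum>j<n. indicator (?S (Suc j)) x) \<le> (1::real)" for x
      proof (cases "\<exists>j<n. x \<in> ?S (Suc j)")
        case True
        then obtain k where k: "k < n" "x \<in> ?S (Suc k)" by blast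
        have rmono: "r j \<le> r i" if "i \<le> j" for i j
          using that R unfolding r_def by (intro divide_left_mono power_increasing) auto
        have *: "j = k" if "x \<in> ?S (Suc j)" for j
        proof (rule ccontr)
          assume "j \<noteq> k"
          then consider "Suc j \<le> k" | "Suc k \<le> j" by linarith
          then show False
          proof cases
            case 1 then show False using rmono[OF 1] r(2)[of k] that k(2) by auto
          next
            case 2 then show False using rmono[OF 2] r(2)[of j] that k(2) by auto
          qed
        qed
        then have "(\<Sum>j<n. indicator (?S (Suc j)) x :: real) = (\<Sum>j<n. if j = k then 1 else 0)"
        proof (intro sum.cong refl)
          fix j
          have "x \<in> ?S (Suc j) \<longleftrightarrow> j = k" using k(2) * by blast
          then show "indicator (?S (Suc j)) x = (if j = k then 1 else 0::real)" by (simp add: indicator_def)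
        qed
        then show ?thesis using k(1) by simp
      next
        case False
        then have "(\<Sum>j<n. indicator (?S (Suc j)) x) = (0::real)" by (intro sum.neutral) auto
        then show ?thesis by simp
      qed
      have "(\<Sum>j<n. E (Suc j)) = (\<integral>x. (\<Sum>j<n. indicator (?S (Suc j)) x * (norm (g x))\<^sup>2) \<partial>lborel)"
        unfolding E_def using i by (subst Bochner_Integration.integral_sum) auto
      also have "\<dots> \<le> D"
        unfolding D_def
      proof (rule integral_mono)
        show "integrable lborel (\<lambda>x. \<Sum>j<n. indicator (?S (Suc j)) x * (norm (g x))\<^sup>2)"
          using i by (intro Bochner_Integration.integrable_sum) auto
        show "(\<Sum>j<n. indicator (?S (Suc j)) x * (norm (g x))\<^sup>2) \<le> (norm (g x))\<^sup>2" for x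
          using mult_right_mono[OF le1, of "(norm (g x))\<^sup>2" x] by (simp add: sum_distrib_right)
      qed (rule C1_compact_integrable(3)[OF f])
      finally show ?thesis .
    qed
    have "B \<le> B / 2 + A * B powr (2 / ?N) * D"
      unfolding B_def
    proof (rule suminf_le_const[OF sc])
      fix n
      have "(\<Sum>j<n. c j) \<le> (\<Sum>j<n. c (Suc j) / 2 + A * B powr (2 / ?N) * E (Suc j))"
      proof (rule sum_mono)
        fix j
        have "A * c (Suc j) powr (2 / ?N) * E (Suc j) \<le> A * B powr (2 / ?N) * E (Suc j)"
          using A E0 c0 cB by (intro mult_right_mono mult_left_mono powr_mono2) auto
        then show "c j \<le> c (Suc j) / 2 + A * B powr (2 / ?N) * E (Suc j)" using rec[of j] by linarith
      qed
      also have "\<dots> = (\<Sum>j<n. c (Suc j)) / 2 + A * B powr (2 / ?N) * (\<Sum>j<n. E (Suc j))"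
        by (simp add: sum.distrib sum_divide_distrib sum_distrib_left)
      also have "\<dots> \<le> B / 2 + A * B powr (2 / ?N) * D"
      proof (intro add_mono mult_left_mono sE divide_right_mono)
        have "(\<Sum>j<n. c (Suc j)) = sum c (Suc ` {..<n})" by (simp add: sum.reindex)
        also have "\<dots> \<le> B" unfolding B_def by (rule sum_le_suminf[OF sc]) (auto simp: c0)
        finally show "(\<Sum>j<n. c (Suc j)) \<le> B" .
      qed (use A in auto)
      finally show "(\<Sum>j<n. c j) \<le> (\<Sum>j. c j) / 2 + A * (\<Sum>j. c j) powr (2 / ?N) * D" by (simp add: B_def)
    qed
    then have B1: "B \<le> 2 * A * D * B powr (2 / ?N)" by argo
    have B2: "B \<le> (2 * A * D) powr (p / 2)"
    proof (cases "B = 0")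
      case False
      then have B: "B > 0" using B0 by simp
      have "B powr (1 - 2 / ?N) = B / B powr (2 / ?N)" using B by (simp add: powr_diff)
      also have "\<dots> \<le> 2 * A * D" using B1 B by (simp add: divide_le_eq)
      finally have "(B powr (1 - 2 / ?N)) powr (p / 2) \<le> (2 * A * D) powr (p / 2)"
        using p2 by (intro powr_mono2) auto
      moreover have "(1 - 2 / ?N) * (p / 2) = 1" using N3 by (simp add: p field_simps)
      ultimately show ?thesis using B by (simp add: powr_powr)
    qed simp
    have cp: "continuous_on UNIV (\<lambda>x. \<bar>f x\<bar> powr p)"
      using C1_compact_continuous[OF f] p2 by (intro continuous_on_powr' continuous_intros) auto
    have ip: "integrable lborel (\<lambda>x. \<bar>f x\<bar> powr p)"
      using C1_compactD(4)[OF f] p2 by (intro integrable_compact_support[OF cp C1_compactD(3)[OF f]]) auto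
    have "ennreal (\<integral>x. \<bar>f x\<bar> powr p \<partial>lborel) = (\<integral>\<^sup>+x. ennreal (\<bar>f x\<bar> powr p) \<partial>lborel)"
      by (rule nn_integral_eq_integral[symmetric, OF ip]) auto
    \<comment> \<open>Layer cake over dyadic bands: a point with
      \<open>r (Suc j) < \<bar>f x\<bar> \<le> r j\<close> is charged to the term \<open>j\<close>.
      Trading \<open>r j\<close> for \<open>r (Suc j)\<close> costs the factor
      \<open>2 powr p\<close>.\<close>
    also have "\<dots> \<le> (\<integral>\<^sup>+x. (\<Sum>j. ennreal (r j powr p) * indicator {x. \<bar>f x\<bar> > r (Suc j)} x) \<partial>lborel)"
    proof (rule nn_integral_mono)
      fix x
      show "ennreal (\<bar>f x\<bar> powr p) \<le> (\<Sum>j. ennreal (r j powr p) * indicator {x. \<bar>f x\<bar> > r (Suc j)} x)"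
      proof (cases "f x = 0")
        case False
        then obtain j where j: "r (Suc j) < \<bar>f x\<bar>" "\<bar>f x\<bar> \<le> r j"
          using geometric_level_exists[of "\<bar>f x\<bar>" R] R(2)[of x] by (auto simp: r_def)
        have "ennreal (\<bar>f x\<bar> powr p) \<le> ennreal (r j powr p) * indicator {x. \<bar>f x\<bar> > r (Suc j)} x"
          using j p2 by (auto intro!: ennreal_leI powr_mono2)
        also have "\<dots> \<le> (\<Sum>j. ennreal (r j powr p) * indicator {x. \<bar>f x\<bar> > r (Suc j)} x)"
        proof -
          have "h j \<le> (\<Sum>j. h j)" for h :: "nat \<Rightarrow> ennreal" using sum_le_suminf[of h "{j}"] by simp
          then show ?thesis .
        qed
        finally show ?thesis .
      qed (use p2 in simp)
    qed
    also have "\<dots> = (\<Sum>j. \<integral>\<^sup>+x. ennreal (r j powr p) * indicator {x. \<bar>f x\<bar> > r (Suc j)} x \<partial>lborel)"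
      by (rule nn_integral_suminf) measurable
    also have "\<dots> = (\<Sum>j. ennreal (2 powr p * c (Suc j)))"
    proof (rule suminf_cong)
      fix j
      have "(\<integral>\<^sup>+x. ennreal (r j powr p) * indicator {x. \<bar>f x\<bar> > r (Suc j)} x \<partial>lborel) = ennreal (r j powr p) * emeasure lborel {x. \<bar>f x\<bar> > r (Suc j)}"
        by (subst nn_integral_cmult_indicator) auto
      also have "emeasure lborel {x. \<bar>f x\<bar> > r (Suc j)} = ennreal (m (r (Suc j)))"
        unfolding m_def using C1_compact_level_finite[OF f, of "r (Suc j)"] r(1)[of "Suc j"]
        by (intro emeasure_eq_ennreal_measure) auto
      also have "ennreal (r j powr p) * ennreal (m (r (Suc j))) = ennreal (2 powr p * c (Suc j))"
        using r(2)[of j] r(1)[of "Suc j"] by (subst ennreal_mult[symmetric]) (auto simp: c_def m_def powr_mult)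
      finally show "(\<integral>\<^sup>+x. ennreal (r j powr p) * indicator {x. \<bar>f x\<bar> > r (Suc j)} x \<partial>lborel) = ennreal (2 powr p * c (Suc j))" .
    qed
    also have "\<dots> = ennreal (\<Sum>j. 2 powr p * c (Suc j))"
      using sc c0 by (intro suminf_ennreal2) (auto simp: summable_Suc_iff)
    also have "\<dots> \<le> ennreal (2 powr p * B)"
    proof (rule ennreal_leI)
      have "(\<Sum>j. c (Suc j)) = B - c 0" unfolding B_def using suminf_split_head[OF sc] .
      moreover have "(\<Sum>j. 2 powr p * c (Suc j)) = 2 powr p * (\<Sum>j. c (Suc j))"
        using sc by (intro suminf_mult) (simp add: summable_Suc_iff)
      ultimately show "(\<Sum>j. 2 powr p * c (Suc j)) \<le> 2 powr p * B" using c0[of 0] by simp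
    qed
    finally have "(\<integral>x. \<bar>f x\<bar> powr p \<partial>lborel) \<le> 2 powr p * B"
      using B0 by (subst (asm) ennreal_le_iff) auto
    also have "\<dots> \<le> 2 powr p * (2 * A * D) powr (p / 2)" using B2 by simp
    finally show "(\<integral>x. \<bar>f x\<bar> powr p \<partial>lborel) \<le> 2 powr p * (2 * A) powr (p / 2) * (\<integral>x. (norm (g x))\<^sup>2 \<partial>lborel) powr (p / 2)"
      using A D by (simp add: powr_mult D_def)
  qed
qed

subsection \<open>Square integrable functions\<close>

text \<open>Arbitrary measures, so that \<open>lborel\<close> and
  \<open>lebesgue_on \<Omega>\<close>, as well as functions and gradients, share one set of
  lemmas.\<close>

definition square_integrable :: "'a measure \<Rightarrow> ('a \<Rightarrow> 'b::euclidean_space) \<Rightarrow> bool" where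
  "square_integrable M f \<longleftrightarrow> f \<in> borel_measurable M \<and> integrable M (\<lambda>x. (norm (f x))\<^sup>2)"

lemma square_integrable_measurable [measurable_dest]: "square_integrable M f \<Longrightarrow> f \<in> borel_measurable M"
  by (simp add: square_integrable_def)

lemma square_integrableD: "square_integrable M f \<Longrightarrow> integrable M (\<lambda>x. (norm (f x))\<^sup>2)"
  by (simp add: square_integrable_def)

lemma square_integrable_inner:
  assumes f: "square_integrable M f" and g: "square_integrable M g"
  shows "integrable M (\<lambda>x. f x \<bullet> g x)"
proof (rule Bochner_Integration.integrable_bound)
  show "integrable M (\<lambda>x. (norm (f x))\<^sup>2 + (norm (g x))\<^sup>2)"
    using f g by (simp add: square_integrable_def)
  show "(\<lambda>x. f x \<bullet> g x) \<in> borel_measurable M"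
    using f g by (auto dest: square_integrable_measurable)
  show "AE x in M. norm (f x \<bullet> g x) \<le> norm ((norm (f x))\<^sup>2 + (norm (g x))\<^sup>2)"
  proof (rule AE_I2)
    fix x
    have "\<bar>f x \<bullet> g x\<bar> \<le> norm (f x) * norm (g x)" by (rule Cauchy_Schwarz_ineq2)
    also have "\<dots> \<le> (norm (f x))\<^sup>2 + (norm (g x))\<^sup>2"
      using sum_squares_bound[of "norm (f x)" "norm (g x)"] mult_nonneg_nonneg[OF norm_ge_zero norm_ge_zero, of "f x" "g x"] by linarith
    finally show "norm (f x \<bullet> g x) \<le> norm ((norm (f x))\<^sup>2 + (norm (g x))\<^sup>2)" by simp
  qed
qed

lemma norm_lincomb_square:
  fixes u v :: "'b::real_inner"
  shows "(norm (c *\<^sub>R u + d *\<^sub>R v))\<^sup>2 = c\<^sup>2 * (norm u)\<^sup>2 + 2 * c * d * (u \<bullet> v) + d\<^sup>2 * (norm v)\<^sup>2"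
  unfolding power2_norm_eq_inner
  by (simp add: inner_add_left inner_add_right inner_commute power2_eq_square algebra_simps)

lemma square_integrable_lincomb:
  assumes f: "square_integrable M f" and g: "square_integrable M g"
  shows "square_integrable M (\<lambda>x. c *\<^sub>R f x + d *\<^sub>R g x)"
    and "(\<integral>x. (norm (c *\<^sub>R f x + d *\<^sub>R g x))\<^sup>2 \<partial>M) =
      c\<^sup>2 * (\<integral>x. (norm (f x))\<^sup>2 \<partial>M) + 2 * c * d * (\<integral>x. f x \<bullet> g x \<partial>M) + d\<^sup>2 * (\<integral>x. (norm (g x))\<^sup>2 \<partial>M)"
  using square_integrable_inner[OF f g] f g
  by (simp_all add: square_integrable_def norm_lincomb_square borel_measurable_add borel_measurable_scaleR)

lemma square_integrable_diff:
  assumes f: "square_integrable M f" and g: "square_integrable M g"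
  shows "square_integrable M (\<lambda>x. f x - g x)"
    and "(\<integral>x. (norm (f x - g x))\<^sup>2 \<partial>M) =
      (\<integral>x. (norm (f x))\<^sup>2 \<partial>M) - 2 * (\<integral>x. f x \<bullet> g x \<partial>M) + (\<integral>x. (norm (g x))\<^sup>2 \<partial>M)"
  using square_integrable_lincomb[OF f g, of 1 "-1"] by simp_all

lemma square_integrable_add:
  assumes f: "square_integrable M f" and g: "square_integrable M g"
  shows "square_integrable M (\<lambda>x. f x + g x)"
    and "(\<integral>x. (norm (f x + g x))\<^sup>2 \<partial>M) =
      (\<integral>x. (norm (f x))\<^sup>2 \<partial>M) + 2 * (\<integral>x. f x \<bullet> g x \<partial>M) + (\<integral>x. (norm (g x))\<^sup>2 \<partial>M)"
  using square_integrable_lincomb[OF f g, of 1 1] by simp_all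

lemma square_integrable_scaleR:
  assumes f: "square_integrable M f"
  shows "square_integrable M (\<lambda>x. c *\<^sub>R f x)"
  using square_integrable_lincomb(1)[OF f f, of c 0] by simp

lemma integral_square_nonneg: "0 \<le> (\<integral>x. (norm (f x))\<^sup>2 \<partial>M)"
  by (intro integral_nonneg_AE) auto

lemma integral_Cauchy_Schwarz:
  assumes f: "square_integrable M f" and g: "square_integrable M g"
  shows "(\<integral>x. f x \<bullet> g x \<partial>M)\<^sup>2 \<le> (\<integral>x. (norm (f x))\<^sup>2 \<partial>M) * (\<integral>x. (norm (g x))\<^sup>2 \<partial>M)"
proof -
  define A B C where "A = (\<integral>x. (norm (f x))\<^sup>2 \<partial>M)" and "B = (\<integral>x. f x \<bullet> g x \<partial>M)" and "C = (\<integral>x. (norm (g x))\<^sup>2 \<partial>M)"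
  have nn: "0 \<le> c\<^sup>2 * A + 2 * c * d * B + d\<^sup>2 * C" for c d
    unfolding A_def B_def C_def square_integrable_lincomb(2)[OF f g, symmetric] by (rule integral_square_nonneg)
  have C0: "C \<ge> 0" unfolding C_def by (rule integral_square_nonneg)
  have "B\<^sup>2 \<le> A * C"
  proof (cases "C = 0")
    case True
    have "B = 0"
    proof (rule ccontr)
      assume "B \<noteq> 0"
      \<comment> \<open>With \<open>C = 0\<close> the form is affine in its second argument, and
        this argument makes its value -1.\<close>
      then show False using nn[of 1 "- (A + 1) / (2 * B)"] True by (auto simp: field_simps)
    qed
    then show ?thesis using True by simp
  next
    case False
    have "0 \<le> C\<^sup>2 * A + 2 * C * (- B) * B + (- B)\<^sup>2 * C" by (rule nn)
    also have "\<dots> = C * (A * C - B\<^sup>2)" by (simp add: power2_eq_square algebra_simps)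
    finally show ?thesis using False C0 by (simp add: zero_le_mult_iff)
  qed
  then show ?thesis by (simp add: A_def B_def C_def)
qed

lemma integral_square_add_le:
  assumes f: "square_integrable M f" and g: "square_integrable M g"
  shows "(\<integral>x. (norm (f x + g x))\<^sup>2 \<partial>M) \<le> 2 * (\<integral>x. (norm (f x))\<^sup>2 \<partial>M) + 2 * (\<integral>x. (norm (g x))\<^sup>2 \<partial>M)"
  using integral_square_nonneg[of M "\<lambda>x. f x - g x"]
  unfolding square_integrable_add(2)[OF f g] square_integrable_diff(2)[OF f g] by linarith

lemma L2_tendsto_inner:
  assumes f: "\<And>n. square_integrable M (f n)" "square_integrable M F" "(\<lambda>n. \<integral>x. (norm (F x - f n x))\<^sup>2 \<partial>M) \<longlonglongrightarrow> 0"
    and g: "\<And>n. square_integrable M (g n)" "\<And>n. (\<integral>x. (norm (g n x))\<^sup>2 \<partial>M) \<le> B"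
  shows "(\<lambda>n. (\<integral>x. F x \<bullet> g n x \<partial>M) - (\<integral>x. f n x \<bullet> g n x \<partial>M)) \<longlonglongrightarrow> 0"
proof (rule Lim_null_comparison[OF always_eventually, rule_format])
  have "(\<lambda>n. sqrt ((\<integral>x. (norm (F x - f n x))\<^sup>2 \<partial>M) * B)) \<longlonglongrightarrow> sqrt (0 * B)"
    by (intro tendsto_intros f)
  then show "(\<lambda>n. sqrt ((\<integral>x. (norm (F x - f n x))\<^sup>2 \<partial>M) * B)) \<longlonglongrightarrow> 0" by simp
  fix n
  have "(\<integral>x. F x \<bullet> g n x \<partial>M) - (\<integral>x. f n x \<bullet> g n x \<partial>M) = (\<integral>x. (F x - f n x) \<bullet> g n x \<partial>M)"
    using square_integrable_inner[OF f(2) g(1)[of n]] square_integrable_inner[OF f(1)[of n] g(1)[of n]]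
    by (simp add: inner_diff_left)
  moreover have "(\<integral>x. (F x - f n x) \<bullet> g n x \<partial>M)\<^sup>2 \<le> (\<integral>x. (norm (F x - f n x))\<^sup>2 \<partial>M) * B"
    by (rule order_trans[OF integral_Cauchy_Schwarz[OF square_integrable_diff(1)[OF f(2) f(1)] g(1)]])
       (intro mult_left_mono g(2) integral_square_nonneg)
  ultimately show "norm ((\<integral>x. F x \<bullet> g n x \<partial>M) - (\<integral>x. f n x \<bullet> g n x \<partial>M)) \<le> sqrt ((\<integral>x. (norm (F x - f n x))\<^sup>2 \<partial>M) * B)"
    by (simp add: real_le_rsqrt)
qed

lemma L2_tendsto_inner_const:
  assumes f: "\<And>n. square_integrable M (f n)" "square_integrable M F" "(\<lambda>n. \<integral>x. (norm (F x - f n x))\<^sup>2 \<partial>M) \<longlonglongrightarrow> 0"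
    and g: "square_integrable M g"
  shows "(\<lambda>n. \<integral>x. f n x \<bullet> g x \<partial>M) \<longlonglongrightarrow> (\<integral>x. F x \<bullet> g x \<partial>M)"
proof -
  have "(\<lambda>n. (\<integral>x. F x \<bullet> g x \<partial>M) - (\<integral>x. f n x \<bullet> g x \<partial>M)) \<longlonglongrightarrow> 0"
    by (rule L2_tendsto_inner[OF f, of "\<lambda>_. g"]) (use g in auto)
  from tendsto_diff[OF tendsto_const this, of "\<integral>x. F x \<bullet> g x \<partial>M"] show ?thesis by simp
qed

lemma L2_tendsto_norm:
  assumes f: "\<And>n. square_integrable M (f n)" "square_integrable M F" "(\<lambda>n. \<integral>x. (norm (F x - f n x))\<^sup>2 \<partial>M) \<longlonglongrightarrow> 0"
  shows "(\<lambda>n. \<integral>x. (norm (f n x))\<^sup>2 \<partial>M) \<longlonglongrightarrow> (\<integral>x. (norm (F x))\<^sup>2 \<partial>M)"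
proof -
  have "(\<lambda>n. (\<integral>x. (norm (F x - f n x))\<^sup>2 \<partial>M) + 2 * (\<integral>x. f n x \<bullet> F x \<partial>M) - (\<integral>x. (norm (F x))\<^sup>2 \<partial>M)) \<longlonglongrightarrow>
    0 + 2 * (\<integral>x. F x \<bullet> F x \<partial>M) - (\<integral>x. (norm (F x))\<^sup>2 \<partial>M)"
    by (intro tendsto_intros f L2_tendsto_inner_const)
  moreover have "(\<integral>x. (norm (F x - f n x))\<^sup>2 \<partial>M) + 2 * (\<integral>x. f n x \<bullet> F x \<partial>M) - (\<integral>x. (norm (F x))\<^sup>2 \<partial>M) = (\<integral>x. (norm (f n x))\<^sup>2 \<partial>M)" for n
    unfolding square_integrable_diff(2)[OF f(2) f(1)] by (simp add: inner_commute)
  ultimately show ?thesis by (simp add: power2_norm_eq_inner)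
qed

text \<open>The Riesz-Fischer argument. Along a fast subsequence the weighted squares of the
  increments have a finite sum almost everywhere, and norm(d) \<le> 2^(-k) + 2^k norm(d)^2 turns
  this into absolute convergence of the increments.\<close>

lemma L2_complete:
  fixes f :: "nat \<Rightarrow> 'a \<Rightarrow> 'b::euclidean_space"
  assumes f: "\<And>n. square_integrable M (f n)"
    and C: "\<And>e. e > 0 \<Longrightarrow> \<exists>N. \<forall>m\<ge>N. \<forall>n\<ge>N. (\<integral>x. (norm (f m x - f n x))\<^sup>2 \<partial>M) < e"
  obtains F r where "square_integrable M F" "(\<lambda>n. \<integral>x. (norm (F x - f n x))\<^sup>2 \<partial>M) \<longlonglongrightarrow> 0"
    "strict_mono (r :: nat \<Rightarrow> nat)" "AE x in M. (\<lambda>n. f (r n) x) \<longlonglongrightarrow> F x"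
proof -
  note [measurable] = square_integrable_measurable[OF f]
  have "\<exists>N. \<forall>k. \<forall>m\<ge>N k. \<forall>n\<ge>N k. (\<integral>x. (norm (f m x - f n x))\<^sup>2 \<partial>M) < (1 / 4) ^ k"
    using C[of "(1/4) ^ _"] by (intro choice) auto
  then obtain N where N: "\<And>k m n. m \<ge> N k \<Longrightarrow> n \<ge> N k \<Longrightarrow> (\<integral>x. (norm (f m x - f n x))\<^sup>2 \<partial>M) < (1 / 4) ^ k"
    by blast
  \<comment> \<open>A strictly increasing choice with \<open>r k \<ge> N k\<close>: the increments
    have squared norm below \<open>(1 / 4) ^ k\<close>, so they remain summable with the weights
    \<open>2 ^ k\<close>.\<close>
  define r where "r = rec_nat (N 0) (\<lambda>k rk. max (Suc rk) (N (Suc k)))"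
  have rS: "r (Suc k) = max (Suc (r k)) (N (Suc k))" for k by (simp add: r_def)
  have sm: "strict_mono r" by (rule strict_mono_Suc_iff[THEN iffD2]) (simp add: rS less_max_iff_disj)
  have rN: "r k \<ge> N k" for k by (cases k) (simp_all add: rS, simp add: r_def)
  define d where "d k x = f (r (Suc k)) x - f (r k) x" for k x
  have dk: "(\<integral>x. (norm (d k x))\<^sup>2 \<partial>M) < (1 / 4) ^ k" for k
    unfolding d_def using rN[of k] by (intro N) (auto simp: rS)
  have sd: "square_integrable M (d k)" for k unfolding d_def by (intro square_integrable_diff f)
  note [measurable] = square_integrable_measurable[OF sd]
  have "(\<integral>\<^sup>+x. (\<Sum>k. ennreal (2 ^ k * (norm (d k x))\<^sup>2)) \<partial>M) = (\<Sum>k. \<integral>\<^sup>+x. ennreal (2 ^ k * (norm (d k x))\<^sup>2) \<partial>M)"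
    by (rule nn_integral_suminf) measurable
  also have "\<dots> \<le> (\<Sum>k. ennreal ((1 / 2) ^ k))"
  proof (rule suminf_le)
    fix k
    have "(\<integral>\<^sup>+x. ennreal (2 ^ k * (norm (d k x))\<^sup>2) \<partial>M) = ennreal (\<integral>x. 2 ^ k * (norm (d k x))\<^sup>2 \<partial>M)"
      using square_integrableD[OF sd] by (intro nn_integral_eq_integral) auto
    also have "\<dots> \<le> ennreal (2 ^ k * (1 / 4) ^ k)"
      using dk[of k] by (intro ennreal_leI) auto
    also have "2 ^ k * (1 / 4) ^ k = (1 / 2 :: real) ^ k" by (simp flip: power_mult_distrib)
    finally show "(\<integral>\<^sup>+x. ennreal (2 ^ k * (norm (d k x))\<^sup>2) \<partial>M) \<le> ennreal ((1 / 2) ^ k)" .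
  qed auto
  also have "\<dots> = ennreal (\<Sum>k. (1 / 2) ^ k)" by (intro suminf_ennreal2) (auto intro: summable_geometric)
  also have "\<dots> < \<infinity>" by simp
  finally have "AE x in M. (\<Sum>k. ennreal (2 ^ k * (norm (d k x))\<^sup>2)) \<noteq> \<infinity>"
    by (intro nn_integral_noteq_infinite) auto
  then have conv: "AE x in M. convergent (\<lambda>k. f (r k) x)"
  proof eventually_elim
    case (elim x)
    then have s: "summable (\<lambda>k. 2 ^ k * (norm (d k x))\<^sup>2)"
      by (intro summable_suminf_not_top) auto
    have "summable (\<lambda>k. norm (d k x))"
    proof (rule summable_comparison_test'[where N=0])
      show "summable (\<lambda>k. (1 / 2) ^ k + 2 ^ k * (norm (d k x))\<^sup>2)"
        by (intro summable_add s summable_geometric) auto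
      fix k
      have "norm (d k x) = (1 / 2) ^ k * (2 ^ k * norm (d k x))" by (simp add: power_divide)
      also have "\<dots> \<le> (1 / 2) ^ k * (1 + (2 ^ k * norm (d k x))\<^sup>2)"
      proof (rule mult_left_mono)
        have "2 * y \<le> 1 + y\<^sup>2" if "y \<ge> 0" for y :: real using sum_squares_bound[of 1 y] by simp
        then have "y \<le> 1 + y\<^sup>2" if "y \<ge> 0" for y :: real using that by fastforce
        then show "2 ^ k * norm (d k x) \<le> 1 + (2 ^ k * norm (d k x))\<^sup>2" by simp
      qed simp
      also have "\<dots> = (1 / 2) ^ k + 2 ^ k * (norm (d k x))\<^sup>2"
        by (simp add: power_divide power_mult_distrib power2_eq_square distrib_left)
      finally show "norm (norm (d k x)) \<le> (1 / 2) ^ k + 2 ^ k * (norm (d k x))\<^sup>2" by simp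
    qed
    then have "summable (\<lambda>k. d k x)" by (rule summable_norm_cancel)
    then have "convergent (\<lambda>n. \<Sum>k<n. d k x)" by (simp add: summable_iff_convergent)
    then have "convergent (\<lambda>n. f (r 0) x + (\<Sum>k<n. d k x))" by (intro convergent_add convergent_const)
    moreover have "f (r 0) x + (\<Sum>k<n. d k x) = f (r n) x" for n
      by (induction n) (simp_all add: d_def algebra_simps)
    ultimately show ?case by simp
  qed
  define F where "F x = lim (\<lambda>k. f (r k) x)" for x
  have [measurable]: "F \<in> borel_measurable M" unfolding F_def by measurable
  have lim: "AE x in M. (\<lambda>k. f (r k) x) \<longlonglongrightarrow> F x"
    using conv by eventually_elim (simp add: F_def convergent_LIMSEQ_iff)
  \<comment> \<open>Fatou's lemma along the subsequence carries the Cauchy bound over to the limit;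
    it serves both to place \<open>F\<close> in \<open>L\<^sup>2\<close> and to prove convergence of
    the whole sequence.\<close>
  have key: "(\<integral>\<^sup>+x. ennreal ((norm (F x - f n x))\<^sup>2) \<partial>M) \<le> ennreal e"
    if e: "\<And>m. m \<ge> N0 \<Longrightarrow> (\<integral>x. (norm (f m x - f n x))\<^sup>2 \<partial>M) \<le> e" for n e N0
  proof -
    have "(\<integral>\<^sup>+x. ennreal ((norm (F x - f n x))\<^sup>2) \<partial>M) \<le> (\<integral>\<^sup>+x. liminf (\<lambda>k. ennreal ((norm (f (r k) x - f n x))\<^sup>2)) \<partial>M)"
    proof (rule nn_integral_mono_AE)
      show "AE x in M. ennreal ((norm (F x - f n x))\<^sup>2) \<le> liminf (\<lambda>k. ennreal ((norm (f (r k) x - f n x))\<^sup>2))"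
        using lim
      proof eventually_elim
        case (elim x)
        then have "(\<lambda>k. ennreal ((norm (f (r k) x - f n x))\<^sup>2)) \<longlonglongrightarrow> ennreal ((norm (F x - f n x))\<^sup>2)"
          by (intro tendsto_ennrealI tendsto_intros)
        from lim_imp_Liminf[OF sequentially_bot this] show ?case by simp
      qed
    qed
    also have "\<dots> \<le> liminf (\<lambda>k. \<integral>\<^sup>+x. ennreal ((norm (f (r k) x - f n x))\<^sup>2) \<partial>M)"
      by (rule nn_integral_liminf) measurable
    also have "\<dots> \<le> ennreal e"
    proof (rule order_trans[OF Liminf_le_Limsup[OF sequentially_bot] Limsup_bounded])
      have "r k \<ge> N0" if "k \<ge> N0" for k using seq_suble[OF sm, of k] that by linarith
      then show "\<forall>\<^sub>F k in sequentially. (\<integral>\<^sup>+x. ennreal ((norm (f (r k) x - f n x))\<^sup>2) \<partial>M) \<le> ennreal e"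
        using e square_integrableD[OF square_integrable_diff(1)[OF f f]]
        by (intro eventually_sequentiallyI[of N0]) (subst nn_integral_eq_integral; auto intro!: ennreal_leI)
    qed
    finally show ?thesis .
  qed
  have sF: "square_integrable M F"
  proof -
    obtain N1 where N1: "\<And>m n. m \<ge> N1 \<Longrightarrow> n \<ge> N1 \<Longrightarrow> (\<integral>x. (norm (f m x - f n x))\<^sup>2 \<partial>M) < 1"
      using C[of 1] by auto
    have "(\<integral>\<^sup>+x. ennreal ((norm (F x - f N1 x))\<^sup>2) \<partial>M) \<le> ennreal 1"
      by (rule key[of N1]) (use N1 in \<open>auto intro: less_imp_le\<close>)
    then have "integrable M (\<lambda>x. (norm (F x - f N1 x))\<^sup>2)"
      by (intro integrableI_nonneg) (auto intro: le_less_trans)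
    then have "square_integrable M (\<lambda>x. F x - f N1 x)" by (simp add: square_integrable_def)
    from square_integrable_add(1)[OF this f[of N1]] show ?thesis by simp
  qed
  have "(\<lambda>n. \<integral>x. (norm (F x - f n x))\<^sup>2 \<partial>M) \<longlonglongrightarrow> 0"
  proof (rule LIMSEQ_I)
    fix e :: real assume "e > 0"
    then obtain N1 where N1: "\<And>m n. m \<ge> N1 \<Longrightarrow> n \<ge> N1 \<Longrightarrow> (\<integral>x. (norm (f m x - f n x))\<^sup>2 \<partial>M) < e / 2"
      using C[of "e / 2"] by auto
    have "norm ((\<integral>x. (norm (F x - f n x))\<^sup>2 \<partial>M) - 0) < e" if "n \<ge> N1" for n
    proof -
      have "(\<integral>\<^sup>+x. ennreal ((norm (F x - f n x))\<^sup>2) \<partial>M) \<le> ennreal (e / 2)"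
        by (rule key[of N1]) (use N1 that in \<open>auto intro: less_imp_le\<close>)
      then have "(\<integral>x. (norm (F x - f n x))\<^sup>2 \<partial>M) \<le> e / 2"
        using square_integrableD[OF square_integrable_diff(1)[OF sF f[of n]]] \<open>e > 0\<close>
        by (subst (asm) nn_integral_eq_integral) (auto simp: ennreal_le_iff)
      then show ?thesis using \<open>e > 0\<close> integral_square_nonneg[of M "\<lambda>x. F x - f n x"] by simp
    qed
    then show "\<exists>no. \<forall>n\<ge>no. norm ((\<integral>x. (norm (F x - f n x))\<^sup>2 \<partial>M) - 0) < e" by blast
  qed
  then show ?thesis using that sF sm lim by blast
qed

subsection \<open>Integration over an open set\<close>

text \<open>\<open>ennreal\<close> cuts off negative values, so the two densities are those of the
  positive and the negative part of \<open>f\<close>. They agree on boxes, an intersection-stable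
  generator of the Borel sets, hence everywhere.\<close>

lemma AE_zero_of_box_integrals:
  fixes f :: "'a::euclidean_space \<Rightarrow> real"
  assumes f: "integrable lborel f" and z: "\<And>c d. (\<integral>x. indicator (box c d) x * f x \<partial>lborel) = 0"
  shows "AE x in lborel. f x = 0"
proof -
  have [measurable]: "f \<in> borel_measurable borel" using f by auto
  let ?P = "density lborel (\<lambda>x. ennreal (f x))" and ?N = "density lborel (\<lambda>x. ennreal (- f x))"
  let ?E = "range (\<lambda>(a, b). box a b :: 'a set)"
  have ip: "integrable lborel (\<lambda>x. max 0 (f x))" and im: "integrable lborel (\<lambda>x. max 0 (- f x))"
    using f by (auto intro: integrable_max)
  have fin: "(\<integral>\<^sup>+x. ennreal (f x) \<partial>lborel) \<noteq> \<infinity>"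
  proof -
    have "(\<integral>\<^sup>+x. ennreal (f x) \<partial>lborel) \<le> (\<integral>\<^sup>+x. ennreal (norm (f x)) \<partial>lborel)"
      by (intro nn_integral_mono ennreal_leI) auto
    also have "\<dots> < \<infinity>" using f by (simp add: integrable_iff_bounded)
    finally show ?thesis by simp
  qed
  have box: "emeasure ?P (box c d) = emeasure ?N (box c d)" "emeasure ?P (box c d) \<noteq> \<infinity>" for c d
  proof -
    have i: "integrable lborel (\<lambda>x. indicator (box c d) x * max 0 (f x))" "integrable lborel (\<lambda>x. indicator (box c d) x * max 0 (- f x))"
      using integrable_mult_indicator[OF _ ip, of "box c d"] integrable_mult_indicator[OF _ im, of "box c d"] by simp_all
    have "emeasure ?P (box c d) = (\<integral>\<^sup>+x. ennreal (indicator (box c d) x * max 0 (f x)) \<partial>lborel)"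
      by (subst emeasure_density) (auto intro!: nn_integral_cong simp: indicator_def max_def ennreal_neg)
    also have "\<dots> = ennreal (\<integral>x. indicator (box c d) x * max 0 (f x) \<partial>lborel)"
      by (rule nn_integral_eq_integral[OF i(1)]) auto
    finally have P: "emeasure ?P (box c d) = \<dots>" .
    have "emeasure ?N (box c d) = (\<integral>\<^sup>+x. ennreal (indicator (box c d) x * max 0 (- f x)) \<partial>lborel)"
      by (subst emeasure_density) (auto intro!: nn_integral_cong simp: indicator_def max_def ennreal_neg)
    also have "\<dots> = ennreal (\<integral>x. indicator (box c d) x * max 0 (- f x) \<partial>lborel)"
      by (rule nn_integral_eq_integral[OF i(2)]) auto
    finally have N: "emeasure ?N (box c d) = \<dots>" .
    have "(\<integral>x. indicator (box c d) x * max 0 (f x) \<partial>lborel) - (\<integral>x. indicator (box c d) x * max 0 (- f x) \<partial>lborel) =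
      (\<integral>x. indicator (box c d) x * f x \<partial>lborel)"
      by (subst Bochner_Integration.integral_diff[OF i, symmetric])
         (auto intro!: Bochner_Integration.integral_cong simp: max_def algebra_simps)
    then show "emeasure ?P (box c d) = emeasure ?N (box c d)" "emeasure ?P (box c d) \<noteq> \<infinity>"
      unfolding P N using z by auto
  qed
  have "?P = ?N"
  proof (rule measure_eqI_generator_eq)
    show "Int_stable ?E" by (auto simp: Int_stable_def box_Int_box)
    show "?E \<subseteq> Pow UNIV" "sets ?P = sigma_sets UNIV ?E" "sets ?N = sigma_sets UNIV ?E"
      by (simp_all add: borel_eq_box)
    let ?A = "\<lambda>n::nat. box (- (real n *\<^sub>R One)) (real n *\<^sub>R One) :: 'a set"
    show "range ?A \<subseteq> ?E" "(\<Union>i. ?A i) = UNIV" unfolding UN_box_eq_UNIV by auto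
    show "emeasure ?P (?A i) \<noteq> \<infinity>" for i by (rule box)
    show "emeasure ?P X = emeasure ?N X" if "X \<in> ?E" for X using that box by auto
  qed
  then have "AE x in lborel. ennreal (f x) = ennreal (- f x)"
    using fin by (subst (asm) finite_density_unique) auto
  then show ?thesis
  proof eventually_elim
    case (elim x)
    then have "f x \<le> 0" "- f x \<le> 0"
      using ennreal_neg[of "- f x"] ennreal_neg[of "f x"] ennreal_eq_0_iff[of "f x"] ennreal_eq_0_iff[of "- f x"]
      by (metis linorder_linear neg_le_0_iff_le)+
    then show ?case by simp
  qed
qed

locale bounded_open_set =
  fixes \<Omega> :: "(real^'n) set"
  assumes open_dom: "open \<Omega>" and bounded_dom: "bounded \<Omega>"
begin

abbreviation M :: "(real^'n) measure" where "M \<equiv> lebesgue_on \<Omega>"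

lemma dom_sets [measurable]: "\<Omega> \<in> sets borel" "\<Omega> \<in> sets lebesgue" "\<Omega> \<inter> space lebesgue \<in> sets lebesgue"
  using open_dom by (auto simp: borel_open)

lemma space_M: "space M = \<Omega>" by (simp add: space_restrict_space)

sublocale finite_measure M
proof
  have "emeasure lebesgue \<Omega> < \<infinity>"
    using bounded_set_imp_lmeasurable[OF bounded_dom] by (auto simp: fmeasurable_def)
  then show "emeasure M (space M) \<noteq> \<infinity>"
    by (simp add: space_M emeasure_restrict_space)
qed

lemma borel_measurable_M:
  fixes f :: "real^'n \<Rightarrow> 'b::topological_space"
  shows "f \<in> borel_measurable borel \<Longrightarrow> f \<in> borel_measurable M"
  by (intro measurable_restrict_space1 measurable_completion) simp

text \<open>The bridge between the estimates on the whole space, stated with \<open>lborel\<close>,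
  and the definitions, stated with \<open>lebesgue_on \<Omega>\<close>.\<close>

lemma integral_M_supported:
  fixes f :: "real^'n \<Rightarrow> real"
  assumes f: "integrable lborel f" and z: "\<And>x. x \<notin> \<Omega> \<Longrightarrow> f x = 0"
  shows "integrable M f" "(\<integral>x. f x \<partial>M) = (\<integral>x. f x \<partial>lborel)"
proof -
  have [measurable]: "f \<in> borel_measurable lborel" using f by auto
  have "(\<lambda>x. indicator \<Omega> x *\<^sub>R f x) = f" using z by (auto simp: fun_eq_iff indicator_def)
  then show "integrable M f" "(\<integral>x. f x \<partial>M) = (\<integral>x. f x \<partial>lborel)"
    using f by (simp_all add: integrable_restrict_space integral_restrict_space integrable_completion integral_completion)
qed

lemma square_integrable_imp_integrable:
  fixes f :: "real^'n \<Rightarrow> real"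
  assumes "square_integrable M f" shows "integrable M f"
proof -
  have "square_integrable M (\<lambda>x. 1 :: real)" by (simp add: square_integrable_def)
  from square_integrable_inner[OF assms this] show ?thesis by simp
qed

text \<open>\<open>f\<close> is only Lebesgue measurable, so it is exchanged for a Borel function
  \<open>F\<close>, to which the result on the whole space applies after restriction to a box.
  Countably many closed boxes cover \<Omega>, and their boundaries are null sets.\<close>

lemma AE_M_zero_of_box_integrals:
  fixes f :: "real^'n \<Rightarrow> real"
  assumes f: "integrable M f" and z: "\<And>a b. cbox a b \<subseteq> \<Omega> \<Longrightarrow> (\<integral>x. indicator (box a b) x * f x \<partial>M) = 0"
  shows "AE x in M. f x = 0"
proof -
  have fi: "integrable lebesgue (\<lambda>x. indicator \<Omega> x * f x)"
    using f by (simp add: integrable_restrict_space)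
  then obtain F where [measurable]: "F \<in> borel_measurable lborel" and F: "AE x in lborel. indicator \<Omega> x * f x = F x"
    using completion_ex_borel_measurable_real[of "\<lambda>x. indicator \<Omega> x * f x" lborel] by auto
  have F': "AE x in lebesgue. indicator \<Omega> x * f x = F x" using F by (rule AE_completion)
  have "integrable lebesgue F"
    using fi F' by (subst integrable_cong_AE[symmetric, OF _ _ F']) (auto intro: measurable_completion)
  then have Fi: "integrable lborel F" by (simp add: integrable_completion)
  have zero: "AE x in lborel. x \<in> cbox a b \<longrightarrow> F x = 0" if ab: "cbox a b \<subseteq> \<Omega>" for a b
  proof -
    have "AE x in lborel. indicator (box a b) x * F x = 0"
    proof (rule AE_zero_of_box_integrals)
      show "integrable lborel (\<lambda>x. indicator (box a b) x * F x)"
        using integrable_mult_indicator[OF _ Fi, of "box a b"] by simp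
      fix c d :: "real^'n"
      \<comment> \<open>The intersection of two open boxes is a box. If it is nonempty, its closure
        stays in \<open>cbox a b\<close>, as the hypothesis on closed boxes inside \<Omega>
        requires.\<close>
      obtain a' b' where e: "box c d \<inter> box a b = box a' b'" "box a' b' \<noteq> {} \<Longrightarrow> cbox a' b' \<subseteq> cbox a b"
      proof (cases "box c d \<inter> box a b = {}")
        case True
        then show ?thesis using that[of 0 0] by simp
      next
        case False
        obtain a' b' where *: "box c d \<inter> box a b = box a' b'" using box_Int_box[of c d a b] by blast
        then have "box a' b' \<subseteq> cbox a b" using box_subset_cbox by blast
        moreover have "box a' b' \<noteq> {}" using False * by simp
        ultimately have "cbox a' b' \<subseteq> cbox a b"
          using closure_minimal[OF _ closed_cbox, of "box a' b'" a b] closure_box[of a' b'] by simp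
        then show ?thesis using that * by blast
      qed
      have "(\<integral>x. indicator (box c d) x * (indicator (box a b) x * F x) \<partial>lborel) = (\<integral>x. indicator (box a' b') x * F x \<partial>lborel)"
        unfolding e(1)[symmetric] by (simp add: indicator_inter_arith mult.assoc)
      also have "\<dots> = (\<integral>x. indicator (box a' b') x * F x \<partial>lebesgue)"
        by (rule integral_completion[symmetric]) measurable
      also have "\<dots> = (\<integral>x. indicator (box a' b') x * (indicator \<Omega> x * f x) \<partial>lebesgue)"
      proof (rule integral_cong_AE)
        show "AE x in lebesgue. indicator (box a' b') x * F x = indicator (box a' b') x * (indicator \<Omega> x * f x)"
          using F' by eventually_elim simp
        show "(\<lambda>x. indicator (box a' b') x * F x) \<in> borel_measurable lebesgue"
          by (rule measurable_completion) measurable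
        show "(\<lambda>x. indicator (box a' b') x * (indicator \<Omega> x * f x)) \<in> borel_measurable lebesgue"
          by (rule borel_measurable_times[OF measurable_completion borel_measurable_integrable[OF fi]]) simp
      qed
      also have "\<dots> = (\<integral>x. indicator (box a' b') x * f x \<partial>M)"
        by (simp add: integral_restrict_space mult.left_commute)
      also have "\<dots> = 0"
      proof (cases "box a' b' = {}")
        case False
        then show ?thesis using z e(2) ab by (meson order_trans)
      qed simp
      finally show "(\<integral>x. indicator (box c d) x * (indicator (box a b) x * F x) \<partial>lborel) = 0" .
    qed
    moreover have "AE x in lborel. x \<notin> cbox a b - box a b"
      by (rule AE_not_in[OF null_sets_cbox_Diff_box])
    ultimately show ?thesis by eventually_elim (auto simp: indicator_def split: if_splits)
  qed
  obtain \<D> where D: "countable \<D>" "\<D> \<subseteq> Pow \<Omega>" "\<And>X. X \<in> \<D> \<Longrightarrow> \<exists>a b. X = cbox a b" "\<Union>\<D> = \<Omega>"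
    using open_countable_Union_open_cbox[OF open_dom] by metis
  have "AE x in lborel. \<forall>X\<in>\<D>. x \<in> X \<longrightarrow> F x = 0"
    unfolding AE_ball_countable[OF D(1)]
  proof
    fix X assume "X \<in> \<D>"
    then obtain a b where "X = cbox a b" "cbox a b \<subseteq> \<Omega>" using D(2,3) by blast
    then show "AE x in lborel. x \<in> X \<longrightarrow> F x = 0" using zero by simp
  qed
  then have "AE x in lborel. x \<in> \<Omega> \<longrightarrow> f x = 0"
    using F
  proof eventually_elim
    case (elim x)
    show ?case
    proof
      assume x: "x \<in> \<Omega>"
      then have "F x = 0" using elim(1) D(4) by blast
      then show "f x = 0" using elim(2) x by simp
    qed
  qed
  then have "AE x in lebesgue. x \<in> \<Omega> \<longrightarrow> f x = 0" by (rule AE_completion)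
  then show ?thesis by (simp add: AE_restrict_space_iff)
qed

lemma test_function_square_integrable:
  assumes "\<phi> \<in> test_functions \<Omega>"
  shows "square_integrable M \<phi>" "square_integrable M (gradient \<phi>)"
    "(\<integral>x. (\<phi> x)\<^sup>2 \<partial>M) = (\<integral>x. (\<phi> x)\<^sup>2 \<partial>lborel)"
    "(\<integral>x. (norm (gradient \<phi> x))\<^sup>2 \<partial>M) = (\<integral>x. (norm (gradient \<phi> x))\<^sup>2 \<partial>lborel)"
proof -
  obtain K where K: "C1_compact \<phi> (gradient \<phi>) K" "K \<subseteq> \<Omega>" using C1_compact_test_function[OF assms] by blast
  have z: "\<phi> x = 0" "gradient \<phi> x = 0" if "x \<notin> \<Omega>" for x
    using that K(2) C1_compactD(4)[OF K(1)] C1_compact_gradient_0[OF K(1)] by blast+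
  note i = C1_compact_integrable(2,3)[OF K(1)]
  show "square_integrable M \<phi>"
    using integral_M_supported(1)[OF i(1)] z borel_measurable_M[OF C1_compact_borel(1)[OF K(1)]]
    by (simp add: square_integrable_def)
  show "square_integrable M (gradient \<phi>)"
    using integral_M_supported(1)[OF i(2)] z borel_measurable_M[OF C1_compact_borel(2)[OF K(1)]]
    by (simp add: square_integrable_def)
  show "(\<integral>x. (\<phi> x)\<^sup>2 \<partial>M) = (\<integral>x. (\<phi> x)\<^sup>2 \<partial>lborel)"
    "(\<integral>x. (norm (gradient \<phi> x))\<^sup>2 \<partial>M) = (\<integral>x. (norm (gradient \<phi> x))\<^sup>2 \<partial>lborel)"
    using integral_M_supported(2)[OF i(1)] integral_M_supported(2)[OF i(2)] z by auto
qed

text \<open>The functions \<open>box_bump a b k\<close> tend boundedly to the indicator of the box,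
  so integrals over boxes vanish as well.\<close>

lemma fundamental_lemma:
  fixes f :: "real^'n \<Rightarrow> real"
  assumes f: "square_integrable M f" and z: "\<And>\<phi>. \<phi> \<in> test_functions \<Omega> \<Longrightarrow> (\<integral>x. f x * \<phi> x \<partial>M) = 0"
  shows "AE x in M. f x = 0"
proof (rule AE_M_zero_of_box_integrals)
  show fi: "integrable M f" by (rule square_integrable_imp_integrable[OF f])
  then have [measurable]: "f \<in> borel_measurable M" by auto
  fix a b assume ab: "cbox a b \<subseteq> \<Omega>"
  note [measurable] = square_integrable_measurable[OF test_function_square_integrable(1)[OF box_bump_test[OF ab]]]
  have "(\<lambda>k. \<integral>x. f x * box_bump a b k x \<partial>M) \<longlonglongrightarrow> (\<integral>x. indicator (box a b) x * f x \<partial>M)"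
  proof (rule integral_dominated_convergence[where w="\<lambda>x. norm (f x)"])
    show "(\<lambda>x. indicator (box a b) x * f x) \<in> borel_measurable M"
      using borel_measurable_M[of "indicator (box a b) :: _ \<Rightarrow> real"] by (intro borel_measurable_times) auto
    show "AE x in M. (\<lambda>k. f x * box_bump a b k x) \<longlonglongrightarrow> indicator (box a b) x * f x"
      using tendsto_mult[OF tendsto_const box_bump_tendsto[of a b]] by (auto simp: mult.commute)
    show "AE x in M. norm (f x * box_bump a b k x) \<le> norm (f x)" for k
      using box_bump_bounds[of a b k] by (auto simp: abs_mult intro!: mult_left_le)
  qed (use fi in auto)
  then show "(\<integral>x. indicator (box a b) x * f x \<partial>M) = 0"
    using z[OF box_bump_test[OF ab]] by (simp add: LIMSEQ_const_iff)
qed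

end

subsection \<open>Weak gradients\<close>

context bounded_open_set
begin

lemma L2_iff: "f \<in> L2 \<Omega> \<longleftrightarrow> square_integrable M f"
  by (simp add: L2_def square_integrable_def)

text \<open>The gradient of the compactly supported product of the two functions integrates to
  zero.\<close>

lemma test_function_integration_by_parts:
  assumes \<phi>: "\<phi> \<in> test_functions \<Omega>" and \<psi>: "\<psi> \<in> test_functions \<Omega>"
  shows "(\<integral>x. \<phi> x * gradient \<psi> x $ i \<partial>M) = - (\<integral>x. gradient \<phi> x $ i * \<psi> x \<partial>M)"
proof -
  obtain K where K: "C1_compact \<phi> (gradient \<phi>) K" "K \<subseteq> \<Omega>" using C1_compact_test_function[OF \<phi>] by blast
  obtain L where L: "C1_compact \<psi> (gradient \<psi>) L" "L \<subseteq> \<Omega>" using C1_compact_test_function[OF \<psi>] by blast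
  define g where "g x = \<phi> x *\<^sub>R gradient \<psi> x + \<psi> x *\<^sub>R gradient \<phi> x" for x
  have C: "C1_compact (\<lambda>x. \<phi> x * \<psi> x) g K"
    unfolding C1_compact_def g_def
  proof (intro conjI allI impI GDERIV_mult continuous_intros)
    show "continuous_on UNIV \<phi>" "continuous_on UNIV \<psi>"
      using C1_compact_continuous[OF K(1)] C1_compact_continuous[OF L(1)] by auto
  qed (use C1_compactD[OF K(1)] C1_compactD[OF L(1)] in auto)
  have cont: "continuous_on UNIV (\<lambda>x. \<phi> x * gradient \<psi> x $ i)" "continuous_on UNIV (\<lambda>x. gradient \<phi> x $ i * \<psi> x)"
    by (intro continuous_intros C1_compact_continuous[OF K(1)] C1_compact_continuous[OF L(1)] C1_compactD(2)[OF K(1)] C1_compactD(2)[OF L(1)])+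
  have int: "integrable lborel (\<lambda>x. \<phi> x * gradient \<psi> x $ i)" "integrable lborel (\<lambda>x. gradient \<phi> x $ i * \<psi> x)"
    using C1_compactD(3,4)[OF K(1)] C1_compact_gradient_0[OF K(1)]
    by (auto intro!: integrable_compact_support[of _ K] cont)
  have z: "\<phi> x = 0" "gradient \<phi> x = 0" if "x \<notin> \<Omega>" for x
    using that K(2) C1_compactD(4)[OF K(1)] C1_compact_gradient_0[OF K(1)] by blast+
  have "(\<integral>x. \<phi> x * gradient \<psi> x $ i \<partial>lborel) + (\<integral>x. gradient \<phi> x $ i * \<psi> x \<partial>lborel) = (\<integral>x. g x \<bullet> axis i 1 \<partial>lborel)"
    using int by (simp add: g_def inner_axis mult.commute flip: Bochner_Integration.integral_add)
  also have "\<dots> = 0" by (rule C1_compact_integral_gradient[OF C])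
  finally show ?thesis
    using z by (subst (1 2) integral_M_supported(2)) (auto simp: int)
qed

lemma square_integrable_component:
  fixes G :: "real^'n \<Rightarrow> real^'n"
  assumes "square_integrable M G" shows "square_integrable M (\<lambda>x. G x $ i)"
proof -
  note [measurable] = square_integrable_measurable[OF assms]
  have "(\<lambda>x. G x \<bullet> axis i 1) \<in> borel_measurable M" by measurable
  then have m: "(\<lambda>x. G x $ i) \<in> borel_measurable M" by (simp add: inner_axis)
  have "integrable M (\<lambda>x. (norm (G x $ i))\<^sup>2)"
  proof (rule Bochner_Integration.integrable_bound[OF square_integrableD[OF assms]])
    show "AE x in M. norm ((norm (G x $ i))\<^sup>2) \<le> norm ((norm (G x))\<^sup>2)"
    proof (rule AE_I2)
      fix x
      have "(norm (G x $ i))\<^sup>2 \<le> (norm (G x))\<^sup>2"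
        using component_le_norm_cart[of "G x" i] by (intro power_mono) auto
      then show "norm ((norm (G x $ i))\<^sup>2) \<le> norm ((norm (G x))\<^sup>2)" by simp
    qed
  qed (use m in measurable)
  then show ?thesis using m by (simp add: square_integrable_def)
qed

lemma weak_gradient_unique:
  assumes G: "square_integrable M G" "has_weak_gradient \<Omega> u G"
    and H: "square_integrable M H" "has_weak_gradient \<Omega> u H"
  shows "AE x in M. G x = H x"
proof -
  have "AE x in M. \<forall>i\<in>UNIV. G x $ i = H x $ i"
  proof (rule AE_finite_allI)
    fix i :: 'n
    have "AE x in M. G x $ i - H x $ i = 0"
    proof (rule fundamental_lemma)
      show "square_integrable M (\<lambda>x. G x $ i - H x $ i)"
        by (intro square_integrable_diff square_integrable_component G H)
      fix \<phi> assume \<phi>: "\<phi> \<in> test_functions \<Omega>"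
      have "(\<integral>x. G x $ i * \<phi> x \<partial>M) = (\<integral>x. H x $ i * \<phi> x \<partial>M)"
        using G(2) H(2) \<phi> unfolding has_weak_gradient_def by force
      moreover have "integrable M (\<lambda>x. G x $ i * \<phi> x)" "integrable M (\<lambda>x. H x $ i * \<phi> x)"
        using square_integrable_inner[OF square_integrable_component[OF G(1), of i] test_function_square_integrable(1)[OF \<phi>]]
          square_integrable_inner[OF square_integrable_component[OF H(1), of i] test_function_square_integrable(1)[OF \<phi>]] by simp_all
      ultimately show "(\<integral>x. (G x $ i - H x $ i) * \<phi> x \<partial>M) = 0"
        by (simp add: left_diff_distrib)
    qed
    then show "AE x in M. G x $ i = H x $ i" by simp
  qed simp
  then show ?thesis by eventually_elim (simp add: vec_eq_iff)
qed

text \<open>Integrals involving the chosen \<open>weak_gradient\<close> can be computed with any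
  square integrable weak gradient at hand.\<close>

lemma weak_gradient_eq:
  assumes G: "square_integrable M G" "has_weak_gradient \<Omega> u G"
  shows "square_integrable M (weak_gradient \<Omega> u)" "AE x in M. weak_gradient \<Omega> u x = G x"
proof -
  have "weak_gradient \<Omega> u \<in> L2 \<Omega> \<and> has_weak_gradient \<Omega> u (weak_gradient \<Omega> u)"
    unfolding weak_gradient_def by (rule someI[of _ G]) (use G in \<open>simp add: L2_iff\<close>)
  then show "square_integrable M (weak_gradient \<Omega> u)" "AE x in M. weak_gradient \<Omega> u x = G x"
    using weak_gradient_unique G by (auto simp: L2_iff)
qed

text \<open>
  Membership of \<open>u\<close> in \<open>H10 \<Omega>\<close> together with its weak gradient \<open>G\<close>, described without the
  choice made in \<^const>\<open>weak_gradient\<close>.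
\<close>
definition sobolev_pair :: "(real^'n \<Rightarrow> real) \<Rightarrow> (real^'n \<Rightarrow> real^'n) \<Rightarrow> bool" where
  "sobolev_pair u G \<longleftrightarrow> square_integrable M u \<and> square_integrable M G \<and>
     (\<exists>\<phi>. (\<forall>n. \<phi> n \<in> test_functions \<Omega>) \<and> (\<lambda>n::nat. \<integral>x. (norm (u x - \<phi> n x))\<^sup>2 \<partial>M) \<longlonglongrightarrow> 0 \<and>
        (\<lambda>n. \<integral>x. (norm (G x - gradient (\<phi> n) x))\<^sup>2 \<partial>M) \<longlonglongrightarrow> 0)"

lemma sobolev_pairD:
  assumes "sobolev_pair u G"
  shows "square_integrable M u" "square_integrable M G"
  using assms by (auto simp: sobolev_pair_def)

lemma sobolev_pair_approx:
  assumes "sobolev_pair u G"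
  obtains \<phi> where "\<And>n. \<phi> n \<in> test_functions \<Omega>" "(\<lambda>n::nat. \<integral>x. (norm (u x - \<phi> n x))\<^sup>2 \<partial>M) \<longlonglongrightarrow> 0"
    "(\<lambda>n. \<integral>x. (norm (G x - gradient (\<phi> n) x))\<^sup>2 \<partial>M) \<longlonglongrightarrow> 0"
  using assms unfolding sobolev_pair_def by blast

lemma sobolev_pair_test: "\<phi> \<in> test_functions \<Omega> \<Longrightarrow> sobolev_pair \<phi> (gradient \<phi>)"
  unfolding sobolev_pair_def by (auto simp: test_function_square_integrable intro!: exI[of _ "\<lambda>_. \<phi>"])

lemma L2_tendsto_lincomb:
  fixes u v :: "real^'n \<Rightarrow> 'b::euclidean_space"
  assumes u: "\<And>n. square_integrable M (u' n)" "square_integrable M u" "(\<lambda>n. \<integral>x. (norm (u x - u' n x))\<^sup>2 \<partial>M) \<longlonglongrightarrow> 0"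
    and v: "\<And>n. square_integrable M (v' n)" "square_integrable M v" "(\<lambda>n. \<integral>x. (norm (v x - v' n x))\<^sup>2 \<partial>M) \<longlonglongrightarrow> 0"
  shows "(\<lambda>n. \<integral>x. (norm ((c *\<^sub>R u x + d *\<^sub>R v x) - (c *\<^sub>R u' n x + d *\<^sub>R v' n x)))\<^sup>2 \<partial>M) \<longlonglongrightarrow> 0"
proof (rule Lim_null_comparison[OF always_eventually, rule_format])
  have "(\<lambda>n. 2 * (c\<^sup>2 * (\<integral>x. (norm (u x - u' n x))\<^sup>2 \<partial>M)) + 2 * (d\<^sup>2 * (\<integral>x. (norm (v x - v' n x))\<^sup>2 \<partial>M))) \<longlonglongrightarrow> 2 * (c\<^sup>2 * 0) + 2 * (d\<^sup>2 * 0)"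
    by (intro tendsto_intros u v)
  then show "(\<lambda>n. 2 * (c\<^sup>2 * (\<integral>x. (norm (u x - u' n x))\<^sup>2 \<partial>M)) + 2 * (d\<^sup>2 * (\<integral>x. (norm (v x - v' n x))\<^sup>2 \<partial>M))) \<longlonglongrightarrow> 0" by simp
  fix n
  have e: "(\<lambda>x. (c *\<^sub>R u x + d *\<^sub>R v x) - (c *\<^sub>R u' n x + d *\<^sub>R v' n x)) =
      (\<lambda>x. c *\<^sub>R (u x - u' n x) + d *\<^sub>R (v x - v' n x))"
    by (simp add: fun_eq_iff algebra_simps)
  have sc: "(\<integral>x. (norm (c *\<^sub>R w x))\<^sup>2 \<partial>M) = c\<^sup>2 * (\<integral>x. (norm (w x))\<^sup>2 \<partial>M)" for c and w :: "real^'n \<Rightarrow> 'b"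
    by (simp add: power_mult_distrib)
  have "(\<integral>x. (norm (c *\<^sub>R (u x - u' n x) + d *\<^sub>R (v x - v' n x)))\<^sup>2 \<partial>M) \<le>
    2 * (\<integral>x. (norm (c *\<^sub>R (u x - u' n x)))\<^sup>2 \<partial>M) + 2 * (\<integral>x. (norm (d *\<^sub>R (v x - v' n x)))\<^sup>2 \<partial>M)"
    by (intro integral_square_add_le square_integrable_scaleR square_integrable_diff u v)
  then show "norm (\<integral>x. (norm ((c *\<^sub>R u x + d *\<^sub>R v x) - (c *\<^sub>R u' n x + d *\<^sub>R v' n x)))\<^sup>2 \<partial>M) \<le>
     2 * (c\<^sup>2 * (\<integral>x. (norm (u x - u' n x))\<^sup>2 \<partial>M)) + 2 * (d\<^sup>2 * (\<integral>x. (norm (v x - v' n x))\<^sup>2 \<partial>M))"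
    unfolding sc fun_cong[OF e]
    using integral_square_nonneg[of M "\<lambda>x. c *\<^sub>R (u x - u' n x) + d *\<^sub>R (v x - v' n x)"] by simp
qed

lemma sobolev_pair_lincomb:
  assumes "sobolev_pair u G" "sobolev_pair v H"
  shows "sobolev_pair (\<lambda>x. c * u x + d * v x) (\<lambda>x. c *\<^sub>R G x + d *\<^sub>R H x)"
proof -
  obtain \<phi> where \<phi>: "\<And>n. \<phi> n \<in> test_functions \<Omega>" "(\<lambda>n::nat. \<integral>x. (norm (u x - \<phi> n x))\<^sup>2 \<partial>M) \<longlonglongrightarrow> 0"
    "(\<lambda>n. \<integral>x. (norm (G x - gradient (\<phi> n) x))\<^sup>2 \<partial>M) \<longlonglongrightarrow> 0" using sobolev_pair_approx[OF assms(1)] by blast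
  obtain \<psi> where \<psi>: "\<And>n. \<psi> n \<in> test_functions \<Omega>" "(\<lambda>n::nat. \<integral>x. (norm (v x - \<psi> n x))\<^sup>2 \<partial>M) \<longlonglongrightarrow> 0"
    "(\<lambda>n. \<integral>x. (norm (H x - gradient (\<psi> n) x))\<^sup>2 \<partial>M) \<longlonglongrightarrow> 0" using sobolev_pair_approx[OF assms(2)] by blast
  note s = sobolev_pairD[OF assms(1)] sobolev_pairD[OF assms(2)]
  note t = test_function_square_integrable(1,2)[OF \<phi>(1)] test_function_square_integrable(1,2)[OF \<psi>(1)]
  show ?thesis
    unfolding sobolev_pair_def
  proof (intro conjI exI[of _ "\<lambda>n x. c * \<phi> n x + d * \<psi> n x"] allI)
    show "square_integrable M (\<lambda>x. c * u x + d * v x)" "square_integrable M (\<lambda>x. c *\<^sub>R G x + d *\<^sub>R H x)"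
      using square_integrable_lincomb(1)[OF s(1) s(3)] square_integrable_lincomb(1)[OF s(2) s(4)] by simp_all
    show "(\<lambda>x. c * \<phi> n x + d * \<psi> n x) \<in> test_functions \<Omega>" for n
      by (rule test_functions_lincomb[OF \<phi>(1) \<psi>(1)])
    show "(\<lambda>n. \<integral>x. (norm (c * u x + d * v x - (c * \<phi> n x + d * \<psi> n x)))\<^sup>2 \<partial>M) \<longlonglongrightarrow> 0"
      using L2_tendsto_lincomb[OF t(1) s(1) \<phi>(2) t(3) s(3) \<psi>(2), of c d] by simp
    show "(\<lambda>n. \<integral>x. (norm (c *\<^sub>R G x + d *\<^sub>R H x - gradient (\<lambda>x. c * \<phi> n x + d * \<psi> n x) x))\<^sup>2 \<partial>M) \<longlonglongrightarrow> 0"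
      unfolding gradient_lincomb[OF \<phi>(1) \<psi>(1)]
      by (rule L2_tendsto_lincomb[OF t(2) s(2) \<phi>(3) t(4) s(4) \<psi>(3)])
  qed
qed

lemma sobolev_pair_weak_gradient:
  assumes "sobolev_pair u G" shows "has_weak_gradient \<Omega> u G"
  unfolding has_weak_gradient_def
proof (intro ballI allI)
  fix \<psi> i assume \<psi>: "\<psi> \<in> test_functions \<Omega>"
  obtain \<phi> where \<phi>: "\<And>n. \<phi> n \<in> test_functions \<Omega>" "(\<lambda>n::nat. \<integral>x. (norm (u x - \<phi> n x))\<^sup>2 \<partial>M) \<longlonglongrightarrow> 0"
    "(\<lambda>n. \<integral>x. (norm (G x - gradient (\<phi> n) x))\<^sup>2 \<partial>M) \<longlonglongrightarrow> 0" using sobolev_pair_approx[OF assms] by blast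
  note s = sobolev_pairD[OF assms]
  note t = test_function_square_integrable(1,2)[OF \<phi>(1)]
  have "(\<lambda>n. \<integral>x. \<phi> n x \<bullet> gradient \<psi> x $ i \<partial>M) \<longlonglongrightarrow> (\<integral>x. u x \<bullet> gradient \<psi> x $ i \<partial>M)"
    by (rule L2_tendsto_inner_const[OF t(1) s(1) \<phi>(2) square_integrable_component[OF test_function_square_integrable(2)[OF \<psi>]]])
  \<comment> \<open>Pairing with \<psi> times a unit vector expresses a component of the gradient as
    an inner product, for which \<open>L\<^sup>2\<close> convergence is available.\<close>
  moreover have "(\<lambda>n. - (\<integral>x. gradient (\<phi> n) x \<bullet> (\<psi> x *\<^sub>R axis i 1) \<partial>M)) \<longlonglongrightarrow> - (\<integral>x. G x \<bullet> (\<psi> x *\<^sub>R axis i 1) \<partial>M)"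
  proof (intro tendsto_minus L2_tendsto_inner_const[OF t(2) s(2) \<phi>(3)])
    show "square_integrable M (\<lambda>x. \<psi> x *\<^sub>R axis i (1::real))"
      using test_function_square_integrable(1)[OF \<psi>] by (simp add: square_integrable_def borel_measurable_scaleR)
  qed
  then have "(\<lambda>n. \<integral>x. \<phi> n x * gradient \<psi> x $ i \<partial>M) \<longlonglongrightarrow> - (\<integral>x. G x $ i * \<psi> x \<partial>M)"
    using test_function_integration_by_parts[OF \<phi>(1) \<psi>] by (simp add: inner_axis mult.commute)
  ultimately show "(\<integral>x. u x * gradient \<psi> x $ i \<partial>M) = - (\<integral>x. G x $ i * \<psi> x \<partial>M)"
    using LIMSEQ_unique by simp blast
qed

lemma sobolev_pair_dirichlet_form:
  assumes "sobolev_pair u G" "sobolev_pair v H"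
  shows "dirichlet_form \<Omega> u v = (\<integral>x. G x \<bullet> H x \<partial>M)"
  unfolding dirichlet_form_def
proof (rule integral_cong_AE)
  note u = weak_gradient_eq[OF sobolev_pairD(2) sobolev_pair_weak_gradient, OF assms(1,1)]
  note v = weak_gradient_eq[OF sobolev_pairD(2) sobolev_pair_weak_gradient, OF assms(2,2)]
  note [measurable] = square_integrable_measurable[OF u(1)] square_integrable_measurable[OF v(1)]
    square_integrable_measurable[OF sobolev_pairD(2)[OF assms(1)]] square_integrable_measurable[OF sobolev_pairD(2)[OF assms(2)]]
  show "(\<lambda>x. weak_gradient \<Omega> u x \<bullet> weak_gradient \<Omega> v x) \<in> borel_measurable M" "(\<lambda>x. G x \<bullet> H x) \<in> borel_measurable M"
    by measurable
  show "AE x in M. weak_gradient \<Omega> u x \<bullet> weak_gradient \<Omega> v x = G x \<bullet> H x"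
    using u(2) v(2) by eventually_elim simp
qed

lemma sobolev_pair_dirichlet_energy:
  assumes "sobolev_pair u G"
  shows "dirichlet_energy \<Omega> u = (\<integral>x. (norm (G x))\<^sup>2 \<partial>M)"
  using sobolev_pair_dirichlet_form[OF assms assms]
  by (simp add: dirichlet_form_def dirichlet_energy_def power2_norm_eq_inner)

text \<open>\<open>H10\<close> measures distance by the gradient chosen for the difference
  \<open>u - \<phi>\<close>, which is not by definition the difference of the chosen gradients;
  uniqueness almost everywhere identifies the two.\<close>

lemma dirichlet_energy_diff_test:
  assumes G: "square_integrable M G" "has_weak_gradient \<Omega> u G" and u: "square_integrable M u" and \<phi>: "\<phi> \<in> test_functions \<Omega>"
  shows "dirichlet_energy \<Omega> (\<lambda>x. u x - \<phi> x) = (\<integral>x. (norm (G x - gradient \<phi> x))\<^sup>2 \<partial>M)"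
  unfolding dirichlet_energy_def
proof (rule integral_cong_AE)
  note t = test_function_square_integrable[OF \<phi>]
  have s: "square_integrable M (\<lambda>x. G x - gradient \<phi> x)" by (rule square_integrable_diff(1)[OF G(1) t(2)])
  have "has_weak_gradient \<Omega> (\<lambda>x. u x - \<phi> x) (\<lambda>x. G x - gradient \<phi> x)"
    unfolding has_weak_gradient_def
  proof (intro ballI allI)
    fix \<psi> i assume \<psi>: "\<psi> \<in> test_functions \<Omega>"
    note t' = test_function_square_integrable[OF \<psi>]
    have "integrable M (\<lambda>x. u x * gradient \<psi> x $ i)" "integrable M (\<lambda>x. \<phi> x * gradient \<psi> x $ i)"
      "integrable M (\<lambda>x. G x $ i * \<psi> x)" "integrable M (\<lambda>x. gradient \<phi> x $ i * \<psi> x)"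
      using square_integrable_inner[OF u square_integrable_component[OF t'(2), of i]]
        square_integrable_inner[OF t(1) square_integrable_component[OF t'(2), of i]]
        square_integrable_inner[OF square_integrable_component[OF G(1), of i] t'(1)]
        square_integrable_inner[OF square_integrable_component[OF t(2), of i] t'(1)] by simp_all
    then show "(\<integral>x. (u x - \<phi> x) * gradient \<psi> x $ i \<partial>M) = - (\<integral>x. (G x - gradient \<phi> x) $ i * \<psi> x \<partial>M)"
      using G(2) \<psi> test_function_integration_by_parts[OF \<phi> \<psi>, of i]
      by (simp add: left_diff_distrib has_weak_gradient_def)
  qed
  note w = weak_gradient_eq[OF s this]
  note [measurable] = square_integrable_measurable[OF w(1)] square_integrable_measurable[OF s]
  show "(\<lambda>x. (norm (weak_gradient \<Omega> (\<lambda>x. u x - \<phi> x) x))\<^sup>2) \<in> borel_measurable M"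
    "(\<lambda>x. (norm (G x - gradient \<phi> x))\<^sup>2) \<in> borel_measurable M" by measurable
  show "AE x in M. (norm (weak_gradient \<Omega> (\<lambda>x. u x - \<phi> x) x))\<^sup>2 = (norm (G x - gradient \<phi> x))\<^sup>2"
    using w(2) by eventually_elim simp
qed

text \<open>The squared \<open>H1_norm\<close> of the error is the sum of two nonnegative
  \<open>L\<^sup>2\<close> errors, so it tends to zero exactly when both of them do.\<close>

lemma H10_iff: "u \<in> H10 \<Omega> \<longleftrightarrow> (\<exists>G. sobolev_pair u G)"
proof
  assume "u \<in> H10 \<Omega>"
  then have "u \<in> L2 \<Omega>" "\<exists>G\<in>L2 \<Omega>. has_weak_gradient \<Omega> u G"
    "\<exists>\<phi>::nat \<Rightarrow> real^'n \<Rightarrow> real. (\<forall>n. \<phi> n \<in> test_functions \<Omega>) \<and> (\<lambda>n. H1_norm \<Omega> (\<lambda>x. u x - \<phi> n x)) \<longlonglongrightarrow> 0"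
    by (auto simp: H10_def H1_def)
  then obtain G \<phi> where "G \<in> L2 \<Omega>" and u: "square_integrable M u" and "has_weak_gradient \<Omega> u G"
    and *: "\<forall>n::nat. \<phi> n \<in> test_functions \<Omega>" "(\<lambda>n. H1_norm \<Omega> (\<lambda>x. u x - \<phi> n x)) \<longlonglongrightarrow> 0"
    by (auto simp: L2_iff)
  then have G: "square_integrable M G" "has_weak_gradient \<Omega> u G" by (auto simp: L2_iff)
  have \<phi>: "\<And>n. \<phi> n \<in> test_functions \<Omega>" "(\<lambda>n. H1_norm \<Omega> (\<lambda>x. u x - \<phi> n x)) \<longlonglongrightarrow> 0" using * by blast+
  let ?a = "\<lambda>n. \<integral>x. (norm (u x - \<phi> n x))\<^sup>2 \<partial>M" and ?b = "\<lambda>n. \<integral>x. (norm (G x - gradient (\<phi> n) x))\<^sup>2 \<partial>M"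
  have ab: "?a n \<ge> 0" "?b n \<ge> 0" for n by (rule integral_square_nonneg)+
  have "(\<lambda>n. (H1_norm \<Omega> (\<lambda>x. u x - \<phi> n x))\<^sup>2) \<longlonglongrightarrow> 0\<^sup>2"
    by (intro tendsto_intros \<phi>)
  moreover have "(H1_norm \<Omega> (\<lambda>x. u x - \<phi> n x))\<^sup>2 = ?a n + ?b n" for n
    unfolding H1_norm_def dirichlet_energy_diff_test[OF G u \<phi>(1)] using ab[of n] by simp
  ultimately have s: "(\<lambda>n. ?a n + ?b n) \<longlonglongrightarrow> 0" by simp
  have "?a \<longlonglongrightarrow> 0" "?b \<longlonglongrightarrow> 0"
    by (rule tendsto_sandwich[OF _ _ tendsto_const s]; use ab in \<open>auto intro!: always_eventually\<close>)+
  then show "\<exists>G. sobolev_pair u G"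
    unfolding sobolev_pair_def using u G(1) \<phi>(1) by blast
next
  assume "\<exists>G. sobolev_pair u G"
  then obtain G where p: "sobolev_pair u G" by blast
  obtain \<phi> where \<phi>: "\<And>n. \<phi> n \<in> test_functions \<Omega>" "(\<lambda>n::nat. \<integral>x. (norm (u x - \<phi> n x))\<^sup>2 \<partial>M) \<longlonglongrightarrow> 0"
    "(\<lambda>n. \<integral>x. (norm (G x - gradient (\<phi> n) x))\<^sup>2 \<partial>M) \<longlonglongrightarrow> 0" using sobolev_pair_approx[OF p] by blast
  note u = sobolev_pairD[OF p] sobolev_pair_weak_gradient[OF p]
  have "(\<lambda>n. H1_norm \<Omega> (\<lambda>x. u x - \<phi> n x)) \<longlonglongrightarrow> sqrt (0 + 0)"
    unfolding H1_norm_def dirichlet_energy_diff_test[OF u(2,3,1) \<phi>(1)]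
    using \<phi>(2,3) by (intro tendsto_intros) simp_all
  then have "\<exists>\<phi>. (\<forall>n. \<phi> n \<in> test_functions \<Omega>) \<and> (\<lambda>n. H1_norm \<Omega> (\<lambda>x. u x - \<phi> n x)) \<longlonglongrightarrow> 0"
    using \<phi>(1) by (intro exI[of _ \<phi>]) simp
  then show "u \<in> H10 \<Omega>"
    using u unfolding H10_def H1_def by (auto simp: L2_iff intro!: bexI[of _ G])
qed

end

subsection \<open>Compactness\<close>

context bounded_open_set
begin

lemma obtain_radius: obtains R where "R > 0" "\<Omega> \<subseteq> ball 0 R"
  using bounded_subset_ballD[OF bounded_dom, of 0] by blast

lemma test_function_diff:
  assumes "\<phi> \<in> test_functions \<Omega>" "\<psi> \<in> test_functions \<Omega>"
  shows "(\<lambda>x. \<phi> x - \<psi> x) \<in> test_functions \<Omega>" "gradient (\<lambda>x. \<phi> x - \<psi> x) = (\<lambda>x. gradient \<phi> x - gradient \<psi> x)"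
  using test_functions_lincomb[OF assms, of 1 "-1"] gradient_lincomb[OF assms, of 1 "-1"] by auto

lemma Poincare:
  assumes R: "R > 0" "\<Omega> \<subseteq> ball 0 R" and \<phi>: "\<phi> \<in> test_functions \<Omega>"
  shows "(\<integral>x. (\<phi> x)\<^sup>2 \<partial>M) \<le> 2 * R\<^sup>2 * (\<integral>x. (norm (gradient \<phi> x))\<^sup>2 \<partial>M)"
proof -
  obtain K where K: "C1_compact \<phi> (gradient \<phi>) K" "K \<subseteq> \<Omega>" using C1_compact_test_function[OF \<phi>] by blast
  show ?thesis
    unfolding test_function_square_integrable[OF \<phi>] by (rule C1_compact_Poincare[OF K(1) R(1)]) (use K(2) R(2) in auto)
qed

lemma test_function_grid:
  assumes e: "e > 0" and R: "R > 0" "\<Omega> \<subseteq> ball 0 R" and \<phi>: "\<phi> \<in> test_functions \<Omega>"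
  shows "(\<integral>x. (\<phi> x)\<^sup>2 \<partial>M) \<le>
    (\<Sum>z\<in>grid_index e R. (\<integral>x. indicator (grid_cell e z) x * \<phi> x \<partial>lborel)\<^sup>2) / e ^ CARD('n) +
    2 ^ CARD('n) * real CARD('n) * e\<^sup>2 * (\<integral>x. (norm (gradient \<phi> x))\<^sup>2 \<partial>M)"
proof -
  obtain K where K: "C1_compact \<phi> (gradient \<phi>) K" "K \<subseteq> \<Omega>" using C1_compact_test_function[OF \<phi>] by blast
  have "K \<subseteq> cball 0 R" using K(2) R(2) ball_subset_cball by blast
  from C1_compact_grid[OF K(1) e this] show ?thesis
    unfolding test_function_square_integrable[OF \<phi>] using e by (simp add: field_simps power_mult_distrib)
qed

text \<open>A diagonal argument makes the integrals over all cells of all grids converge. The grid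
  estimate for a difference of two members then shows the Cauchy property: a fine grid makes the
  gradient part small, and the cell part is a finite sum of convergent terms.\<close>

lemma Rellich:
  assumes \<phi>: "\<And>n. \<phi> n \<in> test_functions \<Omega>" and C: "\<And>n. (\<integral>x. (norm (gradient (\<phi> n) x))\<^sup>2 \<partial>M) \<le> C"
  obtains r u where "strict_mono (r :: nat \<Rightarrow> nat)" "square_integrable M u"
    "(\<lambda>n. \<integral>x. (norm (u x - \<phi> (r n) x))\<^sup>2 \<partial>M) \<longlonglongrightarrow> 0" "AE x in M. (\<lambda>n. \<phi> (r n) x) \<longlonglongrightarrow> u x"
proof -
  obtain R where R: "R > 0" "\<Omega> \<subseteq> ball 0 R" using obtain_radius by blast
  have C0: "C \<ge> 0" using C[of 0] integral_square_nonneg[of M "gradient (\<phi> 0)"] by linarith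
  let ?N = "CARD('n)"
  define e where "e j = 1 / real (Suc j)" for j
  have e: "e j > 0" "e j \<le> 1" for j by (simp_all add: e_def)
  have e0: "e \<longlonglongrightarrow> 0" unfolding e_def using LIMSEQ_inverse_real_of_nat by (simp add: inverse_eq_divide)
  \<comment> \<open>All cells at all scales: a countable set, on which the cell integrals are
    bounded by the Cauchy-Schwarz and Poincare inequalities.\<close>
  let ?I = "SIGMA j:(UNIV::nat set). (grid_index (e j) R :: (real^'n \<Rightarrow> int) set)"
  define X where "X n = (\<lambda>(j, z). \<integral>x. indicator (grid_cell (e j) z) x * \<phi> n x \<partial>lborel)" for n
  have "countable ?I" using finite_grid_index by (intro countable_SIGMA) (auto intro: countable_finite)
  moreover have "norm (X n i) \<le> sqrt (2 * R\<^sup>2 * C)" if "i \<in> ?I" for n i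
  proof -
    obtain j z where i: "i = (j, z)" by (cases i)
    obtain K where K: "C1_compact (\<phi> n) (gradient (\<phi> n)) K" using C1_compact_test_function[OF \<phi>] by blast
    have em: "emeasure lborel (grid_cell (e j) z) = ennreal (e j ^ ?N)" using emeasure_grid_cell[OF e(1), of j z] by simp
    have s1: "square_integrable lborel (indicator (grid_cell (e j) z) :: real^'n \<Rightarrow> real)"
    proof -
      have "(\<lambda>x. (norm (indicator (grid_cell (e j) z) x :: real))\<^sup>2) = (indicator (grid_cell (e j) z) :: real^'n \<Rightarrow> real)"
        by (auto simp: indicator_def fun_eq_iff)
      then show ?thesis using em by (simp add: square_integrable_def integrable_indicator_iff)
    qed
    have s2: "square_integrable lborel (\<phi> n)"
      using C1_compact_integrable(2)[OF K] C1_compact_borel[OF K] by (simp add: square_integrable_def)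
    have "(X n i)\<^sup>2 \<le> (\<integral>x. (norm (indicator (grid_cell (e j) z) x :: real))\<^sup>2 \<partial>lborel) * (\<integral>x. (norm (\<phi> n x))\<^sup>2 \<partial>lborel)"
      using integral_Cauchy_Schwarz[OF s1 s2] by (simp add: X_def i)
    also have "(\<integral>x. (norm (indicator (grid_cell (e j) z) x :: real))\<^sup>2 \<partial>lborel) = (\<integral>x. indicator (grid_cell (e j) z) x \<partial>lborel)"
      by (intro Bochner_Integration.integral_cong) (auto simp: indicator_def)
    also have "\<dots> = e j ^ ?N" using em e(1)[of j] by (simp add: measure_def)
    also have "(\<integral>x. (norm (\<phi> n x))\<^sup>2 \<partial>lborel) = (\<integral>x. (\<phi> n x)\<^sup>2 \<partial>M)"
      using test_function_square_integrable(3)[OF \<phi>] by simp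
    also have "e j ^ ?N * (\<integral>x. (\<phi> n x)\<^sup>2 \<partial>M) \<le> 1 * (2 * R\<^sup>2 * C)"
    proof (rule mult_mono)
      show "e j ^ ?N \<le> 1" using e[of j] by (intro power_le_one) auto
      have "2 * R\<^sup>2 * (\<integral>x. (norm (gradient (\<phi> n) x))\<^sup>2 \<partial>M) \<le> 2 * R\<^sup>2 * C" by (intro mult_left_mono C) simp
      then show "(\<integral>x. (\<phi> n x)\<^sup>2 \<partial>M) \<le> 2 * R\<^sup>2 * C" using Poincare[OF R \<phi>, of n] by linarith
    qed (auto intro: integral_nonneg_AE)
    finally show ?thesis by (simp add: real_le_rsqrt)
  qed
  ultimately obtain k where k: "strict_mono (k::nat\<Rightarrow>nat)" "\<And>i. i \<in> ?I \<Longrightarrow> \<exists>l. (\<lambda>n. X (k n) i) \<longlonglongrightarrow> l"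
    using function_convergent_subsequence[of ?I X "sqrt (2 * R\<^sup>2 * C)"] by blast
  define l where "l i = lim (\<lambda>n. X (k n) i)" for i
  have l: "(\<lambda>n. X (k n) i) \<longlonglongrightarrow> l i" if "i \<in> ?I" for i
    using k(2)[OF that] by (auto simp: l_def limI)
  define f where "f n = \<phi> (k n)" for n
  have ft: "f n \<in> test_functions \<Omega>" for n by (simp add: f_def \<phi>)
  have cauchy: "\<exists>N. \<forall>m\<ge>N. \<forall>n\<ge>N. (\<integral>x. (norm (f m x - f n x))\<^sup>2 \<partial>M) < eps" if eps: "eps > 0" for eps
  proof -
    \<comment> \<open>The scale \<open>j\<close> is fixed first, uniformly in \<open>m\<close> and
      \<open>n\<close>; \<open>4 * C\<close> bounds the energy of a difference of two
      members.\<close>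
    have "(\<lambda>j. 2 ^ ?N * real ?N * (e j)\<^sup>2 * (4 * C)) \<longlonglongrightarrow> 2 ^ ?N * real ?N * 0\<^sup>2 * (4 * C)"
      by (intro tendsto_intros e0)
    then have "\<forall>\<^sub>F j in sequentially. 2 ^ ?N * real ?N * (e j)\<^sup>2 * (4 * C) < eps / 2"
      using eps by (intro order_tendstoD(2)) auto
    then obtain j where j: "2 ^ ?N * real ?N * (e j)\<^sup>2 * (4 * C) < eps / 2"
      by (meson eventually_happens' sequentially_bot)
    let ?Z = "grid_index (e j) R :: (real^'n \<Rightarrow> int) set"
    define s where "s n = (\<Sum>z\<in>?Z. 2 * (X (k n) (j, z) - l (j, z))\<^sup>2) / e j ^ ?N" for n
    have "s \<longlonglongrightarrow> (\<Sum>z\<in>?Z. 2 * (l (j, z) - l (j, z))\<^sup>2) / e j ^ ?N"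
      unfolding s_def using e[of j] by (intro tendsto_intros l) auto
    then have "s \<longlonglongrightarrow> 0" by simp
    then have "\<forall>\<^sub>F n in sequentially. s n < eps / 4" using eps by (intro order_tendstoD(2)) auto
    then obtain N where N: "\<And>n. n \<ge> N \<Longrightarrow> s n < eps / 4" unfolding eventually_sequentially by blast
    have "(\<integral>x. (norm (f m x - f n x))\<^sup>2 \<partial>M) < eps" if mn: "m \<ge> N" "n \<ge> N" for m n
    proof -
      define v where "v x = f m x - f n x" for x
      have v: "v \<in> test_functions \<Omega>" "gradient v = (\<lambda>x. gradient (f m) x - gradient (f n) x)"
        unfolding v_def using test_function_diff[OF ft ft] by auto
      have gv: "(\<integral>x. (norm (gradient v x))\<^sup>2 \<partial>M) \<le> 4 * C"
      proof -
        have "(\<integral>x. (norm (gradient (f m) x + (-1) *\<^sub>R gradient (f n) x))\<^sup>2 \<partial>M) \<le>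
          2 * (\<integral>x. (norm (gradient (f m) x))\<^sup>2 \<partial>M) + 2 * (\<integral>x. (norm ((-1) *\<^sub>R gradient (f n) x))\<^sup>2 \<partial>M)"
          by (intro integral_square_add_le square_integrable_scaleR test_function_square_integrable(2) ft)
        then show ?thesis using C[of "k m"] C[of "k n"] unfolding v(2) by (simp add: f_def)
      qed
      have XX: "(\<integral>x. indicator (grid_cell (e j) z) x * v x \<partial>lborel) = X (k m) (j, z) - X (k n) (j, z)" for z
      proof -
        have "integrable lborel (\<lambda>x. indicator (grid_cell (e j) z) x *\<^sub>R f n x)" for n
        proof -
          obtain K where K: "C1_compact (f n) (gradient (f n)) K" using C1_compact_test_function[OF ft] by blast
          show ?thesis by (rule integrable_mult_indicator[OF _ C1_compact_integrable(1)[OF K]]) simp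
        qed
        then show ?thesis by (simp add: v_def X_def f_def right_diff_distrib)
      qed
      have sq: "(a - b)\<^sup>2 \<le> 2 * (a - c)\<^sup>2 + 2 * (b - c)\<^sup>2" for a b c :: real
        using zero_le_power2[of "a + b - 2 * c"] by (simp add: power2_eq_square algebra_simps)
      have "(\<integral>x. (v x)\<^sup>2 \<partial>M) \<le>
        (\<Sum>z\<in>?Z. (X (k m) (j, z) - X (k n) (j, z))\<^sup>2) / e j ^ ?N + 2 ^ ?N * real ?N * (e j)\<^sup>2 * (\<integral>x. (norm (gradient v x))\<^sup>2 \<partial>M)"
        using test_function_grid[OF e(1) R v(1), of j] unfolding XX .
      also have "\<dots> \<le> (s m + s n) + 2 ^ ?N * real ?N * (e j)\<^sup>2 * (4 * C)"
      proof (intro add_mono mult_left_mono gv)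
        have "(\<Sum>z\<in>?Z. (X (k m) (j, z) - X (k n) (j, z))\<^sup>2) \<le> (\<Sum>z\<in>?Z. 2 * (X (k m) (j, z) - l (j, z))\<^sup>2 + 2 * (X (k n) (j, z) - l (j, z))\<^sup>2)"
          by (intro sum_mono sq)
        then show "(\<Sum>z\<in>?Z. (X (k m) (j, z) - X (k n) (j, z))\<^sup>2) / e j ^ ?N \<le> s m + s n"
          unfolding s_def add_divide_distrib[symmetric] sum.distrib[symmetric]
          using e(1)[of j] by (intro divide_right_mono) auto
      qed simp
      also have "\<dots> < eps" using N[OF mn(1)] N[OF mn(2)] j by linarith
      finally show ?thesis by (simp add: v_def)
    qed
    then show ?thesis by blast
  qed
  obtain u r where u: "square_integrable M u" "(\<lambda>n. \<integral>x. (norm (u x - f n x))\<^sup>2 \<partial>M) \<longlonglongrightarrow> 0"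
    "strict_mono (r :: nat \<Rightarrow> nat)" "AE x in M. (\<lambda>n. f (r n) x) \<longlonglongrightarrow> u x"
    using L2_complete[OF test_function_square_integrable(1)[OF ft] cauchy] by blast
  show ?thesis
  proof (rule that[of "k \<circ> r" u])
    show "strict_mono (k \<circ> r)" using k(1) u(3) by (rule strict_mono_o)
    show "(\<lambda>n. \<integral>x. (norm (u x - \<phi> ((k \<circ> r) n) x))\<^sup>2 \<partial>M) \<longlonglongrightarrow> 0"
      using LIMSEQ_subseq_LIMSEQ[OF u(2,3)] by (simp add: f_def o_def)
    show "AE x in M. (\<lambda>n. \<phi> ((k \<circ> r) n) x) \<longlonglongrightarrow> u x" using u(4) by (simp add: f_def)
  qed (rule u(1))
qed

section \<open>Weak limits of sequences of bounded energy\<close>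

definition energy :: "(real^'n \<Rightarrow> real) \<Rightarrow> real" where
  "energy w = (\<integral>x. (norm (gradient w x))\<^sup>2 \<partial>M)"

text \<open>
  The weak gradient is obtained as a strong limit: test functions that almost minimise the energy in
  shrinking \<open>L2\<close>-neighbourhoods of \<open>u\<close> form a Cauchy sequence, by the parallelogram law.
\<close>
lemma sobolev_pair_of_L2_limit:
  assumes f: "\<And>n. f n \<in> test_functions \<Omega>" and C: "\<And>n. energy (f n) \<le> C"
    and u: "square_integrable M u" "(\<lambda>n. \<integral>x. (norm (u x - f n x))\<^sup>2 \<partial>M) \<longlonglongrightarrow> 0"
  obtains G where "sobolev_pair u G"
proof -
  define A where "A n = {w \<in> test_functions \<Omega>. (\<integral>x. (norm (u x - w x))\<^sup>2 \<partial>M) \<le> 1 / real (Suc n)}" for n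
  define E where "E n = (INF w\<in>A n. energy w)" for n
  have e0: "energy w \<ge> 0" for w unfolding energy_def by (rule integral_square_nonneg)
  have bdd: "bdd_below (energy ` A n)" for n using e0 by (intro bdd_belowI2[of _ 0]) auto
  have inA: "\<exists>k. f k \<in> A n" for n
  proof -
    have "\<forall>\<^sub>F k in sequentially. (\<integral>x. (norm (u x - f k x))\<^sup>2 \<partial>M) < 1 / real (Suc n)"
      by (rule order_tendstoD(2)[OF u(2)]) simp
    then obtain k where "(\<integral>x. (norm (u x - f k x))\<^sup>2 \<partial>M) < 1 / real (Suc n)"
      by (meson eventually_happens' sequentially_bot)
    then show ?thesis using f by (auto simp: A_def intro!: exI[of _ k])
  qed
  have EC: "E n \<le> C" for n
    using inA[of n] C cINF_lower[OF bdd] unfolding E_def by (meson order_trans)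
  have ne: "A n \<noteq> {}" for n using inA[of n] by blast
  have Amono: "A m \<subseteq> A n" if "n \<le> m" for m n
  proof -
    have "1 / real (Suc m) \<le> 1 / real (Suc n)" using that by (simp add: frac_le)
    then show ?thesis by (auto simp: A_def)
  qed
  \<comment> \<open>The neighbourhoods shrink, so their infima increase; each contains some
    \<open>f k\<close>, whence the bound \<open>C\<close> and a finite limit
    \<open>L\<close>.\<close>
  have Emono: "incseq E"
    unfolding incseq_def E_def using Amono ne by (intro allI impI cINF_superset_mono bdd) auto
  then obtain L where L: "E \<longlonglongrightarrow> L" "\<And>n. E n \<le> L"
    using incseq_convergent[of E C] EC by blast
  have "\<exists>w. w \<in> A n \<and> energy w < E n + 1 / real (Suc n)" for n
    using cInf_lessD[of "energy ` A n" "E n + 1 / real (Suc n)"] inA[of n] unfolding E_def by auto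
  then obtain w where w: "\<And>n. w n \<in> A n" "\<And>n. energy (w n) < E n + 1 / real (Suc n)" by metis
  have wt: "w n \<in> test_functions \<Omega>" for n using w(1) by (auto simp: A_def)
  note sw = test_function_square_integrable(1,2)[OF wt]
  have par: "(\<integral>x. (norm (gradient (w m) x - gradient (w n) x))\<^sup>2 \<partial>M) \<le> 2 * (L - E n) + 4 / real (Suc n)" if "n \<le> m" for m n
  proof -
    define v where "v x = (1/2) * w m x + (1/2) * w n x" for x
    have vt: "v \<in> test_functions \<Omega>" unfolding v_def by (rule test_functions_lincomb[OF wt wt])
    have gv: "gradient v x = (1/2) *\<^sub>R gradient (w m) x + (1/2) *\<^sub>R gradient (w n) x" for x
      unfolding v_def by (rule gradient_lincomb[OF wt wt])
    \<comment> \<open>The midpoint of two members of \<open>A n\<close> stays in \<open>A n\<close>,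
      so its energy is at least \<open>E n\<close>; the parallelogram law then leaves little room
      for the difference of the gradients.\<close>
    have "v \<in> A n"
    proof -
      have eq: "u x - v x = (1/2) *\<^sub>R (u x - w m x) + (1/2) *\<^sub>R (u x - w n x)" for x
        by (simp add: v_def field_simps)
      have "(\<integral>x. (norm (u x - v x))\<^sup>2 \<partial>M) \<le>
        2 * (\<integral>x. (norm ((1/2) *\<^sub>R (u x - w m x)))\<^sup>2 \<partial>M) + 2 * (\<integral>x. (norm ((1/2) *\<^sub>R (u x - w n x)))\<^sup>2 \<partial>M)"
        unfolding eq by (intro integral_square_add_le square_integrable_scaleR square_integrable_diff u sw)
      also have "\<dots> = (\<integral>x. (norm (u x - w m x))\<^sup>2 \<partial>M) / 2 + (\<integral>x. (norm (u x - w n x))\<^sup>2 \<partial>M) / 2"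
        by (simp add: power_divide)
      also have "\<dots> \<le> 1 / real (Suc n)"
        using Amono[OF that] w(1)[of m] w(1)[of n] by (auto simp: A_def)
      finally show ?thesis using vt by (simp add: A_def)
    qed
    then have "E n \<le> energy v" unfolding E_def by (intro cINF_lower bdd)
    moreover have "(\<integral>x. (norm (gradient (w m) x - gradient (w n) x))\<^sup>2 \<partial>M) = 2 * energy (w m) + 2 * energy (w n) - 4 * energy v"
      unfolding energy_def gv square_integrable_lincomb(2)[OF sw(2) sw(2)] square_integrable_diff(2)[OF sw(2) sw(2)]
      by (simp add: power2_eq_square)
    moreover have "1 / real (Suc m) \<le> 1 / real (Suc n)" using that by (simp add: frac_le)
    ultimately show ?thesis using w(2)[of m] w(2)[of n] L(2)[of m] by (simp add: add_divide_distrib)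
  qed
  have "\<exists>N. \<forall>m\<ge>N. \<forall>n\<ge>N. (\<integral>x. (norm (gradient (w m) x - gradient (w n) x))\<^sup>2 \<partial>M) < eps" if "eps > 0" for eps
  proof -
    have "(\<lambda>n. 2 * (L - E n) + 4 * (1 / real (Suc n))) \<longlonglongrightarrow> 2 * (L - L) + 4 * 0"
      using LIMSEQ_inverse_real_of_nat L(1) by (intro tendsto_intros) (auto simp: inverse_eq_divide)
    then have "\<forall>\<^sub>F n in sequentially. 2 * (L - E n) + 4 * (1 / real (Suc n)) < eps"
      using that by (intro order_tendstoD(2)) auto
    then obtain N where N: "\<And>n. n \<ge> N \<Longrightarrow> 2 * (L - E n) + 4 / real (Suc n) < eps"
      unfolding eventually_sequentially by auto
    have "(\<integral>x. (norm (gradient (w m) x - gradient (w n) x))\<^sup>2 \<partial>M) < eps" if "m \<ge> N" "n \<ge> N" for m n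
    proof (cases "n \<le> m")
      case True then show ?thesis using par[OF True] N[OF that(2)] by linarith
    next
      case False
      then show ?thesis using par[of m n] N[OF that(1)] by (simp add: norm_minus_commute)
    qed
    then show ?thesis by blast
  qed
  from L2_complete[OF sw(2) this]
  obtain G and r :: "nat \<Rightarrow> nat" where G: "square_integrable M G" "(\<lambda>n. \<integral>x. (norm (G x - gradient (w n) x))\<^sup>2 \<partial>M) \<longlonglongrightarrow> 0"
    "strict_mono r" "AE x in M. (\<lambda>n. gradient (w (r n)) x) \<longlonglongrightarrow> G x" .
  have "(\<lambda>n. \<integral>x. (norm (u x - w n x))\<^sup>2 \<partial>M) \<longlonglongrightarrow> 0"
  proof (rule Lim_null_comparison[OF always_eventually, rule_format])
    show "(\<lambda>n. 1 / real (Suc n)) \<longlonglongrightarrow> 0" using LIMSEQ_inverse_real_of_nat by (simp add: inverse_eq_divide)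
    show "norm (\<integral>x. (norm (u x - w n x))\<^sup>2 \<partial>M) \<le> 1 / real (Suc n)" for n
      using w(1)[of n] integral_square_nonneg[of M "\<lambda>x. u x - w n x"] by (simp add: A_def)
  qed
  then have "sobolev_pair u G" unfolding sobolev_pair_def using u(1) G(1,2) wt by blast
  then show ?thesis using that by blast
qed

text \<open>The components of the gradient of \<psi> are test functions again, so a further
  derivative can be moved onto them. On the right only \<open>u\<close> is left, and
  \<open>L\<^sup>2\<close> convergence of functions controls it.\<close>

lemma sobolev_pair_inner_test:
  assumes "sobolev_pair u G" and \<psi>: "\<psi> \<in> test_functions \<Omega>"
  shows "(\<integral>x. G x \<bullet> gradient \<psi> x \<partial>M) = - (\<Sum>i\<in>UNIV. \<integral>x. u x * gradient (\<lambda>x. gradient \<psi> x $ i) x $ i \<partial>M)"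
proof -
  have "(\<integral>x. G x \<bullet> gradient \<psi> x \<partial>M) = (\<Sum>i\<in>UNIV. \<integral>x. G x $ i * gradient \<psi> x $ i \<partial>M)"
    unfolding inner_vec_def inner_real_def
    using square_integrable_inner[OF square_integrable_component[OF sobolev_pairD(2)[OF assms(1)]]
        square_integrable_component[OF test_function_square_integrable(2)[OF \<psi>]]]
    by (intro Bochner_Integration.integral_sum) simp
  also have "\<dots> = (\<Sum>i\<in>UNIV. - (\<integral>x. u x * gradient (\<lambda>x. gradient \<psi> x $ i) x $ i \<partial>M))"
    using sobolev_pair_weak_gradient[OF assms(1)] test_functions_gradient[OF \<psi>]
    unfolding has_weak_gradient_def by (intro sum.cong) auto
  finally show ?thesis by (simp add: sum_negf)
qed

text \<open>For gradients of test functions this is \<open>sobolev_pair_inner_test\<close>. A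
  general \<open>H\<close> is a limit of such gradients, and the uniform energy bound makes the
  error of the approximation uniform in \<open>n\<close>.\<close>

lemma gradient_weak_convergence:
  assumes f: "\<And>n. f n \<in> test_functions \<Omega>" and C: "\<And>n. energy (f n) \<le> C"
    and u: "sobolev_pair u G" "(\<lambda>n. \<integral>x. (norm (u x - f n x))\<^sup>2 \<partial>M) \<longlonglongrightarrow> 0"
    and v: "sobolev_pair v H"
  shows "(\<lambda>n. \<integral>x. gradient (f n) x \<bullet> H x \<partial>M) \<longlonglongrightarrow> (\<integral>x. G x \<bullet> H x \<partial>M)"
proof -
  note sf = test_function_square_integrable(1,2)[OF f] and su = sobolev_pairD[OF u(1)] and sv = sobolev_pairD[OF v]
  have test: "(\<lambda>n. \<integral>x. gradient (f n) x \<bullet> gradient \<psi> x \<partial>M) \<longlonglongrightarrow> (\<integral>x. G x \<bullet> gradient \<psi> x \<partial>M)"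
    if \<psi>: "\<psi> \<in> test_functions \<Omega>" for \<psi>
    unfolding sobolev_pair_inner_test[OF u(1) \<psi>] sobolev_pair_inner_test[OF sobolev_pair_test[OF f] \<psi>]
    by (intro tendsto_minus tendsto_sum L2_tendsto_inner_const[OF sf(1) su(1) u(2), unfolded inner_real_def]
        square_integrable_component test_function_square_integrable(2) test_functions_gradient \<psi>)
  obtain \<psi> where \<psi>: "\<And>n. \<psi> n \<in> test_functions \<Omega>"
    "(\<lambda>n. \<integral>x. (norm (H x - gradient (\<psi> n) x))\<^sup>2 \<partial>M) \<longlonglongrightarrow> 0" using sobolev_pair_approx[OF v] by blast
  note s\<psi> = test_function_square_integrable(2)[OF \<psi>(1)]
  define B where "B = 2 * C + 2 * (\<integral>x. (norm (G x))\<^sup>2 \<partial>M)"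
  have B: "(\<integral>x. (norm (gradient (f n) x - G x))\<^sup>2 \<partial>M) \<le> B" for n
  proof -
    have "(\<integral>x. (norm (gradient (f n) x + (-1) *\<^sub>R G x))\<^sup>2 \<partial>M) \<le>
      2 * (\<integral>x. (norm (gradient (f n) x))\<^sup>2 \<partial>M) + 2 * (\<integral>x. (norm ((-1) *\<^sub>R G x))\<^sup>2 \<partial>M)"
      by (intro integral_square_add_le square_integrable_scaleR sf su)
    then show ?thesis using C[of n] by (simp add: B_def energy_def)
  qed
  have sD: "square_integrable M (\<lambda>x. gradient (f n) x - G x)" for n by (rule square_integrable_diff(1)[OF sf(2) su(2)])
  have split: "(\<integral>x. gradient (f n) x \<bullet> F x \<partial>M) - (\<integral>x. G x \<bullet> F x \<partial>M) = (\<integral>x. (gradient (f n) x - G x) \<bullet> F x \<partial>M)"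
    if "square_integrable M F" for F n
    using square_integrable_inner[OF sf(2) that, of n] square_integrable_inner[OF su(2) that] by (simp add: inner_diff_left)
  have "(\<lambda>n. \<integral>x. (gradient (f n) x - G x) \<bullet> H x \<partial>M) \<longlonglongrightarrow> 0"
  proof (rule LIMSEQ_I)
    fix eps :: real assume eps: "eps > 0"
    have "(\<lambda>k. sqrt (B * (\<integral>x. (norm (H x - gradient (\<psi> k) x))\<^sup>2 \<partial>M))) \<longlonglongrightarrow> sqrt (B * 0)"
      by (intro tendsto_intros \<psi>)
    then have "\<forall>\<^sub>F k in sequentially. sqrt (B * (\<integral>x. (norm (H x - gradient (\<psi> k) x))\<^sup>2 \<partial>M)) < eps / 2"
      using eps by (intro order_tendstoD(2)) auto
    then obtain k where k: "sqrt (B * (\<integral>x. (norm (H x - gradient (\<psi> k) x))\<^sup>2 \<partial>M)) < eps / 2"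
      by (meson eventually_happens' sequentially_bot)
    have "(\<lambda>n. \<integral>x. (gradient (f n) x - G x) \<bullet> gradient (\<psi> k) x \<partial>M) \<longlonglongrightarrow> 0"
      using tendsto_diff[OF test[OF \<psi>(1)[of k]] tendsto_const, of "\<integral>x. G x \<bullet> gradient (\<psi> k) x \<partial>M"]
      unfolding split[OF s\<psi>] by simp
    then obtain N where N: "\<And>n. n \<ge> N \<Longrightarrow> \<bar>\<integral>x. (gradient (f n) x - G x) \<bullet> gradient (\<psi> k) x \<partial>M\<bar> < eps / 2"
      using LIMSEQ_D[of "\<lambda>n. \<integral>x. (gradient (f n) x - G x) \<bullet> gradient (\<psi> k) x \<partial>M" 0 "eps / 2"] eps by auto
    have "\<bar>\<integral>x. (gradient (f n) x - G x) \<bullet> H x \<partial>M\<bar> < eps" if "n \<ge> N" for n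
    proof -
      have sH: "square_integrable M (\<lambda>x. H x - gradient (\<psi> k) x)" by (rule square_integrable_diff(1)[OF sv(2) s\<psi>])
      have "(\<integral>x. (gradient (f n) x - G x) \<bullet> (H x - gradient (\<psi> k) x) \<partial>M)\<^sup>2 \<le> B * (\<integral>x. (norm (H x - gradient (\<psi> k) x))\<^sup>2 \<partial>M)"
        by (rule order_trans[OF integral_Cauchy_Schwarz[OF sD sH]]) (intro mult_right_mono B integral_square_nonneg)
      then have "\<bar>\<integral>x. (gradient (f n) x - G x) \<bullet> (H x - gradient (\<psi> k) x) \<partial>M\<bar> < eps / 2"
        using k real_sqrt_le_mono[of "(\<integral>x. (gradient (f n) x - G x) \<bullet> (H x - gradient (\<psi> k) x) \<partial>M)\<^sup>2"]
        unfolding real_sqrt_abs by (meson le_less_trans)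
      moreover have "(\<integral>x. (gradient (f n) x - G x) \<bullet> (H x - gradient (\<psi> k) x) \<partial>M) =
        (\<integral>x. (gradient (f n) x - G x) \<bullet> H x \<partial>M) - (\<integral>x. (gradient (f n) x - G x) \<bullet> gradient (\<psi> k) x \<partial>M)"
        using square_integrable_inner[OF sD[of n] sv(2)] square_integrable_inner[OF sD[of n] s\<psi>[of k]]
        by (simp add: inner_diff_right)
      ultimately show ?thesis using N[OF that] by linarith
    qed
    then show "\<exists>no. \<forall>n\<ge>no. norm ((\<integral>x. (gradient (f n) x - G x) \<bullet> H x \<partial>M) - 0) < eps" by auto
  qed
  from tendsto_add[OF this tendsto_const, of "\<integral>x. G x \<bullet> H x \<partial>M"]
  show ?thesis unfolding split[OF sv(2), symmetric] by simp
qed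

text \<open>The last clause is the Hilbert space splitting of the energy: the difference of the two
  terms is 2 < \<nabla>\<phi>, G > - norm(G)^2, and weak convergence is applied with
  \<open>G\<close> itself as the test field.\<close>

theorem weak_compactness:
  assumes \<phi>: "\<And>n. \<phi> n \<in> test_functions \<Omega>" and C: "\<And>n. energy (\<phi> n) \<le> C"
  obtains r u G where "strict_mono (r :: nat \<Rightarrow> nat)" "sobolev_pair u G"
    "(\<lambda>n. \<integral>x. (norm (u x - \<phi> (r n) x))\<^sup>2 \<partial>M) \<longlonglongrightarrow> 0" "AE x in M. (\<lambda>n. \<phi> (r n) x) \<longlonglongrightarrow> u x"
    "(\<lambda>n. energy (\<phi> (r n)) - (\<integral>x. (norm (gradient (\<phi> (r n)) x - G x))\<^sup>2 \<partial>M)) \<longlonglongrightarrow> (\<integral>x. (norm (G x))\<^sup>2 \<partial>M)"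
proof -
  obtain r u where r: "strict_mono (r :: nat \<Rightarrow> nat)" "square_integrable M u"
    "(\<lambda>n. \<integral>x. (norm (u x - \<phi> (r n) x))\<^sup>2 \<partial>M) \<longlonglongrightarrow> 0" "AE x in M. (\<lambda>n. \<phi> (r n) x) \<longlonglongrightarrow> u x"
    by (rule Rellich[OF \<phi> C[unfolded energy_def]])
  obtain G where G: "sobolev_pair u G"
    by (rule sobolev_pair_of_L2_limit[of "\<lambda>n. \<phi> (r n)" C u]) (use \<phi> C r in auto)
  have w: "(\<lambda>n. \<integral>x. gradient (\<phi> (r n)) x \<bullet> G x \<partial>M) \<longlonglongrightarrow> (\<integral>x. (norm (G x))\<^sup>2 \<partial>M)"
    unfolding power2_norm_eq_inner by (rule gradient_weak_convergence[of "\<lambda>n. \<phi> (r n)" C u G u G]) (use \<phi> C r G in auto)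
  have "(\<lambda>n. 2 * (\<integral>x. gradient (\<phi> (r n)) x \<bullet> G x \<partial>M) - (\<integral>x. (norm (G x))\<^sup>2 \<partial>M)) \<longlonglongrightarrow>
    2 * (\<integral>x. (norm (G x))\<^sup>2 \<partial>M) - (\<integral>x. (norm (G x))\<^sup>2 \<partial>M)"
    by (intro tendsto_intros w)
  then have "(\<lambda>n. energy (\<phi> (r n)) - (\<integral>x. (norm (gradient (\<phi> (r n)) x - G x))\<^sup>2 \<partial>M)) \<longlonglongrightarrow> (\<integral>x. (norm (G x))\<^sup>2 \<partial>M)"
    unfolding square_integrable_diff(2)[OF test_function_square_integrable(2)[OF \<phi>] sobolev_pairD(2)[OF G]] energy_def
    by (simp add: algebra_simps)
  then show ?thesis using that r G by blast
qed

end

subsection \<open>The Brezis-Lieb lemma\<close>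

text \<open>By homogeneity, \<open>b\<close> small against \<open>a\<close> is a matter of
  continuity of the power at 1. Otherwise \<open>\<bar>a\<bar>\<close> is at most
  \<open>\<bar>b\<bar> / d\<close>, and both powers are at most a constant times
  \<open>\<bar>b\<bar> powr p\<close>.\<close>

lemma powr_abs_add_bound:
  fixes p :: real
  assumes "p > 0" "eps > 0"
  shows "\<exists>K\<ge>0. \<forall>a b. \<bar>\<bar>a + b\<bar> powr p - \<bar>a\<bar> powr p\<bar> \<le> eps * \<bar>a\<bar> powr p + K * \<bar>b::real\<bar> powr p"
proof -
  have "isCont (\<lambda>x::real. x powr p) 1" by (intro continuous_intros) auto
  then obtain d0 where d0: "d0 > 0" "\<And>x::real. \<bar>x - 1\<bar> < d0 \<Longrightarrow> \<bar>x powr p - 1\<bar> < eps"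
    using assms(2) unfolding continuous_at_eps_delta dist_real_def by fastforce
  define d where "d = d0 / 2"
  have d: "d > 0" "\<And>x::real. \<bar>x - 1\<bar> \<le> d \<Longrightarrow> \<bar>x powr p - 1\<bar> \<le> eps"
    using d0(1) by (auto simp: d_def intro!: less_imp_le[OF d0(2)])
  define K where "K = (1 / d + 1) powr p"
  have "\<bar>\<bar>a + b\<bar> powr p - \<bar>a\<bar> powr p\<bar> \<le> eps * \<bar>a\<bar> powr p + K * \<bar>b\<bar> powr p" for a b :: real
  proof (cases "\<bar>b\<bar> \<le> d * \<bar>a\<bar> \<and> a \<noteq> 0")
    case True
    define x where "x = \<bar>a + b\<bar> / \<bar>a\<bar>"
    have "\<bar>x - 1\<bar> = \<bar>\<bar>a + b\<bar> - \<bar>a\<bar>\<bar> / \<bar>a\<bar>" using True by (simp add: x_def diff_divide_distrib[symmetric] divide_simps abs_if)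
    also have "\<dots> \<le> d" using True by (simp add: divide_le_eq) linarith
    finally have "\<bar>x powr p - 1\<bar> \<le> eps" by (rule d(2))
    moreover have "\<bar>a + b\<bar> powr p = (\<bar>a\<bar> * x) powr p" using True by (simp add: x_def)
    then have "\<bar>a + b\<bar> powr p = \<bar>a\<bar> powr p * x powr p"
      using powr_mult[of "\<bar>a\<bar>" x p] by (simp add: x_def)
    then have "\<bar>a + b\<bar> powr p - \<bar>a\<bar> powr p = \<bar>a\<bar> powr p * (x powr p - 1)"
      by (simp add: algebra_simps)
    ultimately have "\<bar>\<bar>a + b\<bar> powr p - \<bar>a\<bar> powr p\<bar> \<le> \<bar>a\<bar> powr p * eps"
      by (simp add: abs_mult mult_left_mono)
    then show ?thesis by (simp add: K_def mult.commute add_increasing2)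
  next
    case False
    then have "\<bar>a\<bar> \<le> \<bar>b\<bar> / d" using d(1) by (auto simp: field_simps)
    then have le: "\<bar>a\<bar> \<le> (1 / d + 1) * \<bar>b\<bar>" "\<bar>a + b\<bar> \<le> (1 / d + 1) * \<bar>b\<bar>"
      using abs_triangle_ineq[of a b] by (simp_all add: algebra_simps)
    have "\<bar>a\<bar> powr p \<le> ((1 / d + 1) * \<bar>b\<bar>) powr p" "\<bar>a + b\<bar> powr p \<le> ((1 / d + 1) * \<bar>b\<bar>) powr p"
      using le assms(1) by (auto intro!: powr_mono2)
    moreover have "((1 / d + 1) * \<bar>b\<bar>) powr p = K * \<bar>b\<bar> powr p"
      using d(1) by (simp add: K_def powr_mult)
    moreover have "0 \<le> eps * \<bar>a\<bar> powr p" using assms(2) by simp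
    moreover have "0 \<le> \<bar>a\<bar> powr p" "0 \<le> \<bar>a + b\<bar> powr p" by simp_all
    ultimately show ?thesis by linarith
  qed
  then show ?thesis by (intro exI[of _ K]) (simp add: K_def)
qed

text \<open>The defect \<open>h n\<close> has no fixed integrable majorant, but its excess
  \<open>W n\<close> over a small multiple of \<open>\<bar>f n x - F x\<bar> powr p\<close> is
  dominated by a multiple of \<open>\<bar>F x\<bar> powr p\<close>. Dominated convergence removes
  the excess, and the bound \<open>C\<close> makes the rest small.\<close>

theorem Brezis_Lieb:
  fixes f :: "nat \<Rightarrow> 'a \<Rightarrow> real"
  assumes p: "p > 0"
    and [measurable]: "\<And>n. f n \<in> borel_measurable M" "F \<in> borel_measurable M"
    and lim: "AE x in M. (\<lambda>n. f n x) \<longlonglongrightarrow> F x"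
    and F: "integrable M (\<lambda>x. \<bar>F x\<bar> powr p)"
    and d: "\<And>n. integrable M (\<lambda>x. \<bar>f n x - F x\<bar> powr p)" "\<And>n. (\<integral>x. \<bar>f n x - F x\<bar> powr p \<partial>M) \<le> C"
    and fi: "\<And>n. integrable M (\<lambda>x. \<bar>f n x\<bar> powr p)"
  shows "(\<lambda>n. (\<integral>x. \<bar>f n x\<bar> powr p \<partial>M) - (\<integral>x. \<bar>f n x - F x\<bar> powr p \<partial>M)) \<longlonglongrightarrow> (\<integral>x. \<bar>F x\<bar> powr p \<partial>M)"
proof -
  define h where "h n x = \<bar>f n x\<bar> powr p - \<bar>f n x - F x\<bar> powr p - \<bar>F x\<bar> powr p" for n x
  have [measurable]: "h n \<in> borel_measurable M" for n unfolding h_def by measurable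
  have hi: "integrable M (h n)" for n unfolding h_def using fi d(1) F by auto
  have "0 \<le> (\<integral>x. \<bar>f 0 x - F x\<bar> powr p \<partial>M)" by (intro integral_nonneg_AE) auto
  then have C0: "C \<ge> 0" using d(2)[of 0] by linarith
  have hlim: "AE x in M. (\<lambda>n. h n x) \<longlonglongrightarrow> 0"
    using lim
  proof eventually_elim
    case (elim x)
    have "(\<lambda>n. \<bar>f n x\<bar> powr p) \<longlonglongrightarrow> \<bar>F x\<bar> powr p"
      using p elim by (intro tendsto_powr' tendsto_intros) auto
    moreover have "(\<lambda>n. \<bar>f n x - F x\<bar> powr p) \<longlonglongrightarrow> \<bar>F x - F x\<bar> powr p"
      using p elim by (intro tendsto_powr' tendsto_intros) auto
    ultimately have "(\<lambda>n. h n x) \<longlonglongrightarrow> \<bar>F x\<bar> powr p - \<bar>F x - F x\<bar> powr p - \<bar>F x\<bar> powr p"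
      unfolding h_def by (rule tendsto_diff[OF tendsto_diff tendsto_const])
    then show ?case using p by simp
  qed
  have "(\<lambda>n. \<integral>x. h n x \<partial>M) \<longlonglongrightarrow> 0"
  proof (rule LIMSEQ_I)
    fix e :: real assume e: "e > 0"
    \<comment> \<open>Makes \<open>eps * C \<le> e / 2\<close>; the summand 1 covers
      \<open>C = 0\<close>.\<close>
    define eps where "eps = e / (2 * (C + 1))"
    have eps: "eps > 0" using e C0 by (simp add: eps_def)
    obtain K where "K \<ge> 0" and "\<forall>a b. \<bar>\<bar>a + b\<bar> powr p - \<bar>a\<bar> powr p\<bar> \<le> eps * \<bar>a\<bar> powr p + K * \<bar>b::real\<bar> powr p"
      using powr_abs_add_bound[OF p eps] by auto
    then have K: "K \<ge> 0" "\<And>a b. \<bar>\<bar>a + b\<bar> powr p - \<bar>a\<bar> powr p\<bar> \<le> eps * \<bar>a\<bar> powr p + K * \<bar>b::real\<bar> powr p"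
      by simp_all
    define W where "W n x = max 0 (\<bar>h n x\<bar> - eps * \<bar>f n x - F x\<bar> powr p)" for n x
    have [measurable]: "W n \<in> borel_measurable M" for n unfolding W_def by measurable
    have Wb: "W n x \<le> (K + 1) * \<bar>F x\<bar> powr p" for n x
    proof -
      have "\<bar>\<bar>f n x\<bar> powr p - \<bar>f n x - F x\<bar> powr p\<bar> \<le> eps * \<bar>f n x - F x\<bar> powr p + K * \<bar>F x\<bar> powr p"
        using K(2)[of "f n x - F x" "F x"] by simp
      moreover have "\<bar>A - B - D\<bar> - E \<le> J + D" if "\<bar>A - B\<bar> \<le> E + J" "0 \<le> D" for A B D E J :: real
        using that by linarith
      ultimately have "\<bar>h n x\<bar> - eps * \<bar>f n x - F x\<bar> powr p \<le> K * \<bar>F x\<bar> powr p + \<bar>F x\<bar> powr p"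
        unfolding h_def by simp
      then show ?thesis using K(1) by (simp add: W_def distrib_right)
    qed
    have W0: "(\<lambda>n. \<integral>x. W n x \<partial>M) \<longlonglongrightarrow> (\<integral>x. 0 \<partial>M)"
    proof (rule integral_dominated_convergence[where w="\<lambda>x. (K + 1) * \<bar>F x\<bar> powr p"])
      show "integrable M (\<lambda>x. (K + 1) * \<bar>F x\<bar> powr p)" using F by simp
      show "AE x in M. norm (W n x) \<le> (K + 1) * \<bar>F x\<bar> powr p" for n
        using Wb by (auto simp: W_def)
      show "AE x in M. (\<lambda>n. W n x) \<longlonglongrightarrow> 0"
        using hlim
      proof eventually_elim
        case (elim x)
        show ?case
        proof (rule Lim_null_comparison[OF always_eventually, rule_format])
          show "(\<lambda>n. \<bar>h n x\<bar>) \<longlonglongrightarrow> 0" using elim by (rule tendsto_rabs_zero)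
          show "norm (W n x) \<le> \<bar>h n x\<bar>" for n using eps by (simp add: W_def)
        qed
      qed
    qed measurable
    then have "\<forall>\<^sub>F n in sequentially. (\<integral>x. W n x \<partial>M) < e / 2" using e by (intro order_tendstoD(2)) auto
    then obtain N where N: "\<And>n. n \<ge> N \<Longrightarrow> (\<integral>x. W n x \<partial>M) < e / 2" unfolding eventually_sequentially by blast
    have "norm ((\<integral>x. h n x \<partial>M) - 0) < e" if "n \<ge> N" for n
    proof -
      have Wi: "integrable M (W n)"
      proof (rule Bochner_Integration.integrable_bound[of M "\<lambda>x. (K + 1) * \<bar>F x\<bar> powr p"])
        show "integrable M (\<lambda>x. (K + 1) * \<bar>F x\<bar> powr p)" using F by simp
        show "AE x in M. norm (W n x) \<le> norm ((K + 1) * \<bar>F x\<bar> powr p)"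
        proof (rule AE_I2)
          fix x
          have "0 \<le> W n x" by (simp add: W_def)
          then show "norm (W n x) \<le> norm ((K + 1) * \<bar>F x\<bar> powr p)"
            using Wb[where n=n and x=x] by (metis abs_of_nonneg order_trans real_norm_def)
        qed
      qed measurable
      have "\<bar>\<integral>x. h n x \<partial>M\<bar> \<le> (\<integral>x. \<bar>h n x\<bar> \<partial>M)" by (rule integral_abs_bound)
      also have "\<dots> \<le> (\<integral>x. W n x + eps * \<bar>f n x - F x\<bar> powr p \<partial>M)"
        using hi Wi d(1) by (intro integral_mono) (auto simp: W_def)
      also have "\<dots> = (\<integral>x. W n x \<partial>M) + eps * (\<integral>x. \<bar>f n x - F x\<bar> powr p \<partial>M)"
        using Wi d(1) by simp
      also have "\<dots> \<le> (\<integral>x. W n x \<partial>M) + eps * C" using d(2) eps by (simp add: mult_left_mono)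
      also have "eps * C \<le> e / 2" using e C0 by (simp add: eps_def field_simps)
      finally show ?thesis using N[OF that] by simp
    qed
    then show "\<exists>no. \<forall>n\<ge>no. norm ((\<integral>x. h n x \<partial>M) - 0) < e" by blast
  qed
  moreover have "(\<integral>x. h n x \<partial>M) = (\<integral>x. \<bar>f n x\<bar> powr p \<partial>M) - (\<integral>x. \<bar>f n x - F x\<bar> powr p \<partial>M) - (\<integral>x. \<bar>F x\<bar> powr p \<partial>M)" for n
    unfolding h_def using fi d(1) F by simp
  ultimately show ?thesis
    using tendsto_add[OF _ tendsto_const, of "\<lambda>n. \<integral>x. h n x \<partial>M" 0 sequentially "\<integral>x. \<bar>F x\<bar> powr p \<partial>M"] by simp
qed

lemma L2_tendsto_AE_subseq:
  fixes f :: "nat \<Rightarrow> 'a \<Rightarrow> real"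
  assumes f: "\<And>n. square_integrable M (f n)" "square_integrable M F" "(\<lambda>n. \<integral>x. (norm (F x - f n x))\<^sup>2 \<partial>M) \<longlonglongrightarrow> 0"
  obtains r where "strict_mono (r :: nat \<Rightarrow> nat)" "AE x in M. (\<lambda>n. f (r n) x) \<longlonglongrightarrow> F x"
proof -
  have "\<exists>r::nat\<Rightarrow>nat. strict_mono r \<and> (AE x in M. (\<lambda>n. (norm (F x - f (r n) x))\<^sup>2) \<longlonglongrightarrow> 0)"
    by (rule tendsto_L1_AE_subseq[where u="\<lambda>n x. (norm (F x - f n x))\<^sup>2"])
       (use f(3) square_integrableD[OF square_integrable_diff(1)[OF f(2,1)]] in simp_all)
  then obtain r :: "nat \<Rightarrow> nat" where r: "strict_mono r" "AE x in M. (\<lambda>n. (norm (F x - f (r n) x))\<^sup>2) \<longlonglongrightarrow> 0" by blast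
  from r(2) have "AE x in M. (\<lambda>n. f (r n) x) \<longlonglongrightarrow> F x"
  proof eventually_elim
    case (elim x)
    then have "(\<lambda>n. sqrt ((norm (F x - f (r n) x))\<^sup>2)) \<longlonglongrightarrow> sqrt 0" by (rule tendsto_real_sqrt)
    then have "(\<lambda>n. F x - f (r n) x) \<longlonglongrightarrow> 0" by (simp add: tendsto_rabs_zero_iff)
    from tendsto_diff[OF tendsto_const this, of "F x"] show ?case by simp
  qed
  then show ?thesis using that r(1) by blast
qed

subsection \<open>The Sobolev constant\<close>

locale sobolev_domain = bounded_open_set \<Omega> for \<Omega> :: "(real^'n) set" +
  fixes p :: real
  assumes dim: "CARD('n) \<ge> 3" and p_eq: "p = critical_exponent CARD('n)" and nonempty: "\<Omega> \<noteq> {}"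
begin

lemma p_gt_2: "p > 2"
  using dim by (simp add: p_eq critical_exponent_def field_simps)

lemma test_function_integrable_powr:
  assumes "\<phi> \<in> test_functions \<Omega>"
  shows "integrable M (\<lambda>x. \<bar>\<phi> x\<bar> powr p)" "(\<integral>x. \<bar>\<phi> x\<bar> powr p \<partial>M) = (\<integral>x. \<bar>\<phi> x\<bar> powr p \<partial>lborel)"
proof -
  obtain K where K: "C1_compact \<phi> (gradient \<phi>) K" "K \<subseteq> \<Omega>" using C1_compact_test_function[OF assms] by blast
  have cp: "continuous_on UNIV (\<lambda>x. \<bar>\<phi> x\<bar> powr p)"
    using C1_compact_continuous[OF K(1)] p_gt_2 by (intro continuous_on_powr' continuous_intros) auto
  have ip: "integrable lborel (\<lambda>x. \<bar>\<phi> x\<bar> powr p)"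
    using C1_compactD(4)[OF K(1)] by (intro integrable_compact_support[OF cp C1_compactD(3)[OF K(1)]]) auto
  have z: "\<bar>\<phi> x\<bar> powr p = 0" if "x \<notin> \<Omega>" for x using that K(2) C1_compactD(4)[OF K(1), of x] by auto
  show "integrable M (\<lambda>x. \<bar>\<phi> x\<bar> powr p)" "(\<integral>x. \<bar>\<phi> x\<bar> powr p \<partial>M) = (\<integral>x. \<bar>\<phi> x\<bar> powr p \<partial>lborel)"
    by (rule integral_M_supported[OF ip z]; assumption)+
qed

text \<open>Fatou's lemma along an almost everywhere convergent subsequence of the approximating
  test functions, whose energies converge.\<close>

lemma sobolev_pair_Sobolev:
  "\<exists>C>0. \<forall>u G. sobolev_pair u G \<longrightarrow> integrable M (\<lambda>x. \<bar>u x\<bar> powr p) \<and>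
     (\<integral>x. \<bar>u x\<bar> powr p \<partial>M) \<le> C * (\<integral>x. (norm (G x))\<^sup>2 \<partial>M) powr (p / 2)"
proof -
  obtain C where C: "C > 0" "\<And>f g K. C1_compact (f :: real^'n \<Rightarrow> real) g K \<Longrightarrow>
      (\<integral>x. \<bar>f x\<bar> powr p \<partial>lborel) \<le> C * (\<integral>x. (norm (g x))\<^sup>2 \<partial>lborel) powr (p / 2)"
    using C1_compact_Sobolev[where 'a="real^'n", of p] dim by (auto simp: p_eq critical_exponent_def)
  have test: "(\<integral>x. \<bar>\<phi> x\<bar> powr p \<partial>M) \<le> C * energy \<phi> powr (p / 2)" if \<phi>: "\<phi> \<in> test_functions \<Omega>" for \<phi>
  proof -
    obtain K where K: "C1_compact \<phi> (gradient \<phi>) K" using C1_compact_test_function[OF \<phi>] by blast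
    show ?thesis
      using C(2)[OF K] test_function_integrable_powr[OF \<phi>] test_function_square_integrable(4)[OF \<phi>] by (simp add: energy_def)
  qed
  show ?thesis
  proof (intro exI[of _ C] conjI allI impI C(1))
    fix u G assume p: "sobolev_pair u G"
    obtain \<psi> where \<psi>: "\<And>n. \<psi> n \<in> test_functions \<Omega>" "(\<lambda>n::nat. \<integral>x. (norm (u x - \<psi> n x))\<^sup>2 \<partial>M) \<longlonglongrightarrow> 0"
      "(\<lambda>n. \<integral>x. (norm (G x - gradient (\<psi> n) x))\<^sup>2 \<partial>M) \<longlonglongrightarrow> 0" using sobolev_pair_approx[OF p] by blast
    note s = sobolev_pairD[OF p]
    obtain r where r: "strict_mono (r :: nat \<Rightarrow> nat)" "AE x in M. (\<lambda>n. \<psi> (r n) x) \<longlonglongrightarrow> u x"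
      using L2_tendsto_AE_subseq[OF test_function_square_integrable(1)[OF \<psi>(1)] s(1) \<psi>(2)] by blast
    note [measurable] = square_integrable_measurable[OF s(1)] square_integrable_measurable[OF test_function_square_integrable(1)[OF \<psi>(1)]]
    have "(\<lambda>n. energy (\<psi> n)) \<longlonglongrightarrow> (\<integral>x. (norm (G x))\<^sup>2 \<partial>M)"
      unfolding energy_def by (rule L2_tendsto_norm[OF test_function_square_integrable(2)[OF \<psi>(1)] s(2) \<psi>(3)])
    from LIMSEQ_subseq_LIMSEQ[OF this r(1)] have en: "(\<lambda>n. energy (\<psi> (r n))) \<longlonglongrightarrow> (\<integral>x. (norm (G x))\<^sup>2 \<partial>M)"
      by (simp add: o_def)
    have Cen: "(\<lambda>n. C * energy (\<psi> (r n)) powr (p / 2)) \<longlonglongrightarrow> C * (\<integral>x. (norm (G x))\<^sup>2 \<partial>M) powr (p / 2)"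
      using p_gt_2 by (intro tendsto_mult tendsto_const tendsto_powr' en)
        (auto simp: energy_def intro!: always_eventually integral_square_nonneg)
    have "(\<integral>\<^sup>+x. ennreal (\<bar>u x\<bar> powr p) \<partial>M) \<le> (\<integral>\<^sup>+x. liminf (\<lambda>n. ennreal (\<bar>\<psi> (r n) x\<bar> powr p)) \<partial>M)"
    proof (rule nn_integral_mono_AE)
      show "AE x in M. ennreal (\<bar>u x\<bar> powr p) \<le> liminf (\<lambda>n. ennreal (\<bar>\<psi> (r n) x\<bar> powr p))"
        using r(2)
      proof eventually_elim
        case (elim x)
        have "(\<lambda>n. ennreal (\<bar>\<psi> (r n) x\<bar> powr p)) \<longlonglongrightarrow> ennreal (\<bar>u x\<bar> powr p)"
          using p_gt_2 elim by (intro tendsto_ennrealI tendsto_powr' tendsto_intros) auto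
        from lim_imp_Liminf[OF sequentially_bot this] show ?case by simp
      qed
    qed
    also have "\<dots> \<le> liminf (\<lambda>n. \<integral>\<^sup>+x. ennreal (\<bar>\<psi> (r n) x\<bar> powr p) \<partial>M)"
      by (rule nn_integral_liminf) measurable
    also have "\<dots> \<le> liminf (\<lambda>n. ennreal (C * energy (\<psi> (r n)) powr (p / 2)))"
    proof (rule Liminf_mono[OF always_eventually], rule allI)
      fix n
      have "(\<integral>\<^sup>+x. ennreal (\<bar>\<psi> (r n) x\<bar> powr p) \<partial>M) = ennreal (\<integral>x. \<bar>\<psi> (r n) x\<bar> powr p \<partial>M)"
        by (rule nn_integral_eq_integral[OF test_function_integrable_powr(1)[OF \<psi>(1)]]) auto
      then show "(\<integral>\<^sup>+x. ennreal (\<bar>\<psi> (r n) x\<bar> powr p) \<partial>M) \<le> ennreal (C * energy (\<psi> (r n)) powr (p / 2))"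
        using test[OF \<psi>(1)] by (simp add: ennreal_leI)
    qed
    also have "\<dots> = ennreal (C * (\<integral>x. (norm (G x))\<^sup>2 \<partial>M) powr (p / 2))"
      by (rule lim_imp_Liminf[OF sequentially_bot tendsto_ennrealI[OF Cen]])
    finally have le: "(\<integral>\<^sup>+x. ennreal (\<bar>u x\<bar> powr p) \<partial>M) \<le> ennreal (C * (\<integral>x. (norm (G x))\<^sup>2 \<partial>M) powr (p / 2))" .
    show i: "integrable M (\<lambda>x. \<bar>u x\<bar> powr p)"
      using le by (intro integrableI_nonneg) (auto intro: le_less_trans)
    show "(\<integral>x. \<bar>u x\<bar> powr p \<partial>M) \<le> C * (\<integral>x. (norm (G x))\<^sup>2 \<partial>M) powr (p / 2)"
      using le C(1) by (subst (asm) nn_integral_eq_integral[OF i]) (auto simp: ennreal_le_iff)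
  qed
qed

lemma sobolev_pair_integrable_powr: "sobolev_pair u G \<Longrightarrow> integrable M (\<lambda>x. \<bar>u x\<bar> powr p)"
  using sobolev_pair_Sobolev by blast

text \<open>Makes the sets whose infima are \<open>sobolev_const\<close> and
  \<open>rayleigh_inf\<close> nonempty. A continuous function that is nonzero at a point of an open
  set cannot vanish almost everywhere there.\<close>

lemma ex_nonzero_test_function:
  "\<exists>\<phi>\<in>test_functions \<Omega>. \<not> ae_equal \<Omega> \<phi> (\<lambda>_. 0)"
proof -
  obtain x0 where x0: "x0 \<in> \<Omega>" using nonempty by blast
  obtain a b where ab: "cbox a b \<subseteq> \<Omega>" "x0 \<in> box a b" "\<forall>i\<in>Basis. a \<bullet> i < b \<bullet> i"
    by (rule open_contains_cbox[OF open_dom x0])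
  let ?\<phi> = "box_bump a b 1"
  have t: "?\<phi> \<in> test_functions \<Omega>" by (rule box_bump_test[OF ab(1)])
  have pos: "?\<phi> x0 \<noteq> 0"
    using ab(2) by (auto simp: box_bump_def mem_box_cart bump_simps)
  have "\<not> ae_equal \<Omega> ?\<phi> (\<lambda>_. 0)"
  proof
    assume "ae_equal \<Omega> ?\<phi> (\<lambda>_. 0)"
    then have ae: "AE x in lebesgue. x \<in> \<Omega> \<longrightarrow> x \<in> {x. ?\<phi> x = 0}"
      by (simp add: ae_equal_def AE_restrict_space_iff)
    have "continuous_on UNIV ?\<phi>" using test_functions_C_k[OF t, of 0] by simp
    then have "closed {x. ?\<phi> x = 0}" using continuous_closed_vimage[of "{0}" ?\<phi>]
      by (auto simp: vimage_def continuous_on_eq_continuous_at)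
    from mem_closed_if_AE_lebesgue_open[OF open_dom this ae x0] show False using pos by simp
  qed
  then show ?thesis using t by blast
qed

lemma ae_equal_0_iff:
  assumes u: "square_integrable M u"
  shows "ae_equal \<Omega> u (\<lambda>_. 0) \<longleftrightarrow> (\<integral>x. (u x)\<^sup>2 \<partial>M) = 0"
  using square_integrableD[OF u] by (subst integral_nonneg_eq_0_iff_AE) (auto simp: ae_equal_def)

lemma ae_equal_0_iff_powr:
  assumes u: "sobolev_pair u G"
  shows "ae_equal \<Omega> u (\<lambda>_. 0) \<longleftrightarrow> (\<integral>x. \<bar>u x\<bar> powr p \<partial>M) = 0"
  using sobolev_pair_integrable_powr[OF u] by (subst integral_nonneg_eq_0_iff_AE) (auto simp: ae_equal_def)

text \<open>The crude constant bounds all quotients from below by a positive number. This gives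
  positivity, and it makes the real infimum an actual lower bound, from which the sharp inequality
  is read off.\<close>

lemma sobolev_const_pos: "sobolev_const \<Omega> > 0"
  and sobolev_const_ineq: "sobolev_pair u G \<Longrightarrow>
    (\<integral>x. \<bar>u x\<bar> powr p \<partial>M) \<le> sobolev_const \<Omega> powr - (p / 2) * (\<integral>x. (norm (G x))\<^sup>2 \<partial>M) powr (p / 2)"
proof -
  let ?A = "{u \<in> H10 \<Omega>. \<not> ae_equal \<Omega> u (\<lambda>_. 0)}"
  let ?q = "\<lambda>u. dirichlet_energy \<Omega> u / (\<integral>x. \<bar>u x\<bar> powr p \<partial>M) powr (2 / p)"
  have S: "sobolev_const \<Omega> = (INF u\<in>?A. ?q u)" by (simp add: sobolev_const_def p_eq)
  obtain C where C: "C > 0" "\<And>u G. sobolev_pair u G \<Longrightarrow>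
     (\<integral>x. \<bar>u x\<bar> powr p \<partial>M) \<le> C * (\<integral>x. (norm (G x))\<^sup>2 \<partial>M) powr (p / 2)"
    using sobolev_pair_Sobolev by blast
  have pos: "(\<integral>x. \<bar>u x\<bar> powr p \<partial>M) > 0" if "sobolev_pair u G" "\<not> ae_equal \<Omega> u (\<lambda>_. 0)" for u G
  proof -
    have "(\<integral>x. \<bar>u x\<bar> powr p \<partial>M) \<ge> 0" by (intro integral_nonneg_AE) auto
    then show ?thesis using ae_equal_0_iff_powr[OF that(1)] that(2) by linarith
  qed
  have lower: "C powr - (2 / p) \<le> ?q u" if u: "u \<in> ?A" for u
  proof -
    obtain G where G: "sobolev_pair u G" using u H10_iff by blast
    let ?P = "\<integral>x. \<bar>u x\<bar> powr p \<partial>M" and ?E = "\<integral>x. (norm (G x))\<^sup>2 \<partial>M"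
    have P: "?P > 0" using pos[OF G] u by blast
    have E: "?E \<ge> 0" by (rule integral_square_nonneg)
    have "?P powr (2 / p) \<le> (C * ?E powr (p / 2)) powr (2 / p)"
      using C(2)[OF G] P p_gt_2 by (intro powr_mono2) auto
    also have "\<dots> = C powr (2 / p) * ?E"
      using C(1) E p_gt_2 by (simp add: powr_mult powr_powr)
    finally have "?P powr (2 / p) / C powr (2 / p) \<le> ?E" using C(1) by (simp add: divide_le_eq mult.commute)
    then show ?thesis
      using P C(1) by (simp add: sobolev_pair_dirichlet_energy[OF G] powr_minus field_simps)
  qed
  have ne: "?A \<noteq> {}"
    using ex_nonzero_test_function sobolev_pair_test H10_iff by blast
  have "C powr - (2 / p) \<le> sobolev_const \<Omega>" unfolding S by (intro cINF_greatest ne lower)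
  moreover have "C powr - (2 / p) > 0" using C(1) by simp
  ultimately show S0: "sobolev_const \<Omega> > 0" by linarith
  assume G: "sobolev_pair u G"
  let ?P = "\<integral>x. \<bar>u x\<bar> powr p \<partial>M" and ?E = "\<integral>x. (norm (G x))\<^sup>2 \<partial>M"
  show "?P \<le> sobolev_const \<Omega> powr - (p / 2) * ?E powr (p / 2)"
  proof (cases "ae_equal \<Omega> u (\<lambda>_. 0)")
    case True
    then show ?thesis using ae_equal_0_iff_powr[OF G] by simp
  next
    case False
    have P: "?P > 0" by (rule pos[OF G False])
    have E: "?E \<ge> 0" by (rule integral_square_nonneg)
    have "sobolev_const \<Omega> \<le> ?q u"
      unfolding S
    proof (rule cINF_lower)
      show "bdd_below (?q ` ?A)" using lower by (intro bdd_belowI2[of _ "C powr - (2 / p)"]) auto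
      show "u \<in> ?A" using False G H10_iff by blast
    qed
    then have "sobolev_const \<Omega> * ?P powr (2 / p) \<le> ?E"
      using P by (simp add: sobolev_pair_dirichlet_energy[OF G] field_simps)
    then have "(sobolev_const \<Omega> * ?P powr (2 / p)) powr (p / 2) \<le> ?E powr (p / 2)"
      using S0 P p_gt_2 by (intro powr_mono2) auto
    then have "sobolev_const \<Omega> powr (p / 2) * ?P \<le> ?E powr (p / 2)"
      using S0 P p_gt_2 by (simp add: powr_mult powr_powr)
    then show ?thesis using S0 by (simp add: powr_minus field_simps)
  qed
qed

end

subsection \<open>The first Dirichlet eigenvalue\<close>

context sobolev_domain
begin

text \<open>Taken over test functions, for which \<open>weak_compactness\<close> is available;
  \<open>first_eigenfunction\<close> identifies it with
  \<open>first_dirichlet_eigenvalue \<Omega>\<close>.\<close>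

definition rayleigh_inf :: real where
  "rayleigh_inf = (INF w\<in>{w \<in> test_functions \<Omega>. (\<integral>x. (w x)\<^sup>2 \<partial>M) = 1}. energy w)"

lemma energy_nonneg: "energy w \<ge> 0"
  unfolding energy_def by (rule integral_square_nonneg)

lemma rayleigh_bdd: "bdd_below (energy ` A)"
  using energy_nonneg by (intro bdd_belowI2[of _ 0]) auto

lemma test_function_normalize:
  assumes \<phi>: "\<phi> \<in> test_functions \<Omega>" and nz: "(\<integral>x. (\<phi> x)\<^sup>2 \<partial>M) > 0"
  obtains w where "w \<in> test_functions \<Omega>" "(\<integral>x. (w x)\<^sup>2 \<partial>M) = 1" "energy w = energy \<phi> / (\<integral>x. (\<phi> x)\<^sup>2 \<partial>M)"
proof
  let ?c = "1 / sqrt (\<integral>x. (\<phi> x)\<^sup>2 \<partial>M)"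
  have g: "gradient (\<lambda>x. ?c * \<phi> x + 0 * \<phi> x) x = ?c *\<^sub>R gradient \<phi> x" for x
    using gradient_lincomb[OF \<phi> \<phi>, of ?c 0] by simp
  show "(\<lambda>x. ?c * \<phi> x + 0 * \<phi> x) \<in> test_functions \<Omega>" by (rule test_functions_lincomb[OF \<phi> \<phi>])
  show "(\<integral>x. (?c * \<phi> x + 0 * \<phi> x)\<^sup>2 \<partial>M) = 1"
    using nz by (simp add: power_mult_distrib power_divide)
  show "energy (\<lambda>x. ?c * \<phi> x + 0 * \<phi> x) = energy \<phi> / (\<integral>x. (\<phi> x)\<^sup>2 \<partial>M)"
    unfolding energy_def g using nz by (simp add: power_mult_distrib power_divide)
qed

lemma rayleigh_test:
  assumes \<phi>: "\<phi> \<in> test_functions \<Omega>"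
  shows "rayleigh_inf * (\<integral>x. (\<phi> x)\<^sup>2 \<partial>M) \<le> energy \<phi>"
proof (cases "(\<integral>x. (\<phi> x)\<^sup>2 \<partial>M) = 0")
  case False
  have "(\<integral>x. (\<phi> x)\<^sup>2 \<partial>M) \<ge> 0" by (intro integral_nonneg_AE) auto
  then have pos: "(\<integral>x. (\<phi> x)\<^sup>2 \<partial>M) > 0" using False by linarith
  obtain w where w: "w \<in> test_functions \<Omega>" "(\<integral>x. (w x)\<^sup>2 \<partial>M) = 1" "energy w = energy \<phi> / (\<integral>x. (\<phi> x)\<^sup>2 \<partial>M)"
    by (rule test_function_normalize[OF \<phi> pos])
  have "rayleigh_inf \<le> energy w"
    unfolding rayleigh_inf_def using w by (intro cINF_lower rayleigh_bdd) simp
  then show ?thesis using pos w(3) by (simp add: field_simps)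
qed (simp add: energy_nonneg)

lemma rayleigh_pair:
  assumes "sobolev_pair v H"
  shows "rayleigh_inf * (\<integral>x. (v x)\<^sup>2 \<partial>M) \<le> (\<integral>x. (norm (H x))\<^sup>2 \<partial>M)"
proof -
  obtain \<psi> where \<psi>: "\<And>n. \<psi> n \<in> test_functions \<Omega>" "(\<lambda>n::nat. \<integral>x. (norm (v x - \<psi> n x))\<^sup>2 \<partial>M) \<longlonglongrightarrow> 0"
    "(\<lambda>n. \<integral>x. (norm (H x - gradient (\<psi> n) x))\<^sup>2 \<partial>M) \<longlonglongrightarrow> 0" using sobolev_pair_approx[OF assms] by blast
  note s = sobolev_pairD[OF assms]
  have "(\<lambda>n. rayleigh_inf * (\<integral>x. (norm (\<psi> n x))\<^sup>2 \<partial>M)) \<longlonglongrightarrow> rayleigh_inf * (\<integral>x. (norm (v x))\<^sup>2 \<partial>M)"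
    by (intro tendsto_mult tendsto_const L2_tendsto_norm[OF test_function_square_integrable(1)[OF \<psi>(1)] s(1) \<psi>(2)])
  moreover have "(\<lambda>n. energy (\<psi> n)) \<longlonglongrightarrow> (\<integral>x. (norm (H x))\<^sup>2 \<partial>M)"
    unfolding energy_def by (rule L2_tendsto_norm[OF test_function_square_integrable(2)[OF \<psi>(1)] s(2) \<psi>(3)])
  ultimately have "rayleigh_inf * (\<integral>x. (norm (v x))\<^sup>2 \<partial>M) \<le> (\<integral>x. (norm (H x))\<^sup>2 \<partial>M)"
    by (rule LIMSEQ_le) (use rayleigh_test[OF \<psi>(1)] in auto)
  then show ?thesis by simp
qed

text \<open>The constraint survives in the limit by strong \<open>L\<^sup>2\<close> convergence, and
  the energy can only drop, because the term split off in \<open>weak_compactness\<close> is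
  nonnegative.\<close>

lemma rayleigh_attained:
  obtains u G where "sobolev_pair u G" "(\<integral>x. (u x)\<^sup>2 \<partial>M) = 1" "(\<integral>x. (norm (G x))\<^sup>2 \<partial>M) = rayleigh_inf"
proof -
  let ?A = "{w \<in> test_functions \<Omega>. (\<integral>x. (w x)\<^sup>2 \<partial>M) = 1}"
  obtain \<phi>0 where \<phi>0: "\<phi>0 \<in> test_functions \<Omega>" "\<not> ae_equal \<Omega> \<phi>0 (\<lambda>_. 0)" using ex_nonzero_test_function by blast
  have "(\<integral>x. (\<phi>0 x)\<^sup>2 \<partial>M) \<ge> 0" by (intro integral_nonneg_AE) auto
  then have "(\<integral>x. (\<phi>0 x)\<^sup>2 \<partial>M) > 0"
    using ae_equal_0_iff[OF test_function_square_integrable(1)[OF \<phi>0(1)]] \<phi>0(2) by linarith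
  then obtain w0 where "w0 \<in> test_functions \<Omega>" "(\<integral>x. (w0 x)\<^sup>2 \<partial>M) = 1" "energy w0 = energy \<phi>0 / (\<integral>x. (\<phi>0 x)\<^sup>2 \<partial>M)"
    by (rule test_function_normalize[OF \<phi>0(1)])
  then have ne: "?A \<noteq> {}" by blast
  have "\<exists>w. w \<in> ?A \<and> energy w < rayleigh_inf + 1 / real (Suc n)" for n
    using cInf_lessD[of "energy ` ?A" "rayleigh_inf + 1 / real (Suc n)"] ne unfolding rayleigh_inf_def by auto
  then have "\<exists>w. \<forall>n. w n \<in> ?A \<and> energy (w n) < rayleigh_inf + 1 / real (Suc n)" by (intro choice allI)
  then obtain w where "\<forall>n. w n \<in> ?A \<and> energy (w n) < rayleigh_inf + 1 / real (Suc n)" by (rule exE)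
  then have w: "\<And>n. w n \<in> ?A" "\<And>n. energy (w n) < rayleigh_inf + 1 / real (Suc n)" by simp_all
  have wt: "w n \<in> test_functions \<Omega>" for n using w(1) by blast
  have bound: "energy (w n) \<le> rayleigh_inf + 1" for n
  proof -
    have "1 / real (Suc n) \<le> 1" by simp
    then show ?thesis using w(2)[of n] by linarith
  qed
  obtain r u G where r: "strict_mono (r :: nat \<Rightarrow> nat)" "sobolev_pair u G"
    "(\<lambda>n. \<integral>x. (norm (u x - w (r n) x))\<^sup>2 \<partial>M) \<longlonglongrightarrow> 0" "AE x in M. (\<lambda>n. w (r n) x) \<longlonglongrightarrow> u x"
    "(\<lambda>n. energy (w (r n)) - (\<integral>x. (norm (gradient (w (r n)) x - G x))\<^sup>2 \<partial>M)) \<longlonglongrightarrow> (\<integral>x. (norm (G x))\<^sup>2 \<partial>M)"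
    by (rule weak_compactness[OF wt bound])
  have "(\<lambda>n. \<integral>x. (norm (w (r n) x))\<^sup>2 \<partial>M) \<longlonglongrightarrow> (\<integral>x. (norm (u x))\<^sup>2 \<partial>M)"
    by (rule L2_tendsto_norm[OF test_function_square_integrable(1)[OF wt] sobolev_pairD(1)[OF r(2)] r(3)])
  then have u1: "(\<integral>x. (u x)\<^sup>2 \<partial>M) = 1" using w(1) by (simp add: LIMSEQ_const_iff)
  have "(\<lambda>n. rayleigh_inf + 1 / real (Suc n)) \<longlonglongrightarrow> rayleigh_inf + 0"
    using LIMSEQ_inverse_real_of_nat by (intro tendsto_intros) (simp add: inverse_eq_divide)
  then have L: "(\<lambda>n. rayleigh_inf + 1 / real (Suc n)) \<longlonglongrightarrow> rayleigh_inf" by simp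
  have "energy (w (r n)) - (\<integral>x. (norm (gradient (w (r n)) x - G x))\<^sup>2 \<partial>M) \<le> rayleigh_inf + 1 / real (Suc n)" for n
  proof -
    have "1 / real (Suc (r n)) \<le> 1 / real (Suc n)" using seq_suble[OF r(1), of n] by (simp add: frac_le)
    then show ?thesis
      using w(2)[of "r n"] integral_square_nonneg[of M "\<lambda>x. gradient (w (r n)) x - G x"] by linarith
  qed
  then have "(\<integral>x. (norm (G x))\<^sup>2 \<partial>M) \<le> rayleigh_inf"
    by (intro LIMSEQ_le[OF r(5) L]) blast
  moreover have "rayleigh_inf \<le> (\<integral>x. (norm (G x))\<^sup>2 \<partial>M)" using rayleigh_pair[OF r(2)] u1 by simp
  ultimately show ?thesis using that r(2) u1 by simp
qed

text \<open>Turns minimality into an equation; \<open>s = - B / D\<close> makes the right side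
  negative unless \<open>B\<close> vanishes.\<close>

lemma linear_term_zero:
  fixes B C :: real
  assumes "\<And>s. 0 \<le> 2 * s * B + s\<^sup>2 * C" shows "B = 0"
proof (rule ccontr)
  assume B: "B \<noteq> 0"
  define D where "D = \<bar>C\<bar> + 1"
  have D: "D > 0" "C \<le> D" by (auto simp: D_def)
  have "0 \<le> 2 * (- B / D) * B + (- B / D)\<^sup>2 * C" by (rule assms)
  also have "\<dots> \<le> 2 * (- B / D) * B + (- B / D)\<^sup>2 * D" using D by (intro add_left_mono mult_left_mono) auto
  also have "\<dots> = - (B\<^sup>2 / D)" using D by (simp add: power2_eq_square field_simps)
  also have "\<dots> < 0" using B D by simp
  finally show False by simp
qed

text \<open>Perturbing a minimiser of the Rayleigh quotient gives the eigenvalue equation, and an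
  eigenfunction tested with itself has its eigenvalue as Rayleigh quotient. So the set of
  eigenvalues has the minimum \<open>rayleigh_inf\<close>.\<close>

lemma first_eigenfunction:
  obtains u G where "sobolev_pair u G" "(\<integral>x. (u x)\<^sup>2 \<partial>M) = 1" "(\<integral>x. (norm (G x))\<^sup>2 \<partial>M) = first_dirichlet_eigenvalue \<Omega>"
proof -
  obtain u G where u: "sobolev_pair u G" "(\<integral>x. (u x)\<^sup>2 \<partial>M) = 1" "(\<integral>x. (norm (G x))\<^sup>2 \<partial>M) = rayleigh_inf"
    by (rule rayleigh_attained)
  have nz: "\<not> ae_equal \<Omega> u (\<lambda>_. 0)" using ae_equal_0_iff[OF sobolev_pairD(1)[OF u(1)]] u(2) by simp
  have ev: "dirichlet_eigenvalue \<Omega> rayleigh_inf"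
    unfolding dirichlet_eigenvalue_def
  proof (intro bexI[of _ u] conjI nz ballI)
    show "u \<in> H10 \<Omega>" using u(1) H10_iff by blast
    fix v assume "v \<in> H10 \<Omega>"
    then obtain H where v: "sobolev_pair v H" using H10_iff by blast
    note s = sobolev_pairD[OF u(1)] sobolev_pairD[OF v]
    have "0 \<le> 2 * t * ((\<integral>x. G x \<bullet> H x \<partial>M) - rayleigh_inf * (\<integral>x. u x * v x \<partial>M)) +
      t\<^sup>2 * ((\<integral>x. (norm (H x))\<^sup>2 \<partial>M) - rayleigh_inf * (\<integral>x. (v x)\<^sup>2 \<partial>M))" for t
      using rayleigh_pair[OF sobolev_pair_lincomb[OF u(1) v, of 1 t]]
        square_integrable_lincomb(2)[OF s(1,3), of 1 t] square_integrable_lincomb(2)[OF s(2,4), of 1 t] u(2,3)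
      by (simp add: algebra_simps)
    from linear_term_zero[OF this]
    show "dirichlet_form \<Omega> u v = rayleigh_inf * (\<integral>x. u x * v x \<partial>M)"
      unfolding sobolev_pair_dirichlet_form[OF u(1) v] by simp
  qed
  have least: "rayleigh_inf \<le> \<mu>" if \<mu>: "dirichlet_eigenvalue \<Omega> \<mu>" for \<mu>
  proof -
    obtain v where v: "v \<in> H10 \<Omega>" "\<not> ae_equal \<Omega> v (\<lambda>_. 0)" "dirichlet_form \<Omega> v v = \<mu> * (\<integral>x. v x * v x \<partial>M)"
      using \<mu> unfolding dirichlet_eigenvalue_def by blast
    obtain H where H: "sobolev_pair v H" using v(1) H10_iff by blast
    have "(\<integral>x. (v x)\<^sup>2 \<partial>M) \<ge> 0" by (intro integral_nonneg_AE) auto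
    then have pos: "(\<integral>x. (v x)\<^sup>2 \<partial>M) > 0"
      using ae_equal_0_iff[OF sobolev_pairD(1)[OF H]] v(2) by linarith
    have "rayleigh_inf * (\<integral>x. (v x)\<^sup>2 \<partial>M) \<le> (\<integral>x. H x \<bullet> H x \<partial>M)"
      using rayleigh_pair[OF H] by (simp add: power2_norm_eq_inner)
    also have "\<dots> = \<mu> * (\<integral>x. (v x)\<^sup>2 \<partial>M)"
      using v(3) unfolding sobolev_pair_dirichlet_form[OF H H] by (simp add: power2_eq_square)
    finally have "rayleigh_inf * (\<integral>x. (v x)\<^sup>2 \<partial>M) \<le> \<mu> * (\<integral>x. (v x)\<^sup>2 \<partial>M)" .
    then show ?thesis using pos by simp
  qed
  have "first_dirichlet_eigenvalue \<Omega> = rayleigh_inf"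
    unfolding first_dirichlet_eigenvalue_def by (rule cInf_eq_minimum) (use ev least in auto)
  then show ?thesis using that u by simp
qed

text \<open>The Sobolev inequality for the differences sends the integral of
  \<open>\<bar>\<phi> n x - u x\<bar> powr p\<close> to zero; the Brezis-Lieb lemma then yields
  convergence of the critical term itself.\<close>

lemma sobolev_pair_approx_powr:
  assumes "sobolev_pair u G"
  obtains \<phi> where "\<And>n. \<phi> n \<in> test_functions \<Omega>" "(\<lambda>n::nat. \<integral>x. (\<phi> n x)\<^sup>2 \<partial>M) \<longlonglongrightarrow> (\<integral>x. (u x)\<^sup>2 \<partial>M)"
    "(\<lambda>n. energy (\<phi> n)) \<longlonglongrightarrow> (\<integral>x. (norm (G x))\<^sup>2 \<partial>M)"
    "(\<lambda>n. \<integral>x. \<bar>\<phi> n x\<bar> powr p \<partial>M) \<longlonglongrightarrow> (\<integral>x. \<bar>u x\<bar> powr p \<partial>M)"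
proof -
  obtain \<psi> where \<psi>: "\<And>n. \<psi> n \<in> test_functions \<Omega>" "(\<lambda>n::nat. \<integral>x. (norm (u x - \<psi> n x))\<^sup>2 \<partial>M) \<longlonglongrightarrow> 0"
    "(\<lambda>n. \<integral>x. (norm (G x - gradient (\<psi> n) x))\<^sup>2 \<partial>M) \<longlonglongrightarrow> 0" using sobolev_pair_approx[OF assms] by blast
  note s = sobolev_pairD[OF assms]
  note t = test_function_square_integrable(1,2)[OF \<psi>(1)]
  obtain r where r: "strict_mono (r :: nat \<Rightarrow> nat)" "AE x in M. (\<lambda>n. \<psi> (r n) x) \<longlonglongrightarrow> u x"
    using L2_tendsto_AE_subseq[OF t(1) s(1) \<psi>(2)] by blast
  define \<phi> where "\<phi> n = \<psi> (r n)" for n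
  have \<phi>: "\<phi> n \<in> test_functions \<Omega>" for n by (simp add: \<phi>_def \<psi>(1))
  have l1: "(\<lambda>n. \<integral>x. (norm (u x - \<phi> n x))\<^sup>2 \<partial>M) \<longlonglongrightarrow> 0"
    and l2: "(\<lambda>n. \<integral>x. (norm (G x - gradient (\<phi> n) x))\<^sup>2 \<partial>M) \<longlonglongrightarrow> 0"
    using LIMSEQ_subseq_LIMSEQ[OF \<psi>(2) r(1)] LIMSEQ_subseq_LIMSEQ[OF \<psi>(3) r(1)] by (simp_all add: o_def \<phi>_def)
  note t = test_function_square_integrable(1,2)[OF \<phi>]
  have dp: "sobolev_pair (\<lambda>x. \<phi> n x - u x) (\<lambda>x. gradient (\<phi> n) x - G x)" for n
    using sobolev_pair_lincomb[OF sobolev_pair_test[OF \<phi>] assms, of 1 n "-1"] by simp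
  obtain C where C: "C > 0" "\<And>u G. sobolev_pair u G \<Longrightarrow>
     (\<integral>x. \<bar>u x\<bar> powr p \<partial>M) \<le> C * (\<integral>x. (norm (G x))\<^sup>2 \<partial>M) powr (p / 2)"
    using sobolev_pair_Sobolev by blast
  have "(\<lambda>n. C * (\<integral>x. (norm (gradient (\<phi> n) x - G x))\<^sup>2 \<partial>M) powr (p / 2)) \<longlonglongrightarrow> C * 0 powr (p / 2)"
    using p_gt_2 l2 by (intro tendsto_mult tendsto_const tendsto_powr')
      (auto simp: norm_minus_commute intro!: always_eventually integral_square_nonneg)
  then have C0: "(\<lambda>n. C * (\<integral>x. (norm (gradient (\<phi> n) x - G x))\<^sup>2 \<partial>M) powr (p / 2)) \<longlonglongrightarrow> 0" using p_gt_2 by simp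
  have d0: "(\<lambda>n. \<integral>x. \<bar>\<phi> n x - u x\<bar> powr p \<partial>M) \<longlonglongrightarrow> 0"
    by (rule tendsto_sandwich[OF _ _ tendsto_const C0]) (use C(2)[OF dp] in \<open>auto intro!: always_eventually integral_nonneg_AE\<close>)
  then have "Bseq (\<lambda>n. \<integral>x. \<bar>\<phi> n x - u x\<bar> powr p \<partial>M)" by (intro convergent_imp_Bseq convergentI)
  then obtain B where B: "\<And>n. norm (\<integral>x. \<bar>\<phi> n x - u x\<bar> powr p \<partial>M) \<le> B" by (meson BseqE)
  note [measurable] = square_integrable_measurable[OF s(1)] square_integrable_measurable[OF t(1)]
  have "(\<lambda>n. (\<integral>x. \<bar>\<phi> n x\<bar> powr p \<partial>M) - (\<integral>x. \<bar>\<phi> n x - u x\<bar> powr p \<partial>M)) \<longlonglongrightarrow> (\<integral>x. \<bar>u x\<bar> powr p \<partial>M)"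
  proof (rule Brezis_Lieb)
    show "AE x in M. (\<lambda>n. \<phi> n x) \<longlonglongrightarrow> u x" using r(2) by (simp add: \<phi>_def)
    show "(\<integral>x. \<bar>\<phi> n x - u x\<bar> powr p \<partial>M) \<le> B" for n using B[of n] by simp
  qed (use p_gt_2 sobolev_pair_integrable_powr[OF assms] sobolev_pair_integrable_powr[OF dp]
       sobolev_pair_integrable_powr[OF sobolev_pair_test[OF \<phi>]] in auto)
  from tendsto_add[OF this d0] have "(\<lambda>n. \<integral>x. \<bar>\<phi> n x\<bar> powr p \<partial>M) \<longlonglongrightarrow> (\<integral>x. \<bar>u x\<bar> powr p \<partial>M)" by simp
  moreover have "(\<lambda>n. \<integral>x. (\<phi> n x)\<^sup>2 \<partial>M) \<longlonglongrightarrow> (\<integral>x. (u x)\<^sup>2 \<partial>M)"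
    using L2_tendsto_norm[OF t(1) s(1) l1] by simp
  moreover have "(\<lambda>n. energy (\<phi> n)) \<longlonglongrightarrow> (\<integral>x. (norm (G x))\<^sup>2 \<partial>M)"
    unfolding energy_def by (rule L2_tendsto_norm[OF t(2) s(2) l2])
  ultimately show ?thesis using that \<phi> by blast
qed

end

subsection \<open>Scalar inequalities\<close>

text \<open>Half of the antiderivative of the Kirchhoff coefficient that vanishes at 0. The half
  cancels the factor 2 from differentiating a squared norm.\<close>

definition kirchhoff_primitive :: "real \<Rightarrow> real \<Rightarrow> real \<Rightarrow> real \<Rightarrow> real" where
  "kirchhoff_primitive a b \<gamma> t = a / 2 * t + b / (2 * \<gamma>) * t powr \<gamma>"

text \<open>
  The constant on the right of the hypothesis is the minimum of
  \<open>(a + b s powr (\<gamma> - 1)) / s powr (q - 1)\<close> over \<open>s > 0\<close>, raised to the power \<open>\<gamma> - 1\<close>.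
\<close>
lemma kirchhoff_coefficient_lower:
  fixes a b \<gamma> q S s :: real
  assumes "a > 0" "b > 0" "q > 1" "\<gamma> > q" "S > 0" "s > 0"
    and hyp: "a powr (\<gamma> - q) * b powr (q - 1) >
      (\<gamma> - q) powr (\<gamma> - q) * (q - 1) powr (q - 1) / (\<gamma> - 1) powr (\<gamma> - 1) * S powr (- q * (\<gamma> - 1))"
  shows "S powr - q * s powr (q - 1) \<le> a + b * s powr (\<gamma> - 1)"
proof -
  \<comment> \<open>Weights for Young's inequality, with
    \<open>\<eta> * (\<gamma> - 1) = q - 1\<close>, so that the geometric mean of the two terms
    scales like \<open>s powr (q - 1)\<close>.\<close>
  define \<theta> \<eta> where "\<theta> = (\<gamma> - q) / (\<gamma> - 1)" and "\<eta> = (q - 1) / (\<gamma> - 1)"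
  have pos: "\<theta> > 0" "\<eta> > 0" "\<theta> + \<eta> = 1" "\<gamma> - 1 > 0"
    using assms by (simp_all add: \<theta>_def \<eta>_def add_divide_distrib[symmetric])
  \<comment> \<open>The factor that Young's inequality puts before \<open>s powr (q - 1)\<close>.
    Its power with exponent \<open>\<gamma> - 1\<close> is computed in \<open>Xp\<close>; comparison
    with the hypothesis gives \<open>S powr - q \<le> X\<close>.\<close>
  define X where "X = (a / \<theta>) powr \<theta> * (b / \<eta>) powr \<eta>"
  have X: "X \<ge> 0" by (simp add: X_def)
  have Xp: "X powr (\<gamma> - 1) = a powr (\<gamma> - q) * b powr (q - 1) /
      ((\<gamma> - q) powr (\<gamma> - q) * (q - 1) powr (q - 1) / (\<gamma> - 1) powr (\<gamma> - 1))"
  proof -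
    have e: "\<theta> * (\<gamma> - 1) = \<gamma> - q" "\<eta> * (\<gamma> - 1) = q - 1" using pos by (simp_all add: \<theta>_def \<eta>_def)
    have "X powr (\<gamma> - 1) = (a / \<theta>) powr (\<gamma> - q) * (b / \<eta>) powr (q - 1)"
      unfolding X_def by (simp add: powr_mult powr_powr e)
    also have "a / \<theta> = a * (\<gamma> - 1) / (\<gamma> - q)" using pos assms by (simp add: \<theta>_def)
    also have "b / \<eta> = b * (\<gamma> - 1) / (q - 1)" using pos assms by (simp add: \<eta>_def)
    also have "(a * (\<gamma> - 1) / (\<gamma> - q)) powr (\<gamma> - q) * (b * (\<gamma> - 1) / (q - 1)) powr (q - 1) =
      a powr (\<gamma> - q) * b powr (q - 1) * ((\<gamma> - 1) powr (\<gamma> - q) * (\<gamma> - 1) powr (q - 1)) /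
      ((\<gamma> - q) powr (\<gamma> - q) * (q - 1) powr (q - 1))"
      using assms pos by (simp add: powr_mult powr_divide)
    also have "(\<gamma> - 1) powr (\<gamma> - q) * (\<gamma> - 1) powr (q - 1) = (\<gamma> - 1) powr (\<gamma> - 1)"
      by (simp flip: powr_add)
    finally show ?thesis by simp
  qed
  have "S powr - q \<le> X"
  proof (rule ccontr)
    assume "\<not> S powr - q \<le> X"
    then have "X powr (\<gamma> - 1) < (S powr - q) powr (\<gamma> - 1)" using X pos by (intro powr_less_mono2) auto
    also have "\<dots> = S powr (- q * (\<gamma> - 1))" by (simp add: powr_powr)
    finally have "a powr (\<gamma> - q) * b powr (q - 1) <
        S powr (- q * (\<gamma> - 1)) * ((\<gamma> - q) powr (\<gamma> - q) * (q - 1) powr (q - 1) / (\<gamma> - 1) powr (\<gamma> - 1))"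
      unfolding Xp using assms pos by (subst (asm) pos_divide_less_eq) auto
    then show False using hyp by (simp add: mult.commute)
  qed
  then have "S powr - q * s powr (q - 1) \<le> X * s powr (q - 1)" by (intro mult_right_mono) auto
  also have "\<dots> = (a / \<theta>) powr \<theta> * (b * s powr (\<gamma> - 1) / \<eta>) powr \<eta>"
  proof -
    have "(s powr (\<gamma> - 1)) powr \<eta> = s powr (q - 1)" using pos by (simp add: powr_powr \<eta>_def)
    then show ?thesis
      using powr_mult[of "b / \<eta>" "s powr (\<gamma> - 1)" \<eta>] assms pos by (simp add: X_def)
  qed
  also have "\<dots> \<le> \<theta> * (a / \<theta>) + \<eta> * (b * s powr (\<gamma> - 1) / \<eta>)"
    using assms pos by (intro Youngs_inequality_0) auto
  also have "\<dots> = a + b * s powr (\<gamma> - 1)" using pos by simp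
  finally show ?thesis .
qed

lemma DERIV_kirchhoff_primitive:
  assumes "\<gamma> \<noteq> 0" "t > 0"
  shows "(kirchhoff_primitive a b \<gamma> has_real_derivative (a + b * t powr (\<gamma> - 1)) / 2) (at t)"
  unfolding kirchhoff_primitive_def[abs_def]
  using assms by (auto intro!: derivative_eq_intros simp: field_simps)

lemma continuous_on_kirchhoff_primitive: "\<gamma> > 0 \<Longrightarrow> continuous_on {0..} (kirchhoff_primitive a b \<gamma>)"
  unfolding kirchhoff_primitive_def[abs_def] by (intro continuous_intros continuous_on_powr') auto

text \<open>Both sides vanish at 0, and the hypothesis compares their derivatives on the open
  half-line.\<close>

lemma kirchhoff_primitive_lower:
  fixes \<kappa> :: real
  assumes "q > 0" "\<gamma> > 0" "t \<ge> 0"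
    and le: "\<And>s. s > 0 \<Longrightarrow> \<kappa> * s powr (q - 1) \<le> a + b * s powr (\<gamma> - 1)"
  shows "\<kappa> / (2 * q) * t powr q \<le> kirchhoff_primitive a b \<gamma> t"
proof -
  let ?F = "\<lambda>t. kirchhoff_primitive a b \<gamma> t - \<kappa> / (2 * q) * t powr q"
  have "?F 0 \<le> ?F t"
  proof (rule DERIV_nonneg_imp_increasing_open[OF assms(3)])
    fix x assume x: "0 < x" "x < t"
    have "(?F has_real_derivative (a + b * x powr (\<gamma> - 1)) / 2 - \<kappa> / (2 * q) * (q * x powr (q - 1))) (at x)"
      using x assms by (intro DERIV_diff DERIV_kirchhoff_primitive DERIV_cmult) (auto intro!: derivative_eq_intros)
    moreover have "(a + b * x powr (\<gamma> - 1)) / 2 - \<kappa> / (2 * q) * (q * x powr (q - 1)) \<ge> 0"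
      using le[OF x(1)] assms by simp
    ultimately show "\<exists>y. (?F has_real_derivative y) (at x) \<and> 0 \<le> y" by blast
  next
    have "continuous_on {0..t} (\<lambda>t. t powr q)" using assms by (intro continuous_on_powr' continuous_intros) auto
    then show "continuous_on {0..t} ?F"
      using assms by (intro continuous_on_diff continuous_on_mult continuous_on_const
          continuous_on_subset[OF continuous_on_kirchhoff_primitive]) auto
  qed
  then show ?thesis by (simp add: kirchhoff_primitive_def)
qed

text \<open>The linear part is additive, and \<open>t powr \<gamma>\<close> is \<open>t\<close>
  times the nondecreasing factor \<open>t powr (\<gamma> - 1)\<close>.\<close>

lemma kirchhoff_primitive_superadditive:
  fixes x y :: real
  assumes "b \<ge> 0" "\<gamma> \<ge> 1" "x \<ge> 0" "y \<ge> 0"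
  shows "kirchhoff_primitive a b \<gamma> x + kirchhoff_primitive a b \<gamma> y \<le> kirchhoff_primitive a b \<gamma> (x + y)"
proof -
  have split: "z powr \<gamma> = z * z powr (\<gamma> - 1)" if "z \<ge> 0" for z :: real
    using that by (cases "z = 0") (simp_all add: powr_diff)
  have "x * x powr (\<gamma> - 1) + y * y powr (\<gamma> - 1) \<le> x * (x + y) powr (\<gamma> - 1) + y * (x + y) powr (\<gamma> - 1)"
    using assms by (intro add_mono mult_left_mono powr_mono2) auto
  then have "x powr \<gamma> + y powr \<gamma> \<le> (x + y) powr \<gamma>"
    using assms by (simp add: split distrib_right)
  then have "b / (2 * \<gamma>) * (x powr \<gamma> + y powr \<gamma>) \<le> b / (2 * \<gamma>) * (x + y) powr \<gamma>"
    using assms by (intro mult_left_mono) auto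
  then show ?thesis by (simp add: kirchhoff_primitive_def distrib_left add_divide_distrib)
qed

lemma kirchhoff_primitive_coercive:
  fixes C D :: real
  assumes "a \<ge> 0" "b > 0" "q > 1" "\<gamma> > q" "C \<ge> 0" "D \<ge> 0"
  shows "\<exists>T\<ge>0. \<forall>t\<ge>T. C * t + D * t powr q \<le> kirchhoff_primitive a b \<gamma> t"
proof -
  define c where "c = b / (2 * \<gamma>)"
  have c: "c > 0" using assms by (simp add: c_def)
  \<comment> \<open>Beyond \<open>T\<close> the factor \<open>t powr (\<gamma> - q)\<close> exceeds
    \<open>(C + D) / c\<close>, and \<open>t \<ge> 1\<close> allows the linear term to be estimated
    by \<open>t powr q\<close>.\<close>
  define T where "T = max 1 (((C + D) / c) powr (1 / (\<gamma> - q)))"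
  have "C * t + D * t powr q \<le> kirchhoff_primitive a b \<gamma> t" if t: "t \<ge> T" for t
  proof -
    have t1: "t \<ge> 1" using t by (simp add: T_def)
    have "(((C + D) / c) powr (1 / (\<gamma> - q))) powr (\<gamma> - q) \<le> t powr (\<gamma> - q)"
      using t assms by (intro powr_mono2) (auto simp: T_def)
    then have "(C + D) / c \<le> t powr (\<gamma> - q)" using assms c by (simp add: powr_powr)
    then have "C + D \<le> c * t powr (\<gamma> - q)" using c by (simp add: field_simps)
    then have "(C + D) * t powr q \<le> c * t powr (\<gamma> - q) * t powr q" by (intro mult_right_mono) auto
    also have "\<dots> = c * t powr \<gamma>" using powr_add[of t "\<gamma> - q" q] by simp
    finally have "(C + D) * t powr q \<le> c * t powr \<gamma>" .
    moreover have "t powr 1 \<le> t powr q" using t1 assms by (intro powr_mono) auto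
    then have "C * t \<le> C * t powr q" using t1 assms by (intro mult_left_mono) auto
    moreover have "0 \<le> a / 2 * t" using t1 assms by simp
    ultimately show ?thesis by (simp add: kirchhoff_primitive_def c_def distrib_right)
  qed
  then show ?thesis by (intro exI[of _ T]) (simp add: T_def)
qed

subsection \<open>Differentiating the critical term\<close>

lemma DERIV_abs_powr:
  fixes x p :: real
  assumes "p > 1"
  shows "((\<lambda>x. \<bar>x\<bar> powr p) has_real_derivative p * \<bar>x\<bar> powr (p - 2) * x) (at x)"
proof -
  have s: "z powr (p - 1) = z powr (p - 2) * z" if "z > 0" for z :: real
    using that powr_add[of z "p - 2" 1] by simp
  consider "x > 0" | "x < 0" | "x = 0" by linarith
  then show ?thesis
  proof cases
    case 1
    have "((\<lambda>x. x powr p) has_real_derivative p * \<bar>x\<bar> powr (p - 2) * x) (at x)"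
      using 1 by (auto intro!: derivative_eq_intros simp: s)
    then show ?thesis
      by (rule has_field_derivative_transform_within_open[of _ _ _ "{0<..}"]) (use 1 in auto)
  next
    case 2
    have "((\<lambda>x. (- x) powr p) has_real_derivative p * \<bar>x\<bar> powr (p - 2) * x) (at x)"
      using 2 by (auto intro!: derivative_eq_intros simp: s)
    then show ?thesis
      by (rule has_field_derivative_transform_within_open[of _ _ _ "{..<0}"]) (use 2 in auto)
  next
    case 3
    have "((\<lambda>h. \<bar>h\<bar> powr p / h) \<longlongrightarrow> 0) (at 0)"
    proof (rule Lim_null_comparison)
      have "norm (\<bar>h\<bar> powr p / h) \<le> \<bar>h\<bar> powr (p - 1)" for h :: real
        by (cases "h = 0") (simp_all add: abs_divide powr_diff)
      then show "\<forall>\<^sub>F h in at 0. norm (\<bar>h\<bar> powr p / h) \<le> \<bar>h\<bar> powr (p - 1)" by simp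
      have "((\<lambda>h. \<bar>h\<bar> powr (p - 1)) \<longlongrightarrow> \<bar>0::real\<bar> powr (p - 1)) (at 0)"
        using assms by (intro tendsto_powr' tendsto_intros) auto
      then show "((\<lambda>h::real. \<bar>h\<bar> powr (p - 1)) \<longlongrightarrow> 0) (at 0)" using assms by simp
    qed
    then show ?thesis using 3 by (simp add: DERIV_def)
  qed
qed

lemma abs_powr_add_le:
  fixes x y p :: real
  assumes "p > 0" shows "(\<bar>x\<bar> + \<bar>y\<bar>) powr p \<le> 2 powr p * (\<bar>x\<bar> powr p + \<bar>y\<bar> powr p)"
proof -
  have "(\<bar>x\<bar> + \<bar>y\<bar>) powr p \<le> (2 * max \<bar>x\<bar> \<bar>y\<bar>) powr p" using assms by (intro powr_mono2) auto
  also have "\<dots> = 2 powr p * max \<bar>x\<bar> \<bar>y\<bar> powr p" by (simp add: powr_mult)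
  also have "\<dots> \<le> 2 powr p * (\<bar>x\<bar> powr p + \<bar>y\<bar> powr p)" by (intro mult_left_mono) (auto simp: max_def)
  finally show ?thesis .
qed

text \<open>By the mean value theorem the quotient is a derivative at an intermediate point, of
  absolute value at most \<open>\<bar>x\<bar> + \<bar>y\<bar>\<close>. The bound is independent of
  \<open>s\<close> and serves as majorant in a dominated convergence.\<close>

lemma abs_powr_difference_quotient:
  fixes x y p s :: real
  assumes p: "p > 1" and s: "0 < s" "s \<le> 1"
  shows "\<bar>(\<bar>x + s * y\<bar> powr p - \<bar>x\<bar> powr p) / s\<bar> \<le> p * (2 powr p * (\<bar>x\<bar> powr p + \<bar>y\<bar> powr p))"
proof -
  have D: "((\<lambda>t. \<bar>x + t * y\<bar> powr p) has_real_derivative p * \<bar>x + t * y\<bar> powr (p - 2) * (x + t * y) * y) (at t)" for t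
    by (rule DERIV_chain2[OF DERIV_abs_powr[OF p]]) (auto intro!: derivative_eq_intros)
  obtain z where z: "0 < z" "z < s"
    "\<bar>x + s * y\<bar> powr p - \<bar>x + 0 * y\<bar> powr p = (s - 0) * (p * \<bar>x + z * y\<bar> powr (p - 2) * (x + z * y) * y)"
    using MVT2[OF s(1) D] by blast
  let ?w = "x + z * y"
  have w: "\<bar>?w\<bar> \<le> \<bar>x\<bar> + \<bar>y\<bar>"
  proof -
    have "\<bar>z * y\<bar> \<le> \<bar>y\<bar>" using z s by (simp add: abs_mult mult_left_le_one_le)
    then show ?thesis by linarith
  qed
  have split: "t powr p = t powr (p - 1) * t" "t powr (p - 1) = t powr (p - 2) * t" if "t \<ge> 0" for t :: real
    using that powr_add[of t "p - 1" 1] powr_add[of t "p - 2" 1] by (cases "t = 0"; simp)+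
  have "\<bar>(\<bar>x + s * y\<bar> powr p - \<bar>x\<bar> powr p) / s\<bar> = p * (\<bar>?w\<bar> powr (p - 1) * \<bar>y\<bar>)"
    using z s p by (simp add: abs_mult split(2) mult.assoc)
  also have "\<dots> \<le> p * ((\<bar>x\<bar> + \<bar>y\<bar>) powr (p - 1) * (\<bar>x\<bar> + \<bar>y\<bar>))"
    using w p by (intro mult_left_mono mult_mono powr_mono2) auto
  also have "\<dots> = p * (\<bar>x\<bar> + \<bar>y\<bar>) powr p" by (simp add: split(1)[of "\<bar>x\<bar> + \<bar>y\<bar>"])
  also have "\<dots> \<le> p * (2 powr p * (\<bar>x\<bar> powr p + \<bar>y\<bar> powr p))"
    using p by (intro mult_left_mono abs_powr_add_le) auto
  finally show ?thesis .
qed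

lemma difference_quotient_sequence:
  fixes f :: "real \<Rightarrow> real"
  assumes "(f has_real_derivative D) (at 0)"
  shows "(\<lambda>n. (f (1 / real (Suc n)) - f 0) / (1 / real (Suc n))) \<longlonglongrightarrow> D"
proof -
  have "((\<lambda>t. (f t - f 0) / t) \<longlongrightarrow> D) (at 0)" using assms by (simp add: DERIV_def)
  moreover have "filterlim (\<lambda>n. 1 / real (Suc n)) (at 0) sequentially"
    unfolding filterlim_at using LIMSEQ_inverse_real_of_nat by (auto simp: inverse_eq_divide)
  ultimately show ?thesis by (rule filterlim_compose)
qed

text \<open>The steps 1 / (n + 1) suffice, as minimality is exploited through quotients from the
  right only.\<close>

lemma integral_abs_powr_derivative:
  fixes u v :: "'a \<Rightarrow> real"
  assumes p: "p > 1" and [measurable]: "u \<in> borel_measurable M" "v \<in> borel_measurable M"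
    and i: "integrable M (\<lambda>x. \<bar>u x\<bar> powr p)" "integrable M (\<lambda>x. \<bar>v x\<bar> powr p)"
    and i_add: "\<And>s. integrable M (\<lambda>x. \<bar>u x + s * v x\<bar> powr p)"
  shows "(\<lambda>n. ((\<integral>x. \<bar>u x + 1 / real (Suc n) * v x\<bar> powr p \<partial>M) - (\<integral>x. \<bar>u x\<bar> powr p \<partial>M)) / (1 / real (Suc n)))
    \<longlonglongrightarrow> (\<integral>x. p * (\<bar>u x\<bar> powr (p - 2) * u x * v x) \<partial>M)"
proof -
  let ?s = "\<lambda>n. 1 / real (Suc n)"
  have "(\<lambda>n. \<integral>x. (\<bar>u x + ?s n * v x\<bar> powr p - \<bar>u x\<bar> powr p) / ?s n \<partial>M) \<longlonglongrightarrow> (\<integral>x. p * (\<bar>u x\<bar> powr (p - 2) * u x * v x) \<partial>M)"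
  proof (rule integral_dominated_convergence[where w="\<lambda>x. p * (2 powr p * (\<bar>u x\<bar> powr p + \<bar>v x\<bar> powr p))"])
    show "integrable M (\<lambda>x. p * (2 powr p * (\<bar>u x\<bar> powr p + \<bar>v x\<bar> powr p)))" using i by simp
    show "AE x in M. norm ((\<bar>u x + ?s n * v x\<bar> powr p - \<bar>u x\<bar> powr p) / ?s n) \<le> p * (2 powr p * (\<bar>u x\<bar> powr p + \<bar>v x\<bar> powr p))" for n
      using abs_powr_difference_quotient[OF p, of "?s n"] by (intro AE_I2) simp
    show "AE x in M. (\<lambda>n. (\<bar>u x + ?s n * v x\<bar> powr p - \<bar>u x\<bar> powr p) / ?s n) \<longlonglongrightarrow> p * (\<bar>u x\<bar> powr (p - 2) * u x * v x)"
    proof (rule AE_I2)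
      fix x
      have "((\<lambda>t. \<bar>u x + t * v x\<bar> powr p) has_real_derivative p * \<bar>u x + 0 * v x\<bar> powr (p - 2) * (u x + 0 * v x) * v x) (at 0)"
        by (rule DERIV_chain2[OF DERIV_abs_powr[OF p]]) (auto intro!: derivative_eq_intros)
      from difference_quotient_sequence[OF this]
      show "(\<lambda>n. (\<bar>u x + ?s n * v x\<bar> powr p - \<bar>u x\<bar> powr p) / ?s n) \<longlonglongrightarrow> p * (\<bar>u x\<bar> powr (p - 2) * u x * v x)"
        by (simp add: mult.assoc)
    qed
  qed measurable
  moreover have "(\<integral>x. (\<bar>u x + ?s n * v x\<bar> powr p - \<bar>u x\<bar> powr p) / ?s n \<partial>M) =
    ((\<integral>x. \<bar>u x + ?s n * v x\<bar> powr p \<partial>M) - (\<integral>x. \<bar>u x\<bar> powr p \<partial>M)) / ?s n" for n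
    using i i_add[of "?s n"] by (simp only: integral_divide_zero Bochner_Integration.integral_diff)
  ultimately show ?thesis by simp
qed

subsection \<open>The Kirchhoff functional\<close>

locale kirchhoff_problem = sobolev_domain \<Omega> p for \<Omega> :: "(real^'n) set" and p :: real +
  fixes a b \<gamma> lam :: real
  assumes a_nonneg: "a \<ge> 0" and b_pos: "b > 0" and \<gamma>_gt: "\<gamma> > p / 2"
    and large: "a powr (\<gamma> - p / 2) * b powr (p / 2 - 1) >
         (\<gamma> - p / 2) powr (\<gamma> - p / 2) * (p / 2 - 1) powr (p / 2 - 1) / (\<gamma> - 1) powr (\<gamma> - 1)
         * sobolev_const \<Omega> powr (- (p / 2) * (\<gamma> - 1))"
    and lam_ge: "lam \<ge> a * first_dirichlet_eigenvalue \<Omega>"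
begin

text \<open>The sharp constant in front of the energy to the power \<open>p / 2\<close>.\<close>

definition \<kappa> :: real where "\<kappa> = sobolev_const \<Omega> powr - (p / 2)"

abbreviation \<Phi> :: "real \<Rightarrow> real" where "\<Phi> \<equiv> kirchhoff_primitive a b \<gamma>"

text \<open>The gradient is a separate argument, which keeps the functional free of the choice in
  \<open>weak_gradient\<close>.\<close>

definition J :: "(real^'n \<Rightarrow> real) \<Rightarrow> (real^'n \<Rightarrow> real^'n) \<Rightarrow> real" where
  "J u G = \<Phi> (\<integral>x. (norm (G x))\<^sup>2 \<partial>M) - lam / 2 * (\<integral>x. (u x)\<^sup>2 \<partial>M) - 1 / p * (\<integral>x. \<bar>u x\<bar> powr p \<partial>M)"

lemma \<gamma>_gt_1: "\<gamma> > 1"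
  using \<gamma>_gt p_gt_2 by linarith

text \<open>With \<open>a = 0\<close> the left side of \<open>large\<close> is 0, since
  \<open>0 powr\<close> anything is 0, while the right side is nonnegative.\<close>

lemma a_pos: "a > 0"
proof (rule ccontr)
  assume "\<not> a > 0"
  then have "a = 0" using a_nonneg by simp
  then have "a powr (\<gamma> - p / 2) * b powr (p / 2 - 1) = 0" by simp
  moreover have "0 \<le> (\<gamma> - p / 2) powr (\<gamma> - p / 2) * (p / 2 - 1) powr (p / 2 - 1) / (\<gamma> - 1) powr (\<gamma> - 1)
         * sobolev_const \<Omega> powr (- (p / 2) * (\<gamma> - 1))"
    by simp
  ultimately show False using large by linarith
qed

text \<open>The first eigenvalue is an energy. The sign matters for coercivity, where
  \<open>lam\<close> multiplies an upper bound from the Poincare inequality.\<close>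

lemma lam_nonneg: "lam \<ge> 0"
proof -
  obtain u G where u: "sobolev_pair u G" "(\<integral>x. (u x)\<^sup>2 \<partial>M) = 1" "(\<integral>x. (norm (G x))\<^sup>2 \<partial>M) = first_dirichlet_eigenvalue \<Omega>"
    by (rule first_eigenfunction)
  have "0 \<le> a * first_dirichlet_eigenvalue \<Omega>"
    unfolding u(3)[symmetric] by (intro mult_nonneg_nonneg a_nonneg integral_square_nonneg)
  then show ?thesis using lam_ge by linarith
qed

lemma \<kappa>_nonneg: "\<kappa> \<ge> 0" by (simp add: \<kappa>_def)

text \<open>The integrated form of the hypothesis \<open>large\<close>, with
  \<open>q = p / 2\<close>: whatever a function gains in the critical term by the sharp Sobolev
  inequality is paid for by \<Phi> of its energy.\<close>

lemma \<Phi>_lower: "t \<ge> 0 \<Longrightarrow> \<kappa> / p * t powr (p / 2) \<le> \<Phi> t"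
  using kirchhoff_primitive_lower[of "p / 2" \<gamma> t \<kappa> a b]
    kirchhoff_coefficient_lower[OF a_pos b_pos _ \<gamma>_gt sobolev_const_pos _ large] p_gt_2 \<gamma>_gt_1
  by (simp add: \<kappa>_def)

lemma \<Phi>_nonneg: "t \<ge> 0 \<Longrightarrow> \<Phi> t \<ge> 0"
  using a_pos b_pos \<gamma>_gt_1 by (simp add: kirchhoff_primitive_def)

lemma \<Phi>_tendsto:
  assumes "f \<longlonglongrightarrow> l" "\<And>n. f n \<ge> 0"
  shows "(\<lambda>n. \<Phi> (f n)) \<longlonglongrightarrow> \<Phi> l"
  unfolding kirchhoff_primitive_def using assms \<gamma>_gt_1
  by (intro tendsto_intros tendsto_powr') auto

lemma J_limit_of_test:
  assumes "sobolev_pair u G"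
  obtains \<phi> where "\<And>n::nat. \<phi> n \<in> test_functions \<Omega>" "(\<lambda>n. J (\<phi> n) (gradient (\<phi> n))) \<longlonglongrightarrow> J u G"
proof -
  obtain \<phi> where \<phi>: "\<And>n. \<phi> n \<in> test_functions \<Omega>" "(\<lambda>n::nat. \<integral>x. (\<phi> n x)\<^sup>2 \<partial>M) \<longlonglongrightarrow> (\<integral>x. (u x)\<^sup>2 \<partial>M)"
    "(\<lambda>n. energy (\<phi> n)) \<longlonglongrightarrow> (\<integral>x. (norm (G x))\<^sup>2 \<partial>M)"
    "(\<lambda>n. \<integral>x. \<bar>\<phi> n x\<bar> powr p \<partial>M) \<longlonglongrightarrow> (\<integral>x. \<bar>u x\<bar> powr p \<partial>M)"
    using sobolev_pair_approx_powr[OF assms] by blast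
  have "(\<lambda>n. J (\<phi> n) (gradient (\<phi> n))) \<longlonglongrightarrow> J u G"
    unfolding J_def energy_def[symmetric]
    by (intro tendsto_diff tendsto_mult tendsto_const \<Phi>_tendsto \<phi> energy_nonneg)
  then show ?thesis using that \<phi>(1) by blast
qed

text \<open>Only test functions compete, but by \<open>J_limit_of_test\<close> the value is a lower
  bound on all Sobolev pairs as well.\<close>

definition J_inf :: real where
  "J_inf = (INF \<phi>\<in>test_functions \<Omega>. J \<phi> (gradient \<phi>))"

text \<open>The two negative terms are at most \<open>C * t\<close> and
  \<open>\<kappa> / p * t powr (p / 2)\<close> at energy \<open>t\<close>, by the Poincare and
  Sobolev inequalities, and the power \<gamma> > p / 2 outgrows both.\<close>

lemma J_coercive:
  obtains T L where "T \<ge> 0" "\<And>\<phi>. \<phi> \<in> test_functions \<Omega> \<Longrightarrow> J \<phi> (gradient \<phi>) \<ge> L"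
    "\<And>\<phi>. \<lbrakk>\<phi> \<in> test_functions \<Omega>; J \<phi> (gradient \<phi>) < 0\<rbrakk> \<Longrightarrow> energy \<phi> \<le> T"
proof -
  obtain R where R: "R > 0" "\<Omega> \<subseteq> ball 0 R" by (rule obtain_radius)
  \<comment> \<open>The coefficient \<open>lam / 2\<close> times the Poincare constant
    \<open>2 * R\<^sup>2\<close>.\<close>
  define C where "C = lam * R\<^sup>2"
  have C: "C \<ge> 0" using lam_nonneg by (simp add: C_def)
  obtain T where T: "T \<ge> 0" "\<And>t. t \<ge> T \<Longrightarrow> C * t + \<kappa> / p * t powr (p / 2) \<le> \<Phi> t"
    using kirchhoff_primitive_coercive[OF a_nonneg b_pos _ \<gamma>_gt C, of "\<kappa> / p"] p_gt_2 \<kappa>_nonneg by auto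
  have lower: "\<Phi> (energy \<phi>) - (C * energy \<phi> + \<kappa> / p * energy \<phi> powr (p / 2)) \<le> J \<phi> (gradient \<phi>)"
    if \<phi>: "\<phi> \<in> test_functions \<Omega>" for \<phi>
  proof -
    have "lam / 2 * (\<integral>x. (\<phi> x)\<^sup>2 \<partial>M) \<le> lam / 2 * (2 * R\<^sup>2 * energy \<phi>)"
      using Poincare[OF R \<phi>] lam_nonneg by (intro mult_left_mono) (auto simp: energy_def)
    moreover have "1 / p * (\<integral>x. \<bar>\<phi> x\<bar> powr p \<partial>M) \<le> 1 / p * (\<kappa> * energy \<phi> powr (p / 2))"
      using sobolev_const_ineq[OF sobolev_pair_test[OF \<phi>]] p_gt_2
      by (intro mult_left_mono) (auto simp: energy_def \<kappa>_def)
    ultimately show ?thesis by (simp add: J_def energy_def[symmetric] C_def)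
  qed
  show ?thesis
  proof (rule that[OF T(1)])
    fix \<phi> assume \<phi>: "\<phi> \<in> test_functions \<Omega>"
    have E: "energy \<phi> \<ge> 0" by (rule energy_nonneg)
    show "- (C * T + \<kappa> / p * T powr (p / 2)) \<le> J \<phi> (gradient \<phi>)"
    proof (cases "energy \<phi> \<ge> T")
      case True
      have "0 \<le> C * T + \<kappa> / p * T powr (p / 2)" using C T(1) \<kappa>_nonneg p_gt_2 by simp
      then show ?thesis using lower[OF \<phi>] T(2)[OF True] by linarith
    next
      case False
      then have "C * energy \<phi> \<le> C * T" using C by (intro mult_left_mono) auto
      moreover have "\<kappa> / p * energy \<phi> powr (p / 2) \<le> \<kappa> / p * T powr (p / 2)"
        using False E \<kappa>_nonneg p_gt_2 by (intro mult_left_mono powr_mono2) auto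
      ultimately show ?thesis using lower[OF \<phi>] \<Phi>_nonneg[OF E] by linarith
    qed
    assume "J \<phi> (gradient \<phi>) < 0"
    then show "energy \<phi> \<le> T" using lower[OF \<phi>] T(2)[of "energy \<phi>"] by linarith
  qed
qed

lemma J_inf_test: "\<phi> \<in> test_functions \<Omega> \<Longrightarrow> J_inf \<le> J \<phi> (gradient \<phi>)"
proof -
  obtain T L where "T \<ge> 0" and L: "\<And>\<phi>. \<phi> \<in> test_functions \<Omega> \<Longrightarrow> J \<phi> (gradient \<phi>) \<ge> L"
    and "\<And>\<phi>. \<lbrakk>\<phi> \<in> test_functions \<Omega>; J \<phi> (gradient \<phi>) < 0\<rbrakk> \<Longrightarrow> energy \<phi> \<le> T" using J_coercive by blast
  assume "\<phi> \<in> test_functions \<Omega>"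
  then show ?thesis
    unfolding J_inf_def using L by (intro cINF_lower) (auto intro!: bdd_belowI2[of _ L])
qed

lemma J_inf_pair: "sobolev_pair u G \<Longrightarrow> J_inf \<le> J u G"
proof -
  assume "sobolev_pair u G"
  then obtain \<phi> where \<phi>: "\<And>n::nat. \<phi> n \<in> test_functions \<Omega>" "(\<lambda>n. J (\<phi> n) (gradient (\<phi> n))) \<longlonglongrightarrow> J u G"
    using J_limit_of_test by blast
  show ?thesis by (rule LIMSEQ_le_const[OF \<phi>(2)]) (use J_inf_test[OF \<phi>(1)] in blast)
qed

text \<open>
  Along multiples \<open>s u\<close> of the first eigenfunction the quadratic part of the functional is nonpositive,
  and for small \<open>s\<close> the critical term of order \<open>s powr p\<close> beats the Kirchhoff term of order \<open>s powr (2 * \<gamma>)\<close>.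
\<close>
lemma J_inf_neg: "J_inf < 0"
proof -
  obtain u G where u: "sobolev_pair u G" "(\<integral>x. (u x)\<^sup>2 \<partial>M) = 1" "(\<integral>x. (norm (G x))\<^sup>2 \<partial>M) = first_dirichlet_eigenvalue \<Omega>"
    by (rule first_eigenfunction)
  define m where "m = first_dirichlet_eigenvalue \<Omega>"
  have m: "m \<ge> 0" unfolding m_def u(3)[symmetric] by (rule integral_square_nonneg)
  define P where "P = (\<integral>x. \<bar>u x\<bar> powr p \<partial>M)"
  have "P \<ge> 0" unfolding P_def by (intro integral_nonneg_AE) auto
  moreover have "P \<noteq> 0" using ae_equal_0_iff_powr[OF u(1)] ae_equal_0_iff[OF sobolev_pairD(1)[OF u(1)]] u(2) by (simp add: P_def)
  ultimately have P: "P > 0" by linarith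
  define c where "c = b / (2 * \<gamma>) * m powr \<gamma>"
  have c: "c \<ge> 0" using b_pos \<gamma>_gt_1 by (simp add: c_def)
  \<comment> \<open>Solves \<open>s powr (2 * \<gamma> - p) * (c + 1) = P / p\<close>; the summand 1
    makes the comparison with \<open>c\<close> strict and covers \<open>c = 0\<close>.\<close>
  define s where "s = (P / p / (c + 1)) powr (1 / (2 * \<gamma> - p))"
  have s: "s > 0" using P p_gt_2 c by (simp add: s_def)
  have "s powr (2 * \<gamma> - p) = P / p / (c + 1)" using P p_gt_2 c \<gamma>_gt by (simp add: s_def powr_powr)
  moreover have "P / p * (c / (c + 1)) < P / p * 1" using P p_gt_2 c by (intro mult_strict_left_mono) auto
  ultimately have "s powr (2 * \<gamma> - p) * c < P / p" by simp
  then have "s powr p * (s powr (2 * \<gamma> - p) * c) < s powr p * (P / p)" using s by (intro mult_strict_left_mono) auto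
  then have small: "s powr (2 * \<gamma>) * c < s powr p * (P / p)"
    by (simp add: mult.assoc[symmetric] powr_add[symmetric])
  have pair: "sobolev_pair (\<lambda>x. s * u x) (\<lambda>x. s *\<^sub>R G x)"
    using sobolev_pair_lincomb[OF u(1,1), of s 0] by simp
  have n: "(\<integral>x. (norm (s *\<^sub>R G x))\<^sup>2 \<partial>M) = s\<^sup>2 * m" using u(3) by (simp add: power_mult_distrib m_def)
  have "J (\<lambda>x. s * u x) (\<lambda>x. s *\<^sub>R G x) = \<Phi> (s\<^sup>2 * m) - lam / 2 * s\<^sup>2 - 1 / p * (s powr p * P)"
    unfolding J_def n using u(2) s by (simp add: power_mult_distrib abs_mult powr_mult P_def)
  also have "\<Phi> (s\<^sup>2 * m) = a / 2 * (s\<^sup>2 * m) + s powr (2 * \<gamma>) * c"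
  proof -
    have "(s\<^sup>2) powr \<gamma> = s powr (2 * \<gamma>)" using s by (simp add: powr_powr flip: powr_numeral)
    then show ?thesis using m by (simp add: kirchhoff_primitive_def c_def powr_mult)
  qed
  also have "a / 2 * (s\<^sup>2 * m) + s powr (2 * \<gamma>) * c - lam / 2 * s\<^sup>2 - 1 / p * (s powr p * P) =
      s\<^sup>2 / 2 * (a * m - lam) + (s powr (2 * \<gamma>) * c - s powr p * (P / p))"
    by (simp add: field_simps)
  also have "\<dots> < 0"
  proof -
    have "s\<^sup>2 / 2 * (a * m - lam) \<le> 0" using lam_ge by (intro mult_nonneg_nonpos) (auto simp: m_def)
    then show ?thesis using small by linarith
  qed
  finally show ?thesis using J_inf_pair[OF pair] by linarith
qed

text \<open>
  Lower semicontinuity along the minimising sequence: the energy \<open>B\<close> lost in the weak limit costs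
  \<open>\<Phi> B\<close> by superadditivity, while by the Brezis-Lieb lemma it gains at most
  \<open>\<kappa> / p * B powr (p / 2)\<close> in the critical term, which is no more than \<open>\<Phi> B\<close>.
\<close>
theorem J_minimizer:
  obtains u G where "sobolev_pair u G" "J u G = J_inf"
proof -
  obtain T L where T: "T \<ge> 0" and "\<And>\<phi>. \<phi> \<in> test_functions \<Omega> \<Longrightarrow> J \<phi> (gradient \<phi>) \<ge> L"
    and TE: "\<And>\<phi>. \<lbrakk>\<phi> \<in> test_functions \<Omega>; J \<phi> (gradient \<phi>) < 0\<rbrakk> \<Longrightarrow> energy \<phi> \<le> T" using J_coercive by blast
  \<comment> \<open>The slack is measured in units of \<open>- J_inf\<close>, so it never exceeds
    \<open>- J_inf\<close>. Thus every member of the sequence has negative \<open>J\<close>, which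
    is what the energy bound of \<open>J_coercive\<close> asks for.\<close>
  have "\<exists>\<phi>. \<phi> \<in> test_functions \<Omega> \<and> J \<phi> (gradient \<phi>) < J_inf + (- J_inf) * (1 / real (Suc n))" for n
  proof -
    have "J_inf < J_inf + (- J_inf) * (1 / real (Suc n))" using mult_pos_pos[of "- J_inf" "1 / real (Suc n)"] J_inf_neg by simp
    then have "\<exists>y\<in>(\<lambda>\<phi>. J \<phi> (gradient \<phi>)) ` test_functions \<Omega>. y < J_inf + (- J_inf) * (1 / real (Suc n))"
      unfolding J_inf_def using test_functions_0 by (intro cInf_lessD) auto
    then show ?thesis by blast
  qed
  then have "\<exists>\<phi>. \<forall>n. \<phi> n \<in> test_functions \<Omega> \<and> J (\<phi> n) (gradient (\<phi> n)) < J_inf + (- J_inf) * (1 / real (Suc n))"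
    by (intro choice allI)
  then obtain \<phi> where "\<forall>n. \<phi> n \<in> test_functions \<Omega> \<and> J (\<phi> n) (gradient (\<phi> n)) < J_inf + (- J_inf) * (1 / real (Suc n))"
    by (rule exE)
  then have \<phi>: "\<And>n. \<phi> n \<in> test_functions \<Omega>" "\<And>n. J (\<phi> n) (gradient (\<phi> n)) < J_inf + (- J_inf) * (1 / real (Suc n))" by simp_all
  have ET: "energy (\<phi> n) \<le> T" for n
  proof (rule TE[OF \<phi>(1)])
    have "(- J_inf) * (1 / real (Suc n)) \<le> (- J_inf) * 1" using J_inf_neg by (intro mult_left_mono) auto
    then show "J (\<phi> n) (gradient (\<phi> n)) < 0" using \<phi>(2)[of n] by linarith
  qed
  obtain r u G where r: "strict_mono (r :: nat \<Rightarrow> nat)" "sobolev_pair u G"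
    "(\<lambda>n. \<integral>x. (norm (u x - \<phi> (r n) x))\<^sup>2 \<partial>M) \<longlonglongrightarrow> 0" "AE x in M. (\<lambda>n. \<phi> (r n) x) \<longlonglongrightarrow> u x"
    "(\<lambda>n. energy (\<phi> (r n)) - (\<integral>x. (norm (gradient (\<phi> (r n)) x - G x))\<^sup>2 \<partial>M)) \<longlonglongrightarrow> (\<integral>x. (norm (G x))\<^sup>2 \<partial>M)"
    by (rule weak_compactness[OF \<phi>(1) ET])
  note s = sobolev_pairD[OF r(2)]
  note t = test_function_square_integrable(1,2)[OF \<phi>(1)]
  let ?A = "\<integral>x. (norm (G x))\<^sup>2 \<partial>M"
  have A: "?A \<ge> 0" by (rule integral_square_nonneg)
  define B where "B n = (\<integral>x. (norm (gradient (\<phi> (r n)) x - G x))\<^sup>2 \<partial>M)" for n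
  have B0: "B n \<ge> 0" for n unfolding B_def by (rule integral_square_nonneg)
  define Bd where "Bd = 2 * T + 2 * ?A"
  have BT: "B n \<le> Bd" for n
  proof -
    have "(\<integral>x. (norm (gradient (\<phi> (r n)) x + (-1) *\<^sub>R G x))\<^sup>2 \<partial>M) \<le>
      2 * (\<integral>x. (norm (gradient (\<phi> (r n)) x))\<^sup>2 \<partial>M) + 2 * (\<integral>x. (norm ((-1) *\<^sub>R G x))\<^sup>2 \<partial>M)"
      by (intro integral_square_add_le square_integrable_scaleR t s)
    then show ?thesis using ET[of "r n"] by (simp add: B_def Bd_def energy_def)
  qed
  \<comment> \<open>A further subsequence makes the lost energies converge, to
    \<open>l\<close>.\<close>
  have "seq_compact {0..Bd}" by (intro compact_imp_seq_compact) simp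
  moreover have "\<forall>n. B n \<in> {0..Bd}" using B0 BT by simp
  ultimately obtain l q where l: "l \<in> {0..Bd}" and q: "strict_mono q" "(B \<circ> q) \<longlonglongrightarrow> l"
    by (rule seq_compactE)
  define w where "w n = \<phi> (r (q n))" for n
  have wt: "w n \<in> test_functions \<Omega>" for n by (simp add: w_def \<phi>(1))
  have Bl: "(\<lambda>n. B (q n)) \<longlonglongrightarrow> l" using q(2) by (simp add: o_def)
  have "(\<lambda>n. energy (w n) - B (q n)) \<longlonglongrightarrow> ?A"
    using LIMSEQ_subseq_LIMSEQ[OF r(5) q(1)] by (simp add: o_def w_def B_def)
  from tendsto_add[OF this Bl] have en: "(\<lambda>n. energy (w n)) \<longlonglongrightarrow> ?A + l" by simp
  have l2: "(\<lambda>n. \<integral>x. (norm (u x - w n x))\<^sup>2 \<partial>M) \<longlonglongrightarrow> 0"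
    using LIMSEQ_subseq_LIMSEQ[OF r(3) q(1)] by (simp add: o_def w_def)
  have sq: "(\<lambda>n. \<integral>x. (w n x)\<^sup>2 \<partial>M) \<longlonglongrightarrow> (\<integral>x. (u x)\<^sup>2 \<partial>M)"
    using L2_tendsto_norm[OF test_function_square_integrable(1)[OF wt] s(1) l2] by simp
  have dp: "sobolev_pair (\<lambda>x. w n x - u x) (\<lambda>x. gradient (w n) x - G x)" for n
    using sobolev_pair_lincomb[OF sobolev_pair_test[OF wt] r(2), of 1 n "-1"] by simp
  have dpl: "(\<integral>x. \<bar>w n x - u x\<bar> powr p \<partial>M) \<le> \<kappa> * B (q n) powr (p / 2)" for n
    using sobolev_const_ineq[OF dp[of n]] by (simp add: \<kappa>_def B_def w_def)
  note [measurable] = square_integrable_measurable[OF s(1)] square_integrable_measurable[OF test_function_square_integrable(1)[OF wt]]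
  have BL: "(\<lambda>n. (\<integral>x. \<bar>w n x\<bar> powr p \<partial>M) - (\<integral>x. \<bar>w n x - u x\<bar> powr p \<partial>M)) \<longlonglongrightarrow> (\<integral>x. \<bar>u x\<bar> powr p \<partial>M)"
  proof (rule Brezis_Lieb)
    show "AE x in M. (\<lambda>n. w n x) \<longlonglongrightarrow> u x"
      using r(4)
    proof eventually_elim
      case (elim x)
      from LIMSEQ_subseq_LIMSEQ[OF this q(1)] show ?case by (simp add: o_def w_def)
    qed
    show "(\<integral>x. \<bar>w n x - u x\<bar> powr p \<partial>M) \<le> \<kappa> * Bd powr (p / 2)" for n
      using dpl[of n] B0 BT p_gt_2 \<kappa>_nonneg by (rule_tac order_trans) (auto intro!: mult_left_mono powr_mono2)
  qed (use p_gt_2 sobolev_pair_integrable_powr[OF r(2)] sobolev_pair_integrable_powr[OF dp]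
       sobolev_pair_integrable_powr[OF sobolev_pair_test[OF wt]] in auto)
  \<comment> \<open>This is \<open>J\<close> of \<open>w n\<close> plus the critical term of
    \<open>w n - u\<close> minus \<Phi> of the lost energy. By the domination
    \<open>\<Phi>_lower\<close> it is at most \<open>J\<close> of \<open>w n\<close>, and unlike the
    critical term alone, every group in it has a known limit.\<close>
  let ?K = "\<lambda>n. \<Phi> (energy (w n)) - lam / 2 * (\<integral>x. (w n x)\<^sup>2 \<partial>M) -
    1 / p * ((\<integral>x. \<bar>w n x\<bar> powr p \<partial>M) - (\<integral>x. \<bar>w n x - u x\<bar> powr p \<partial>M)) - \<Phi> (B (q n))"
  have lim: "?K \<longlonglongrightarrow> \<Phi> (?A + l) - lam / 2 * (\<integral>x. (u x)\<^sup>2 \<partial>M) - 1 / p * (\<integral>x. \<bar>u x\<bar> powr p \<partial>M) - \<Phi> l"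
    by (intro tendsto_diff tendsto_mult tendsto_const \<Phi>_tendsto en sq BL Bl energy_nonneg B0)
  have "(\<lambda>n. J_inf + (- J_inf) * (1 / real (Suc n))) \<longlonglongrightarrow> J_inf + (- J_inf) * 0"
    using LIMSEQ_inverse_real_of_nat by (intro tendsto_intros) (simp add: inverse_eq_divide)
  then have limI: "(\<lambda>n. J_inf + (- J_inf) * (1 / real (Suc n))) \<longlonglongrightarrow> J_inf" by simp
  have "?K n \<le> J_inf + (- J_inf) * (1 / real (Suc n))" for n
  proof -
    have "1 / p * (\<integral>x. \<bar>w n x - u x\<bar> powr p \<partial>M) \<le> 1 / p * (\<kappa> * B (q n) powr (p / 2))"
      using dpl p_gt_2 by (intro mult_left_mono) auto
    also have "\<dots> \<le> \<Phi> (B (q n))" using \<Phi>_lower[OF B0, of "q n"] by simp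
    finally have "?K n \<le> J (w n) (gradient (w n))"
      by (simp add: J_def energy_def algebra_simps)
    moreover have "(- J_inf) * (1 / real (Suc (r (q n)))) \<le> (- J_inf) * (1 / real (Suc n))"
    proof (rule mult_left_mono)
      have "n \<le> r (q n)" using seq_suble[OF q(1), of n] seq_suble[OF r(1), of "q n"] by linarith
      then show "1 / real (Suc (r (q n))) \<le> 1 / real (Suc n)" by (simp add: frac_le)
    qed (use J_inf_neg in simp)
    ultimately show ?thesis using \<phi>(2)[of "r (q n)"] by (simp add: w_def)
  qed
  then have "\<Phi> (?A + l) - lam / 2 * (\<integral>x. (u x)\<^sup>2 \<partial>M) - 1 / p * (\<integral>x. \<bar>u x\<bar> powr p \<partial>M) - \<Phi> l \<le> J_inf"
    by (intro LIMSEQ_le[OF lim limI]) blast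
  moreover have "\<Phi> ?A + \<Phi> l \<le> \<Phi> (?A + l)"
    using l A b_pos \<gamma>_gt_1 by (intro kirchhoff_primitive_superadditive) auto
  ultimately have "J u G \<le> J_inf" by (simp add: J_def)
  then show ?thesis using that[OF r(2)] J_inf_pair[OF r(2)] by simp
qed

text \<open>Limit of the nonnegative difference quotients of the functional at the minimiser in the
  direction \<open>v\<close>.\<close>

lemma J_minimizer_inequality:
  assumes u: "sobolev_pair u G" "J u G = J_inf" and v: "sobolev_pair v H"
  shows "0 \<le> (a + b * (\<integral>x. (norm (G x))\<^sup>2 \<partial>M) powr (\<gamma> - 1)) * (\<integral>x. G x \<bullet> H x \<partial>M) -
    lam * (\<integral>x. u x * v x \<partial>M) - (\<integral>x. \<bar>u x\<bar> powr (p - 2) * u x * v x \<partial>M)"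
proof -
  note su = sobolev_pairD[OF u(1)] and sv = sobolev_pairD[OF v]
  let ?A = "\<integral>x. (norm (G x))\<^sup>2 \<partial>M" and ?\<beta> = "\<integral>x. G x \<bullet> H x \<partial>M" and ?C = "\<integral>x. (norm (H x))\<^sup>2 \<partial>M"
  let ?s = "\<lambda>n. 1 / real (Suc n)"
  \<comment> \<open>\<Phi> is differentiated only at positive arguments. At zero energy the
    minimiser would vanish almost everywhere and \<open>J\<close> would be 0 instead of
    negative.\<close>
  have "?A \<noteq> 0"
  proof
    assume A: "?A = 0"
    have "(\<integral>x. \<bar>u x\<bar> powr p \<partial>M) \<le> 0" using sobolev_const_ineq[OF u(1)] A p_gt_2 by simp
    moreover have "(\<integral>x. \<bar>u x\<bar> powr p \<partial>M) \<ge> 0" by (intro integral_nonneg_AE) auto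
    ultimately have P: "(\<integral>x. \<bar>u x\<bar> powr p \<partial>M) = 0" by simp
    then have "(\<integral>x. (u x)\<^sup>2 \<partial>M) = 0" using ae_equal_0_iff_powr[OF u(1)] ae_equal_0_iff[OF su(1)] by simp
    then have "J u G = 0" using A P by (simp add: J_def kirchhoff_primitive_def)
    then show False using u(2) J_inf_neg by simp
  qed
  then have A: "?A > 0" using integral_square_nonneg[of M G] by linarith
  have pair: "sobolev_pair (\<lambda>x. u x + s * v x) (\<lambda>x. G x + s *\<^sub>R H x)" for s
    using sobolev_pair_lincomb[OF u(1) v, of 1 s] by simp
  have nG: "(\<integral>x. (norm (G x + s *\<^sub>R H x))\<^sup>2 \<partial>M) = ?A + 2 * s * ?\<beta> + s\<^sup>2 * ?C" for s
    using square_integrable_lincomb(2)[OF su(2) sv(2), of 1 s] by simp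
  have nu: "(\<integral>x. (u x + s * v x)\<^sup>2 \<partial>M) = (\<integral>x. (u x)\<^sup>2 \<partial>M) + 2 * s * (\<integral>x. u x * v x \<partial>M) + s\<^sup>2 * (\<integral>x. (v x)\<^sup>2 \<partial>M)" for s
    using square_integrable_lincomb(2)[OF su(1) sv(1), of 1 s] by simp
  have "((\<lambda>s. \<Phi> (?A + 2 * s * ?\<beta> + s\<^sup>2 * ?C)) has_real_derivative
      (a + b * (?A + 2 * 0 * ?\<beta> + 0\<^sup>2 * ?C) powr (\<gamma> - 1)) / 2 * (2 * ?\<beta>)) (at 0)"
    by (rule DERIV_chain2[OF DERIV_kirchhoff_primitive]) (use A \<gamma>_gt_1 in \<open>auto intro!: derivative_eq_intros\<close>)
  from difference_quotient_sequence[OF this]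
  have d1: "(\<lambda>n. (\<Phi> (\<integral>x. (norm (G x + ?s n *\<^sub>R H x))\<^sup>2 \<partial>M) - \<Phi> ?A) / ?s n) \<longlonglongrightarrow> (a + b * ?A powr (\<gamma> - 1)) * ?\<beta>"
    unfolding nG by simp
  have "((\<lambda>s. (\<integral>x. (u x)\<^sup>2 \<partial>M) + 2 * s * (\<integral>x. u x * v x \<partial>M) + s\<^sup>2 * (\<integral>x. (v x)\<^sup>2 \<partial>M)) has_real_derivative
      2 * (\<integral>x. u x * v x \<partial>M)) (at 0)"
    by (auto intro!: derivative_eq_intros)
  from difference_quotient_sequence[OF this]
  have d2: "(\<lambda>n. ((\<integral>x. (u x + ?s n * v x)\<^sup>2 \<partial>M) - (\<integral>x. (u x)\<^sup>2 \<partial>M)) / ?s n) \<longlonglongrightarrow> 2 * (\<integral>x. u x * v x \<partial>M)"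
    unfolding nu by simp
  have d3: "(\<lambda>n. ((\<integral>x. \<bar>u x + ?s n * v x\<bar> powr p \<partial>M) - (\<integral>x. \<bar>u x\<bar> powr p \<partial>M)) / ?s n)
    \<longlonglongrightarrow> (\<integral>x. p * (\<bar>u x\<bar> powr (p - 2) * u x * v x) \<partial>M)"
    using p_gt_2 square_integrable_measurable[OF su(1)] square_integrable_measurable[OF sv(1)]
      sobolev_pair_integrable_powr[OF u(1)] sobolev_pair_integrable_powr[OF v] sobolev_pair_integrable_powr[OF pair]
    by (intro integral_abs_powr_derivative) auto
  have "(\<lambda>n. (\<Phi> (\<integral>x. (norm (G x + ?s n *\<^sub>R H x))\<^sup>2 \<partial>M) - \<Phi> ?A) / ?s n
      - lam / 2 * (((\<integral>x. (u x + ?s n * v x)\<^sup>2 \<partial>M) - (\<integral>x. (u x)\<^sup>2 \<partial>M)) / ?s n)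
      - 1 / p * (((\<integral>x. \<bar>u x + ?s n * v x\<bar> powr p \<partial>M) - (\<integral>x. \<bar>u x\<bar> powr p \<partial>M)) / ?s n))
    \<longlonglongrightarrow> (a + b * ?A powr (\<gamma> - 1)) * ?\<beta> - lam / 2 * (2 * (\<integral>x. u x * v x \<partial>M)) -
      1 / p * (\<integral>x. p * (\<bar>u x\<bar> powr (p - 2) * u x * v x) \<partial>M)"
    by (intro tendsto_diff tendsto_mult tendsto_const d1 d2 d3)
  then have "0 \<le> (a + b * ?A powr (\<gamma> - 1)) * ?\<beta> - lam / 2 * (2 * (\<integral>x. u x * v x \<partial>M)) -
      1 / p * (\<integral>x. p * (\<bar>u x\<bar> powr (p - 2) * u x * v x) \<partial>M)"
  proof (rule LIMSEQ_le_const, intro exI[of _ 0] allI impI)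
    fix n
    have "J u G \<le> J (\<lambda>x. u x + ?s n * v x) (\<lambda>x. G x + ?s n *\<^sub>R H x)"
      unfolding u(2) by (rule J_inf_pair[OF pair])
    then have "0 \<le> (J (\<lambda>x. u x + ?s n * v x) (\<lambda>x. G x + ?s n *\<^sub>R H x) - J u G) / ?s n" by simp
    also have "\<dots> = (\<Phi> (\<integral>x. (norm (G x + ?s n *\<^sub>R H x))\<^sup>2 \<partial>M) - \<Phi> ?A) / ?s n
      - lam / 2 * (((\<integral>x. (u x + ?s n * v x)\<^sup>2 \<partial>M) - (\<integral>x. (u x)\<^sup>2 \<partial>M)) / ?s n)
      - 1 / p * (((\<integral>x. \<bar>u x + ?s n * v x\<bar> powr p \<partial>M) - (\<integral>x. \<bar>u x\<bar> powr p \<partial>M)) / ?s n)"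
      unfolding J_def by (simp only: divide_inverse) (simp only: algebra_simps)
    finally show "0 \<le> (\<Phi> (\<integral>x. (norm (G x + ?s n *\<^sub>R H x))\<^sup>2 \<partial>M) - \<Phi> ?A) / ?s n
      - lam / 2 * (((\<integral>x. (u x + ?s n * v x)\<^sup>2 \<partial>M) - (\<integral>x. (u x)\<^sup>2 \<partial>M)) / ?s n)
      - 1 / p * (((\<integral>x. \<bar>u x + ?s n * v x\<bar> powr p \<partial>M) - (\<integral>x. \<bar>u x\<bar> powr p \<partial>M)) / ?s n)" .
  qed
  then show ?thesis using p_gt_2 by simp
qed

text \<open>The inequality for \<open>v\<close> and for \<open>- v\<close>.\<close>

lemma J_minimizer_equation:
  assumes u: "sobolev_pair u G" "J u G = J_inf" and v: "sobolev_pair v H"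
  shows "(a + b * (\<integral>x. (norm (G x))\<^sup>2 \<partial>M) powr (\<gamma> - 1)) * (\<integral>x. G x \<bullet> H x \<partial>M) =
    lam * (\<integral>x. u x * v x \<partial>M) + (\<integral>x. \<bar>u x\<bar> powr (p - 2) * u x * v x \<partial>M)"
proof -
  have v': "sobolev_pair (\<lambda>x. - v x) (\<lambda>x. - H x)"
    using sobolev_pair_lincomb[OF v v, of "-1" 0] by simp
  show ?thesis
    using J_minimizer_inequality[OF u v] J_minimizer_inequality[OF u v'] by simp
qed

lemma J_minimizer_weak_solution:
  assumes u: "sobolev_pair u G" "J u G = J_inf"
  shows "weak_solution \<Omega> a b \<gamma> lam u"
  unfolding weak_solution_def p_eq[symmetric]
proof (intro conjI ballI)
  show "u \<in> H10 \<Omega>" using u(1) H10_iff by blast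
  fix v assume "v \<in> H10 \<Omega>"
  then obtain H where v: "sobolev_pair v H" using H10_iff by blast
  show "(a + b * dirichlet_energy \<Omega> u powr (\<gamma> - 1)) * dirichlet_form \<Omega> u v =
    lam * (\<integral>x. u x * v x \<partial>M) + (\<integral>x. \<bar>u x\<bar> powr (p - 2) * u x * v x \<partial>M)"
    unfolding sobolev_pair_dirichlet_energy[OF u(1)] sobolev_pair_dirichlet_form[OF u(1) v]
    by (rule J_minimizer_equation[OF u v])
qed

lemma ex_two_weak_solutions:
  "\<exists>u v. weak_solution \<Omega> a b \<gamma> lam u \<and> \<not> ae_equal \<Omega> u (\<lambda>_. 0) \<and>
         weak_solution \<Omega> a b \<gamma> lam v \<and> \<not> ae_equal \<Omega> v (\<lambda>_. 0) \<and> \<not> ae_equal \<Omega> u v"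
proof -
  obtain u G where u: "sobolev_pair u G" "J u G = J_inf" by (rule J_minimizer)
  have u': "sobolev_pair (\<lambda>x. - u x) (\<lambda>x. - G x)"
    using sobolev_pair_lincomb[OF u(1,1), of "-1" 0] by simp
  have J': "J (\<lambda>x. - u x) (\<lambda>x. - G x) = J_inf" using u(2) by (simp add: J_def)
  have nz: "\<not> ae_equal \<Omega> u (\<lambda>_. 0)"
  proof
    assume "ae_equal \<Omega> u (\<lambda>_. 0)"
    \<comment> \<open>Only the terms in \<open>u\<close> are used to vanish here; for the term in
      \<open>G\<close> nonnegativity of \<Phi> is enough to contradict
      \<open>J_inf_neg\<close>.\<close>
    then have "J u G = \<Phi> (\<integral>x. (norm (G x))\<^sup>2 \<partial>M)"
      using ae_equal_0_iff[OF sobolev_pairD(1)[OF u(1)]] ae_equal_0_iff_powr[OF u(1)] by (simp add: J_def)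
    then show False using \<Phi>_nonneg[OF integral_square_nonneg[of M G]] u(2) J_inf_neg by simp
  qed
  \<comment> \<open>If \<open>u\<close> and \<open>- u\<close> agreed almost everywhere,
    \<open>u\<close> would vanish almost everywhere.\<close>
  then have "\<not> ae_equal \<Omega> (\<lambda>x. - u x) (\<lambda>_. 0)" "\<not> ae_equal \<Omega> u (\<lambda>x. - u x)"
    by (simp_all add: ae_equal_def equal_neg_zero)
  then show ?thesis
    using J_minimizer_weak_solution[OF u] J_minimizer_weak_solution[OF u' J'] nz by blast
qed

end

theorem theorem1p8:
  fixes \<Omega> :: "(real^'n) set" and a b \<gamma> lam p :: real
  assumes "CARD('n) \<ge> 3"
    and "open \<Omega>" "connected \<Omega>" "bounded \<Omega>" "\<Omega> \<noteq> {}"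
    and "p = critical_exponent CARD('n)"
    and "a \<ge> 0" "b > 0" "\<gamma> > p / 2"
    and "a powr (\<gamma> - p / 2) * b powr (p / 2 - 1) >
         (\<gamma> - p / 2) powr (\<gamma> - p / 2) * (p / 2 - 1) powr (p / 2 - 1) / (\<gamma> - 1) powr (\<gamma> - 1)
         * sobolev_const \<Omega> powr (- (p / 2) * (\<gamma> - 1))"
    and "lam \<ge> a * first_dirichlet_eigenvalue \<Omega>"
  shows "\<exists>u v. weak_solution \<Omega> a b \<gamma> lam u \<and> \<not> ae_equal \<Omega> u (\<lambda>_. 0) \<and>
               weak_solution \<Omega> a b \<gamma> lam v \<and> \<not> ae_equal \<Omega> v (\<lambda>_. 0) \<and>
               \<not> ae_equal \<Omega> u v"
proof -
  interpret kirchhoff_problem \<Omega> p a b \<gamma> lam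
    by unfold_locales (use assms in auto)
  show ?thesis by (rule ex_two_weak_solutions)
qed

end
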